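(* Let $k=\mathbb{F}_q$ be a finite field, $Q$ a finite acyclic quiver, $A=kQ$, and let $\mathcal{H}(C_1(\mathscr{P}))$ be the Hall algebra of the exact category $C_1(\mathscr{P})$ of 1-cyclic complexes of finite dimensional projective $A$-modules. Let $S:=\{[X^\cdot]\mid X^\cdot\in C_1(\mathscr{P})\text{ is indecomposable}\}$. Then $S$ is a universal PBW-basis of $\mathcal{H}(C_1(\mathscr{P}))$; that is, for any total order $\leq$ on $S$, the ordered monomials $[X^\cdot_1]^{a_1}[X^\cdot_2]^{a_2}\cdots[X^\cdot_N]^{a_N}$, where $[X^\cdot_1]\leq[X^\cdot_2]\leq\cdots\leq[X^\cdot_N]$ are isoclasses of pairwise non-isomorphic indecomposable objects and $a_i\in\mathbb{N}$ (one monomial for each finitely supported function $S\to\mathbb{N}$; when $S$ is finite, $[X_1^\cdot],\dots,[X_N^\cdot]$ may be taken to be all elements of $S$), together with the unit $[0]$ (the monomial with all exponents zero), form a basis of $\mathcal{H}(C_1(\mathscr{P}))$.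
   Context: $A$-modules are finite dimensional left modules; $\mathscr{P}$ is the category of finite dimensional projective $A$-modules. A 1-cyclic complex of $A$-modules is a pair $(M,d)$ with $M$ an $A$-module and $d\in\operatorname{End}_A(M)$, $d^2=0$; a morphism $f:(M,d)\to(M',d')$ is an $A$-homomorphism with $d'f=fd$. $C_1(\mathscr{P})$ is the category of 1-cyclic complexes $(M,d)$ with $M\in\mathscr{P}$; its exact structure consists of the sequences which are short exact on underlying modules. $[X]$ denotes the isomorphism class (isoclass) of $X$. Hall numbers: for objects $X,Y,Z$, let $W_{XY}^Z$ be the set of pairs $(\varphi,\psi)$ with $0\to Y\xrightarrow{\varphi}Z\xrightarrow{\psi}X\to0$ exact in $C_1(\mathscr{P})$, and $F_{XY}^Z:=|W_{XY}^Z|/(|\operatorname{Aut}X|\cdot|\operatorname{Aut}Y|)$. The Hall algebra $\mathcal{H}(C_1(\mathscr{P}))$ is the $\mathbb{C}$-vector space with basis the isoclasses $[X]$ of objects and multiplication $[X]\cdot[Y]=\sum_{[Z]}F_{XY}^Z[Z]$; its unit is $[0]$. *)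

theory Defs
  imports
    Complex_Main
    "HOL-Library.Poly_Mapping"
    "HOL-Algebra.Module"
    "Graph_Theory.Arc_Walk"
begin

section \<open>Path algebras\<close>

text \<open>
  A finite quiver is a finite directed multigraph (\<^locale>\<open>fin_digraph\<close>). A path of the quiver is a
  triple (source, list of arrows, target); the trivial path at u is (u, [], u). Elements of the
  path algebra are finitely supported coefficient functions on the paths, with value zero on
  triples that are not paths. Products are composed like maps: the product of a path q with a
  path p is "first p, then q" when p ends where q starts, and zero otherwise. With this order left
  modules over the path algebra are covariant representations of the quiver. The scalar
  multiplication of the record is that of the base field.
\<close>

type_synonym ('v, 'e) qpath = "'v \<times> 'e list \<times> 'v"

definition qpaths :: "('v, 'e) pre_digraph \<Rightarrow> ('v, 'e) qpath set" where
  "qpaths Q = {(u, p, v). pre_digraph.awalk Q u p v}"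

definition path_algebra ::
  "('k, 'x) ring_scheme \<Rightarrow> ('v, 'e) pre_digraph \<Rightarrow> ('k, ('v, 'e) qpath \<Rightarrow> 'k) module" where
  "path_algebra K Q =
    \<lparr>carrier = {f. (\<forall>r. f r \<in> carrier K) \<and> (\<forall>r. r \<notin> qpaths Q \<longrightarrow> f r = \<zero>\<^bsub>K\<^esub>)
                   \<and> finite {r. f r \<noteq> \<zero>\<^bsub>K\<^esub>}},
     mult = (\<lambda>f g (u, r, w).
       finsum K (\<lambda>(p, v, q). f (v, q, w) \<otimes>\<^bsub>K\<^esub> g (u, p, v))
         {(p, v, q). (u, p, v) \<in> qpaths Q \<and> (v, q, w) \<in> qpaths Q \<and> p @ q = r}),
     one = (\<lambda>(u, r, w). if (u, r, w) \<in> qpaths Q \<and> r = [] then \<one>\<^bsub>K\<^esub> else \<zero>\<^bsub>K\<^esub>),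
     zero = (\<lambda>_. \<zero>\<^bsub>K\<^esub>),
     add = (\<lambda>f g r. f r \<oplus>\<^bsub>K\<^esub> g r),
     smult = (\<lambda>c f r. c \<otimes>\<^bsub>K\<^esub> f r)\<rparr>"

section \<open>Finite dimensional left modules\<close>

text \<open>
  The library's \<^locale>\<open>Module.module\<close> needs a commutative ring, so its axioms are restated here over an
  arbitrary ring. As for that locale, the fields mult and one of a module record have no meaning.
\<close>

locale left_module = A?: ring A + M?: abelian_group M
  for A (structure) and M :: "('a, 'm) module" (structure) +
  assumes smult_closed:
      "a \<in> carrier A \<Longrightarrow> x \<in> carrier M \<Longrightarrow> a \<odot>\<^bsub>M\<^esub> x \<in> carrier M"
    and smult_l_distr:
      "a \<in> carrier A \<Longrightarrow> b \<in> carrier A \<Longrightarrow> x \<in> carrier M \<Longrightarrow>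
        (a \<oplus>\<^bsub>A\<^esub> b) \<odot>\<^bsub>M\<^esub> x = a \<odot>\<^bsub>M\<^esub> x \<oplus>\<^bsub>M\<^esub> b \<odot>\<^bsub>M\<^esub> x"
    and smult_r_distr:
      "a \<in> carrier A \<Longrightarrow> x \<in> carrier M \<Longrightarrow> y \<in> carrier M \<Longrightarrow>
        a \<odot>\<^bsub>M\<^esub> (x \<oplus>\<^bsub>M\<^esub> y) = a \<odot>\<^bsub>M\<^esub> x \<oplus>\<^bsub>M\<^esub> a \<odot>\<^bsub>M\<^esub> y"
    and smult_assoc1:
      "a \<in> carrier A \<Longrightarrow> b \<in> carrier A \<Longrightarrow> x \<in> carrier M \<Longrightarrow>
        (a \<otimes>\<^bsub>A\<^esub> b) \<odot>\<^bsub>M\<^esub> x = a \<odot>\<^bsub>M\<^esub> (b \<odot>\<^bsub>M\<^esub> x)"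
    and smult_one: "x \<in> carrier M \<Longrightarrow> \<one>\<^bsub>A\<^esub> \<odot>\<^bsub>M\<^esub> x = x"

text \<open>
  The field acts on a module through the multiples of the unit of the algebra; finite dimensional
  means that finitely many elements span over the field.
\<close>

definition fd_module ::
  "('k, 'x) ring_scheme \<Rightarrow> ('k, 'a) module \<Rightarrow> ('a, 'm) module \<Rightarrow> bool" where
  "fd_module K A M \<longleftrightarrow> left_module A M \<and>
    (\<exists>B. finite B \<and> B \<subseteq> carrier M \<and>
      (\<forall>x \<in> carrier M. \<exists>c \<in> B \<rightarrow> carrier K.
         x = (\<Oplus>\<^bsub>M\<^esub>b \<in> B. (c b \<odot>\<^bsub>A\<^esub> \<one>\<^bsub>A\<^esub>) \<odot>\<^bsub>M\<^esub> b)))"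

text \<open>
  Homomorphisms are extensional functions, so that they can be counted.
\<close>

definition mod_hom ::
  "('k, 'a) module \<Rightarrow> ('a, 'm) module \<Rightarrow> ('a, 'n) module \<Rightarrow> ('m \<Rightarrow> 'n) set" where
  "mod_hom A M N = {f \<in> carrier M \<rightarrow>\<^sub>E carrier N.
     (\<forall>x \<in> carrier M. \<forall>y \<in> carrier M. f (x \<oplus>\<^bsub>M\<^esub> y) = f x \<oplus>\<^bsub>N\<^esub> f y) \<and>
     (\<forall>a \<in> carrier A. \<forall>x \<in> carrier M. f (a \<odot>\<^bsub>M\<^esub> x) = a \<odot>\<^bsub>N\<^esub> f x)}"

text \<open>
  Projective objects of the category of finite dimensional modules. The test modules live on
  subsets of the natural numbers. This is no restriction over a finite field: there every finite
  dimensional module is a finite set, hence isomorphic to one carried by a set of naturals.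
\<close>

definition projective ::
  "('k, 'x) ring_scheme \<Rightarrow> ('k, 'a) module \<Rightarrow> ('a, 'm) module \<Rightarrow> bool" where
  "projective K A P \<longleftrightarrow> fd_module K A P \<and>
    (\<forall>(M :: ('a, nat) module) (N :: ('a, nat) module) g f.
       fd_module K A M \<longrightarrow> fd_module K A N \<longrightarrow>
       g \<in> mod_hom A M N \<longrightarrow> g ` carrier M = carrier N \<longrightarrow> f \<in> mod_hom A P N \<longrightarrow>
       (\<exists>h \<in> mod_hom A P M. \<forall>x \<in> carrier P. g (h x) = f x))"

section \<open>1-cyclic complexes of projectives\<close>

type_synonym ('a, 'm) cyclic_complex = "('a, 'm) module \<times> ('m \<Rightarrow> 'm)"

text \<open>
  The objects, with underlying sets inside the naturals; as for the test modules in
  \<^const>\<open>projective\<close>, these represent all isomorphism classes when the field is finite.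
\<close>

definition C1P ::
  "('k, 'x) ring_scheme \<Rightarrow> ('k, 'a) module \<Rightarrow> ('a, nat) cyclic_complex set" where
  "C1P K A = {(M, d). projective K A M \<and> d \<in> mod_hom A M M \<and>
     (\<forall>x \<in> carrier M. d (d x) = \<zero>\<^bsub>M\<^esub>)}"

definition cc_hom ::
  "('k, 'a) module \<Rightarrow> ('a, 'm) cyclic_complex \<Rightarrow> ('a, 'n) cyclic_complex \<Rightarrow> ('m \<Rightarrow> 'n) set" where
  "cc_hom A X Y = {f \<in> mod_hom A (fst X) (fst Y).
     \<forall>x \<in> carrier (fst X). snd Y (f x) = f (snd X x)}"

definition cc_isos ::
  "('k, 'a) module \<Rightarrow> ('a, 'm) cyclic_complex \<Rightarrow> ('a, 'n) cyclic_complex \<Rightarrow> ('m \<Rightarrow> 'n) set" where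
  "cc_isos A X Y = {f \<in> cc_hom A X Y. bij_betw f (carrier (fst X)) (carrier (fst Y))}"

definition cc_iso ::
  "('k, 'a) module \<Rightarrow> ('a, 'm) cyclic_complex \<Rightarrow> ('a, 'n) cyclic_complex \<Rightarrow> bool" where
  "cc_iso A X Y \<longleftrightarrow> cc_isos A X Y \<noteq> {}"

definition cc_Aut :: "('k, 'a) module \<Rightarrow> ('a, 'm) cyclic_complex \<Rightarrow> ('m \<Rightarrow> 'm) set" where
  "cc_Aut A X = cc_isos A X X"

definition mod_sum :: "('a, 'm) module \<Rightarrow> ('a, 'n) module \<Rightarrow> ('a, 'm \<times> 'n) module" where
  "mod_sum M N =
    \<lparr>carrier = carrier M \<times> carrier N, mult = undefined, one = undefined,
     zero = (\<zero>\<^bsub>M\<^esub>, \<zero>\<^bsub>N\<^esub>),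
     add = (\<lambda>(x, y) (x', y'). (x \<oplus>\<^bsub>M\<^esub> x', y \<oplus>\<^bsub>N\<^esub> y')),
     smult = (\<lambda>a (x, y). (a \<odot>\<^bsub>M\<^esub> x, a \<odot>\<^bsub>N\<^esub> y))\<rparr>"

definition cc_sum ::
  "('a, 'm) cyclic_complex \<Rightarrow> ('a, 'n) cyclic_complex \<Rightarrow> ('a, 'm \<times> 'n) cyclic_complex" where
  "cc_sum X Y = (mod_sum (fst X) (fst Y),
     \<lambda>z \<in> carrier (fst X) \<times> carrier (fst Y). (snd X (fst z), snd Y (snd z)))"

definition cc_is_zero :: "('a, 'm) cyclic_complex \<Rightarrow> bool" where
  "cc_is_zero X \<longleftrightarrow> carrier (fst X) = {\<zero>\<^bsub>fst X\<^esub>}"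

definition cc_indecomposable ::
  "('k, 'x) ring_scheme \<Rightarrow> ('k, 'a) module \<Rightarrow> ('a, nat) cyclic_complex \<Rightarrow> bool" where
  "cc_indecomposable K A X \<longleftrightarrow> X \<in> C1P K A \<and> \<not> cc_is_zero X \<and>
     (\<forall>Y \<in> C1P K A. \<forall>Z \<in> C1P K A. cc_iso A X (cc_sum Y Z) \<longrightarrow> cc_is_zero Y \<or> cc_is_zero Z)"

definition zero_complex :: "('a, nat) cyclic_complex" where
  "zero_complex =
    (\<lparr>carrier = {0}, mult = undefined, one = undefined, zero = 0,
      add = (\<lambda>_ _. 0), smult = (\<lambda>_ _. 0)\<rparr>, \<lambda>x \<in> {0}. 0)"

section \<open>The Hall algebra\<close>

type_synonym 'a isoclass = "('a, nat) cyclic_complex set"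

definition isoclass ::
  "('k, 'x) ring_scheme \<Rightarrow> ('k, 'a) module \<Rightarrow> ('a, nat) cyclic_complex \<Rightarrow> 'a isoclass" where
  "isoclass K A X = {Y \<in> C1P K A. cc_iso A X Y}"

definition isoclasses ::
  "('k, 'x) ring_scheme \<Rightarrow> ('k, 'a) module \<Rightarrow> 'a isoclass set" where
  "isoclasses K A = isoclass K A ` C1P K A"

text \<open>Short exact sequences with sub-object Y, middle term Z and quotient X.\<close>

definition ses ::
  "('k, 'a) module \<Rightarrow> ('a, nat) cyclic_complex \<Rightarrow> ('a, nat) cyclic_complex \<Rightarrow>
    ('a, nat) cyclic_complex \<Rightarrow> ((nat \<Rightarrow> nat) \<times> (nat \<Rightarrow> nat)) set" where
  "ses A X Y Z = {(\<phi>, \<psi>). \<phi> \<in> cc_hom A Y Z \<and> \<psi> \<in> cc_hom A Z X \<and>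
     inj_on \<phi> (carrier (fst Y)) \<and>
     \<phi> ` carrier (fst Y) = {z \<in> carrier (fst Z). \<psi> z = \<zero>\<^bsub>fst X\<^esub>} \<and>
     \<psi> ` carrier (fst Z) = carrier (fst X)}"

definition hall_number ::
  "('k, 'a) module \<Rightarrow> ('a, nat) cyclic_complex \<Rightarrow> ('a, nat) cyclic_complex \<Rightarrow>
    ('a, nat) cyclic_complex \<Rightarrow> complex" where
  "hall_number A X Y Z =
     of_nat (card (ses A X Y Z)) / (of_nat (card (cc_Aut A X)) * of_nat (card (cc_Aut A Y)))"

text \<open>Hall numbers only depend on the isoclasses, so they are evaluated at chosen representatives.\<close>

definition hall_coeff ::
  "('k, 'a) module \<Rightarrow> 'a isoclass \<Rightarrow> 'a isoclass \<Rightarrow> 'a isoclass \<Rightarrow> complex" where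
  "hall_coeff A x y z = hall_number A (SOME X. X \<in> x) (SOME Y. Y \<in> y) (SOME Z. Z \<in> z)"

definition pm_scale :: "complex \<Rightarrow> ('b \<Rightarrow>\<^sub>0 complex) \<Rightarrow> ('b \<Rightarrow>\<^sub>0 complex)" where
  "pm_scale c = Poly_Mapping.map ((*) c)"

lemma lookup_pm_scale [simp]:
  "Poly_Mapping.lookup (pm_scale c f) x = c * Poly_Mapping.lookup f x"
  by (simp add: pm_scale_def Poly_Mapping.map.rep_eq when_def)

global_interpretation pm: vector_space pm_scale
  by unfold_locales
    (auto intro!: poly_mapping_eqI simp: Poly_Mapping.lookup_add algebra_simps)

definition hall_mult ::
  "('k, 'x) ring_scheme \<Rightarrow> ('k, 'a) module \<Rightarrow> 'a isoclass \<Rightarrow> 'a isoclass \<Rightarrow>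
    ('a isoclass \<Rightarrow>\<^sub>0 complex)" where
  "hall_mult K A x y =
     (\<Sum>z \<in> {z \<in> isoclasses K A. hall_coeff A x y z \<noteq> 0}.
        Poly_Mapping.single z (hall_coeff A x y z))"

text \<open>
  The vector space with basis the isoclasses consists of the finitely supported functions all of
  whose keys are isoclasses; the multiplication is the bilinear extension of the product above.
\<close>

definition hall_algebra ::
  "('k, 'x) ring_scheme \<Rightarrow> ('k, 'a) module \<Rightarrow> ('a isoclass \<Rightarrow>\<^sub>0 complex) ring" where
  "hall_algebra K A =
    \<lparr>carrier = {f. Poly_Mapping.keys f \<subseteq> isoclasses K A},
     mult = (\<lambda>f g. \<Sum>x \<in> Poly_Mapping.keys f. \<Sum>y \<in> Poly_Mapping.keys g.
       pm_scale (Poly_Mapping.lookup f x * Poly_Mapping.lookup g y) (hall_mult K A x y)),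
     one = Poly_Mapping.single (isoclass K A zero_complex) 1,
     zero = 0,
     add = (+)\<rparr>"

definition indecomposables ::
  "('k, 'x) ring_scheme \<Rightarrow> ('k, 'a) module \<Rightarrow> ('a isoclass \<Rightarrow>\<^sub>0 complex) set" where
  "indecomposables K A =
     {Poly_Mapping.single (isoclass K A X) 1 | X. cc_indecomposable K A X}"

section \<open>Universal PBW bases\<close>

text \<open>The strictly increasing enumeration of a finite set F by a linear order r.\<close>

definition ordered_list :: "'s rel \<Rightarrow> 's set \<Rightarrow> 's list" where
  "ordered_list r F =
     (THE xs. set xs = F \<and> distinct xs \<and> sorted_wrt (\<lambda>x y. (x, y) \<in> r) xs)"

definition ordered_monomial :: "'s ring \<Rightarrow> 's rel \<Rightarrow> ('s \<Rightarrow> nat) \<Rightarrow> 's" where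
  "ordered_monomial H r a =
     foldr (\<lambda>x m. (x [^]\<^bsub>H\<^esub> a x) \<otimes>\<^bsub>H\<^esub> m) (ordered_list r {x. a x \<noteq> 0}) \<one>\<^bsub>H\<^esub>"

definition exponents :: "'s set \<Rightarrow> ('s \<Rightarrow> nat) set" where
  "exponents S = {a. finite {x. a x \<noteq> 0} \<and> {x. a x \<noteq> 0} \<subseteq> S}"

text \<open>
  The family of ordered monomials is a basis: different exponents give different monomials, and
  the set of monomials is linearly independent and spans the algebra.
\<close>

definition universal_PBW_basis ::
  "('b \<Rightarrow>\<^sub>0 complex) ring \<Rightarrow> ('b \<Rightarrow>\<^sub>0 complex) set \<Rightarrow> bool" where
  "universal_PBW_basis H S \<longleftrightarrow> S \<subseteq> carrier H \<and>
     (\<forall>r. linear_order_on S r \<longrightarrow>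
        inj_on (ordered_monomial H r) (exponents S) \<and>
        pm.independent (ordered_monomial H r ` exponents S) \<and>
        pm.span (ordered_monomial H r ` exponents S) = carrier H)"

end

theory Submission
  imports Defs
begin

text \<open>
  If Z is an extension of X by Y, left exactness of Hom gives
  |Hom(T, Z)| \<le> |Hom(T, X + Y)| and |Hom(Z, T)| \<le> |Hom(X + Y, T)| for every T, and
  |End Z| = |End(X + Y)| forces the identity of X to lift to a section, so that Z is the direct sum.
  Hence an ordered monomial is a nonzero multiple of the class of the corresponding direct sum of
  indecomposables plus classes with strictly fewer endomorphisms, and the transition matrix to the
  basis of isoclasses is triangular, in any order of the factors.

  Uniqueness of the decomposition into indecomposables is obtained by counting. For X indecomposable,
  End X is local, so the homomorphisms from X to M that are not split monomorphisms form a set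
  rad(X, M) with rad(X, M + N) = rad(X, M) \<times> rad(X, N). The quotient |Hom(X, M)| / |rad(X, M)| is
  therefore multiplicative in M; it is 1 at the indecomposables other than X and exceeds 1 at X.
\<close>

section \<open>Hall algebras with leading terms\<close>

text \<open>Endomorphism counts alone are not stable under multiplication: |End(X + Y)| contains the
  mixed factors |Hom(X, Y)| and |Hom(Y, X)|, so a lower term of one factor might gain mixed factors
  that outweigh its deficit. The induction along a monomial therefore carries inequalities against
  every test object T, on both sides, and uses End only to measure strictness. The bounds refer to
  direct sums, which commute, although the product does not; this is why the leading class ignores
  the order of the factors. The argument is carried out over an abstract commutative monoid of
  classes. Exact sequences and chosen representatives enter only when the axioms of
  \<open>hall_data\<close> are verified. One of them is that a product has finitely many terms, and
  there projectivity is decisive: the underlying modules of an extension split, so only the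
  differential can vary.\<close>

definition hall_ring :: "'i monoid \<Rightarrow> ('i \<Rightarrow> 'i \<Rightarrow> 'i \<Rightarrow> complex) \<Rightarrow> ('i \<Rightarrow>\<^sub>0 complex) ring" where
  "hall_ring G F =
    \<lparr>carrier = {f. Poly_Mapping.keys f \<subseteq> carrier G},
     mult = (\<lambda>f g. \<Sum>x \<in> Poly_Mapping.keys f. \<Sum>y \<in> Poly_Mapping.keys g.
       pm_scale (Poly_Mapping.lookup f x * Poly_Mapping.lookup g y)
         (\<Sum>z \<in> {z \<in> carrier G. F x y z \<noteq> 0}. Poly_Mapping.single z (F x y z))),
     one = Poly_Mapping.single \<one>\<^bsub>G\<^esub> 1,
     zero = 0,
     add = (+)\<rparr>"

section \<open>Enumerating a finite subset of a linear order\<close>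

text \<open>Two different heads would each occur in the tail of the other list and so precede one
  another, against antisymmetry. This makes the \<open>THE\<close> in \<open>ordered_list\<close>
  meaningful.\<close>

lemma sorted_wrt_unique:
  assumes "antisym r" "distinct xs" "distinct ys" "set xs = set ys"
    and "sorted_wrt (\<lambda>x y. (x, y) \<in> r) xs" "sorted_wrt (\<lambda>x y. (x, y) \<in> r) ys"
  shows "xs = ys"
  using assms(2-)
proof (induction xs arbitrary: ys)
  case (Cons x xs)
  then obtain y ys' where ys: "ys = y # ys'"
    by (cases ys) auto
  have "x = y"
  proof (rule ccontr)
    assume ne: "x \<noteq> y"
    then have "x \<in> set ys'" "y \<in> set xs"
      using Cons.prems(3) ys by auto
    then have "(x, y) \<in> r" "(y, x) \<in> r"
      using Cons.prems(4,5) ys by auto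
    then show False
      using \<open>antisym r\<close> ne by (auto dest: antisymD)
  qed
  moreover from this have "set xs = set ys'"
    using Cons.prems ys by (metis distinct.simps(2) insert_ident list.simps(15))
  ultimately show ?case
    using Cons.IH[of ys'] Cons.prems ys by auto
qed simp

lemma sorted_wrt_exists:
  assumes "linear_order_on S r" "finite F" "F \<subseteq> S"
  shows "\<exists>xs. set xs = F \<and> distinct xs \<and> sorted_wrt (\<lambda>x y. (x, y) \<in> r) xs"
  using assms(2,3)
proof (induction "card F" arbitrary: F)
  case (Suc n)
  have lin: "trans r" "total_on S r" "refl_on S r"
    using assms(1) by (auto simp: order_on_defs)
  \<comment> \<open>A finite nonempty subset has a least element, which becomes the head of the
    list.\<close>
  have "\<exists>m\<in>F'. \<forall>x\<in>F'. (m, x) \<in> r" if "finite F'" "F' \<noteq> {}" "F' \<subseteq> S" for F'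
    using that
  proof (induction rule: finite_ne_induct)
    case (singleton x)
    then show ?case using lin(3) by (auto simp: refl_on_def)
  next
    case (insert x A)
    then obtain m where m: "m \<in> A" "\<forall>x\<in>A. (m, x) \<in> r" by auto
    have "m \<noteq> x" "m \<in> S" "x \<in> S"
      using insert m by auto
    then consider "(m, x) \<in> r" | "(x, m) \<in> r"
      using lin(2) by (auto simp: total_on_def)
    then show ?case
    proof cases
      case 1
      then show ?thesis using m by auto
    next
      case 2
      have "(x, x) \<in> r" using lin(3) \<open>x \<in> S\<close> by (auto simp: refl_on_def)
      then show ?thesis using 2 m lin(1) by (auto dest: transD)
    qed
  qed
  moreover have "F \<noteq> {}" using Suc by auto
  ultimately obtain m where m: "m \<in> F" "\<forall>x\<in>F. (m, x) \<in> r"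
    using Suc.prems by blast
  have "n = card (F - {m})" "finite (F - {m})" "F - {m} \<subseteq> S"
    using Suc.hyps(2) Suc.prems m by auto
  from Suc.hyps(1)[OF this] obtain xs
    where "set xs = F - {m}" "distinct xs" "sorted_wrt (\<lambda>x y. (x, y) \<in> r) xs"
    by blast
  then show ?case
    using m by (intro exI[of _ "m # xs"]) auto
qed simp

lemma ordered_list:
  assumes "linear_order_on S r" "finite F" "F \<subseteq> S"
  shows "set (ordered_list r F) = F" "distinct (ordered_list r F)"
proof -
  have "antisym r" using assms(1) by (simp add: order_on_defs)
  then have "\<exists>!xs. set xs = F \<and> distinct xs \<and> sorted_wrt (\<lambda>x y. (x, y) \<in> r) xs"
    using sorted_wrt_exists[OF assms] by (auto intro: sorted_wrt_unique)
  from theI'[OF this] show "set (ordered_list r F) = F" "distinct (ordered_list r F)"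
    by (auto simp: ordered_list_def)
qed

text \<open>
  The elements of the monoid stand for isoclasses with direct sum; \<open>hom\<close> counts homomorphisms,
  \<open>sz\<close> counts elements, and \<open>mul d x\<close> is exponential in the multiplicity of d as a summand of x.
\<close>

locale hall_data = comm_monoid G for G :: "'i monoid" (structure) +
  fixes F :: "'i \<Rightarrow> 'i \<Rightarrow> 'i \<Rightarrow> complex" and hom :: "'i \<Rightarrow> 'i \<Rightarrow> nat" and D :: "'i set"
    and sz :: "'i \<Rightarrow> nat" and mul :: "'i \<Rightarrow> 'i \<Rightarrow> real"
  assumes D_carrier: "D \<subseteq> carrier G"
    and hom_pos: "x \<in> carrier G \<Longrightarrow> y \<in> carrier G \<Longrightarrow> 0 < hom x y"
    and hom_left: "x \<in> carrier G \<Longrightarrow> y \<in> carrier G \<Longrightarrow> t \<in> carrier G \<Longrightarrow>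
      hom (x \<otimes> y) t = hom x t * hom y t"
    and hom_right: "x \<in> carrier G \<Longrightarrow> y \<in> carrier G \<Longrightarrow> t \<in> carrier G \<Longrightarrow>
      hom t (x \<otimes> y) = hom t x * hom t y"
    and F_le_right: "x \<in> carrier G \<Longrightarrow> y \<in> carrier G \<Longrightarrow> z \<in> carrier G \<Longrightarrow> t \<in> carrier G \<Longrightarrow>
      F x y z \<noteq> 0 \<Longrightarrow> hom t z \<le> hom t (x \<otimes> y)"
    and F_le_left: "x \<in> carrier G \<Longrightarrow> y \<in> carrier G \<Longrightarrow> z \<in> carrier G \<Longrightarrow> t \<in> carrier G \<Longrightarrow>
      F x y z \<noteq> 0 \<Longrightarrow> hom z t \<le> hom (x \<otimes> y) t"
    and F_split: "x \<in> carrier G \<Longrightarrow> y \<in> carrier G \<Longrightarrow> z \<in> carrier G \<Longrightarrow>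
      F x y z \<noteq> 0 \<Longrightarrow> hom z z = hom (x \<otimes> y) (x \<otimes> y) \<Longrightarrow> z = x \<otimes> y"
    and F_sum: "x \<in> carrier G \<Longrightarrow> y \<in> carrier G \<Longrightarrow> F x y (x \<otimes> y) \<noteq> 0"
    and F_finite: "x \<in> carrier G \<Longrightarrow> y \<in> carrier G \<Longrightarrow> finite {z \<in> carrier G. F x y z \<noteq> 0}"
    and decompose: "x \<in> carrier G \<Longrightarrow> x \<noteq> \<one> \<Longrightarrow> x \<notin> D \<Longrightarrow>
      \<exists>y\<in>carrier G. \<exists>z\<in>carrier G. x = y \<otimes> z \<and> sz y < sz x \<and> sz z < sz x"
    and mul_one: "d \<in> D \<Longrightarrow> mul d \<one> = 1"
    and mul_mult: "d \<in> D \<Longrightarrow> x \<in> carrier G \<Longrightarrow> y \<in> carrier G \<Longrightarrow> mul d (x \<otimes> y) = mul d x * mul d y"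
    and mul_neq: "d \<in> D \<Longrightarrow> e \<in> D \<Longrightarrow> d \<noteq> e \<Longrightarrow> mul d e = 1"
    and mul_self: "d \<in> D \<Longrightarrow> 1 < mul d d"
begin

abbreviation H where "H \<equiv> hall_ring G F"

section \<open>Unique decomposition in the abstract monoid\<close>

definition power_prod :: "('i \<Rightarrow> nat) \<Rightarrow> 'i" where
  "power_prod a = finprod G (\<lambda>d. d [^] a d) {d. a d \<noteq> 0}"

lemma power_closed: "a \<in> exponents D \<Longrightarrow> a d \<noteq> 0 \<Longrightarrow> d \<in> carrier G"
  using D_carrier by (auto simp: exponents_def)

lemma power_prod_closed [simp]: "a \<in> exponents D \<Longrightarrow> power_prod a \<in> carrier G"
  unfolding power_prod_def using power_closed by (intro finprod_closed) auto

text \<open>Factors with exponent 0 are trivial, so two exponent functions can be compared over the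
  union of their supports.\<close>

lemma power_prod_superset:
  assumes "a \<in> exponents D" "finite E" "{d. a d \<noteq> 0} \<subseteq> E" "E \<subseteq> D"
  shows "power_prod a = finprod G (\<lambda>d. d [^] a d) E"
  unfolding power_prod_def
  using assms D_carrier by (intro finprod_mono_neutral_cong_left) auto

lemma power_prod_add:
  assumes "a \<in> exponents D" "b \<in> exponents D"
  shows "(\<lambda>d. a d + b d) \<in> exponents D"
    and "power_prod (\<lambda>d. a d + b d) = power_prod a \<otimes> power_prod b"
proof -
  let ?E = "{d. a d \<noteq> 0} \<union> {d. b d \<noteq> 0}"
  have E: "finite ?E" "?E \<subseteq> D" using assms by (auto simp: exponents_def)
  have "{d. a d + b d \<noteq> 0} \<subseteq> ?E" by auto
  then show ab: "(\<lambda>d. a d + b d) \<in> exponents D"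
    using E finite_subset unfolding exponents_def by (intro CollectI conjI) blast+
  have "power_prod (\<lambda>d. a d + b d) = finprod G (\<lambda>d. d [^] (a d + b d)) ?E"
    using ab E by (intro power_prod_superset) auto
  also have "\<dots> = finprod G (\<lambda>d. d [^] a d \<otimes> d [^] b d) ?E"
    using E D_carrier by (intro finprod_cong') (auto simp: nat_pow_mult)
  also have "\<dots> = finprod G (\<lambda>d. d [^] a d) ?E \<otimes> finprod G (\<lambda>d. d [^] b d) ?E"
    using E D_carrier by (intro finprod_multf) auto
  also have "\<dots> = power_prod a \<otimes> power_prod b"
    using assms E by (simp add: power_prod_superset[of _ ?E])
  finally show "power_prod (\<lambda>d. a d + b d) = power_prod a \<otimes> power_prod b" .
qed

text \<open>Splitting terminates because both summands have smaller \<open>sz\<close>.\<close>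

lemma decomposition: "x \<in> carrier G \<Longrightarrow> \<exists>a\<in>exponents D. x = power_prod a"
proof (induction "sz x" arbitrary: x rule: less_induct)
  case less
  consider "x = \<one>" | "x \<in> D" | "x \<noteq> \<one>" "x \<notin> D" by blast
  then show ?case
  proof cases
    case 1
    then show ?thesis
      by (intro bexI[of _ "\<lambda>_. 0"]) (auto simp: power_prod_def exponents_def)
  next
    case 2
    then have "{d. (if d = x then 1 else 0 :: nat) \<noteq> 0} = {x}" by auto
    with 2 show ?thesis using less.prems
      by (intro bexI[of _ "\<lambda>d. if d = x then 1 else 0"]) (auto simp: power_prod_def exponents_def)
  next
    case 3
    then obtain y z where "y \<in> carrier G" "z \<in> carrier G" "x = y \<otimes> z" "sz y < sz x" "sz z < sz x"
      using decompose less.prems by blast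
    then obtain a b where "a \<in> exponents D" "b \<in> exponents D" "x = power_prod a \<otimes> power_prod b"
      using less.hyps by metis
    then show ?thesis
      using power_prod_add[of a b] by metis
  qed
qed

lemma mul_power: "d \<in> D \<Longrightarrow> x \<in> carrier G \<Longrightarrow> mul d (x [^] (n::nat)) = mul d x ^ n"
  by (induction n) (auto simp: mul_one mul_mult)

lemma mul_finprod:
  assumes "d \<in> D" "finite E" "f \<in> E \<rightarrow> carrier G"
  shows "mul d (finprod G f E) = (\<Prod>e\<in>E. mul d (f e))"
  using assms(2,3) by (induction E rule: finite_induct) (auto simp: mul_one mul_mult assms(1))

text \<open>\<open>mul d\<close> turns the product into a product of reals in which every factor
  belonging to another member of \<open>D\<close> is 1.\<close>

lemma mul_power_prod:
  assumes "a \<in> exponents D" "d \<in> D"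
  shows "mul d (power_prod a) = mul d d ^ a d"
proof -
  have fin: "finite {e. a e \<noteq> 0}" "{e. a e \<noteq> 0} \<subseteq> D"
    using assms by (auto simp: exponents_def)
  have "mul d (power_prod a) = (\<Prod>e\<in>{e. a e \<noteq> 0}. mul d (e [^] a e))"
    unfolding power_prod_def using assms fin D_carrier by (intro mul_finprod) auto
  also have "\<dots> = (\<Prod>e\<in>{e. a e \<noteq> 0}. if e = d then mul d d ^ a d else 1)"
    using assms fin D_carrier by (intro prod.cong) (auto simp: mul_power mul_neq subset_iff)
  also have "\<dots> = mul d d ^ a d"
    using fin by (simp add: prod.delta)
  finally show ?thesis .
qed

text \<open>The exponent of d can be read off from \<open>mul d\<close>, as powers of a real above 1
  are distinct; outside \<open>D\<close> all exponents vanish. For isoclasses this is the uniqueness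
  part of the Krull-Schmidt theorem.\<close>

lemma power_prod_inj: "inj_on power_prod (exponents D)"
proof (rule inj_onI, rule ext)
  fix a b d assume *: "a \<in> exponents D" "b \<in> exponents D" "power_prod a = power_prod b"
  show "a d = b d"
  proof (cases "d \<in> D")
    case True
    then have "mul d d ^ a d = mul d d ^ b d"
      using * mul_power_prod by metis
    then show ?thesis
      using mul_self[OF True] by (simp add: power_inject_exp)
  next
    case False
    then show ?thesis using * by (force simp: exponents_def)
  qed
qed

section \<open>Leading terms and their products\<close>

definition below :: "'i \<Rightarrow> 'i \<Rightarrow> bool" where
  "below z m \<longleftrightarrow> (\<forall>t\<in>carrier G. hom t z \<le> hom t m \<and> hom z t \<le> hom m t)"

text \<open>The strict inequality separates the leading class from the rest of the support;
  \<open>below\<close> retains the bounds that the next multiplication consumes.\<close>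

definition leading :: "('i \<Rightarrow>\<^sub>0 complex) \<Rightarrow> 'i \<Rightarrow> bool" where
  "leading f m \<longleftrightarrow> m \<in> carrier G \<and> m \<in> Poly_Mapping.keys f \<and>
     (\<forall>z\<in>Poly_Mapping.keys f. z \<in> carrier G \<and> below z m \<and> (z = m \<or> hom z z < hom m m))"

text \<open>\<open>F_finite\<close> enters because a sum over an infinite index set would default to
  0 and lose the coefficients.\<close>

lemma lookup_mult:
  assumes "f \<in> carrier H" "g \<in> carrier H"
  shows "Poly_Mapping.lookup (f \<otimes>\<^bsub>H\<^esub> g) z =
    (\<Sum>x\<in>Poly_Mapping.keys f. \<Sum>y\<in>Poly_Mapping.keys g.
      Poly_Mapping.lookup f x * Poly_Mapping.lookup g y * (if z \<in> carrier G then F x y z else 0))"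
proof -
  have "Poly_Mapping.lookup (\<Sum>z \<in> {z \<in> carrier G. F x y z \<noteq> 0}. Poly_Mapping.single z (F x y z)) z
      = (if z \<in> carrier G then F x y z else 0)"
    if "x \<in> carrier G" "y \<in> carrier G" for x y
    using F_finite[OF that]
    by (auto simp: lookup_sum lookup_single when_def sum.delta' cong: sum.cong)
  moreover have "x \<in> carrier G" if "x \<in> Poly_Mapping.keys f" for x
    using that assms by (auto simp: hall_ring_def)
  moreover have "x \<in> carrier G" if "x \<in> Poly_Mapping.keys g" for x
    using that assms by (auto simp: hall_ring_def)
  ultimately show ?thesis
    by (simp add: hall_ring_def lookup_sum cong: sum.cong)
qed

lemma below_mult:
  assumes "below x m" "below y n"
    and "x \<in> carrier G" "m \<in> carrier G" "y \<in> carrier G" "n \<in> carrier G"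
  shows "below (x \<otimes> y) (m \<otimes> n)"
  using assms by (auto simp: below_def hom_left hom_right intro!: mult_mono)

lemma hom_self_mult:
  assumes "x \<in> carrier G" "y \<in> carrier G"
  shows "hom (x \<otimes> y) (x \<otimes> y) = (hom x x * hom y y) * (hom x y * hom y x)"
  using assms by (simp add: hom_left hom_right ac_simps)

lemma below_self: "below x m \<Longrightarrow> x \<in> carrier G \<Longrightarrow> m \<in> carrier G \<Longrightarrow> hom x x \<le> hom m m"
  unfolding below_def by (meson order_trans)

text \<open>All four factors in \<open>hom_self_mult\<close> are positive and monotone, so
  strictness in one diagonal factor suffices. The mixed factors are bounded because
  \<open>below\<close> speaks about every test object.\<close>

lemma below_less_mult:
  assumes "below x m" "below y n" "hom x x < hom m m \<or> hom y y < hom n n"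
    and c: "x \<in> carrier G" "m \<in> carrier G" "y \<in> carrier G" "n \<in> carrier G"
  shows "hom (x \<otimes> y) (x \<otimes> y) < hom (m \<otimes> n) (m \<otimes> n)"
proof -
  have le: "hom x x \<le> hom m m" "hom y y \<le> hom n n"
    using assms by (auto intro: below_self)
  have "hom x x * hom y y < hom m m * hom n n"
  proof (cases "hom x x < hom m m")
    case True
    then show ?thesis
      using le c hom_pos[of n n] hom_pos[of y y] by (intro mult_less_le_imp_less) auto
  next
    case False
    then show ?thesis
      using le assms(3) c hom_pos[of m m] hom_pos[of x x] by (intro mult_le_less_imp_less) auto
  qed
  moreover have "hom x y \<le> hom m n" "hom y x \<le> hom n m"
    using assms unfolding below_def by (meson order_trans)+
  then have "hom x y * hom y x \<le> hom m n * hom n m" by (intro mult_mono) auto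
  ultimately show ?thesis
    unfolding hom_self_mult[OF c(1,3)] hom_self_mult[OF c(2,4)]
    using c hom_pos[of x y] hom_pos[of y x] by (auto intro: mult_less_le_imp_less)
qed

lemma leading_carrier: "leading f m \<Longrightarrow> f \<in> carrier H"
  by (auto simp: leading_def hall_ring_def)

text \<open>Every middle term of a pair (x, y) is bounded by the direct sum of x and y, which is in
  turn bounded by that of m and n.\<close>

lemma leading_mult:
  assumes f: "leading f m" and g: "leading g n"
  shows "leading (f \<otimes>\<^bsub>H\<^esub> g) (m \<otimes> n)"
proof -
  have mn: "m \<in> carrier G" "n \<in> carrier G" "m \<otimes> n \<in> carrier G"
    using assms by (auto simp: leading_def)
  note fg = leading_carrier[OF f] leading_carrier[OF g]
  have key: "x \<in> carrier G" "y \<in> carrier G" "below (x \<otimes> y) (m \<otimes> n)"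
    "x = m \<and> y = n \<or> hom (x \<otimes> y) (x \<otimes> y) < hom (m \<otimes> n) (m \<otimes> n)"
    if "x \<in> Poly_Mapping.keys f" "y \<in> Poly_Mapping.keys g" for x y
  proof -
    have *: "x \<in> carrier G" "y \<in> carrier G" "below x m" "below y n"
      "x = m \<or> hom x x < hom m m" "y = n \<or> hom y y < hom n n"
      using assms that unfolding leading_def by blast+
    then show "x \<in> carrier G" "y \<in> carrier G" "below (x \<otimes> y) (m \<otimes> n)"
      using mn by (auto intro: below_mult)
    show "x = m \<and> y = n \<or> hom (x \<otimes> y) (x \<otimes> y) < hom (m \<otimes> n) (m \<otimes> n)"
      using * mn below_less_mult[of x m y n] by blast
  qed
  let ?l = "Poly_Mapping.lookup"
  have "?l (f \<otimes>\<^bsub>H\<^esub> g) (m \<otimes> n) =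
    (\<Sum>x\<in>Poly_Mapping.keys f. \<Sum>y\<in>Poly_Mapping.keys g. ?l f x * ?l g y * F x y (m \<otimes> n))"
    using fg mn by (simp add: lookup_mult)
  also have "\<dots> = (\<Sum>(x, y)\<in>Poly_Mapping.keys f \<times> Poly_Mapping.keys g.
      ?l f x * ?l g y * F x y (m \<otimes> n))"
    by (simp add: sum.cartesian_product)
  \<comment> \<open>Any other pair has a direct sum with strictly fewer endomorphisms than
    \<open>m \<otimes> n\<close>; if \<open>m \<otimes> n\<close> were a middle term of it,
    \<open>F_le_right\<close> and \<open>F_le_left\<close> would give the opposite
    inequality.\<close>
  also have "\<dots> = (\<Sum>(x, y)\<in>{(m, n)}. ?l f x * ?l g y * F x y (m \<otimes> n))"
  proof (intro sum.mono_neutral_right ballI)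
    show "{(m, n)} \<subseteq> Poly_Mapping.keys f \<times> Poly_Mapping.keys g"
      using assms by (auto simp: leading_def)
    fix p assume p: "p \<in> Poly_Mapping.keys f \<times> Poly_Mapping.keys g - {(m, n)}"
    obtain x y where xy: "p = (x, y)" by force
    have "F x y (m \<otimes> n) = 0"
    proof (rule ccontr)
      assume F: "F x y (m \<otimes> n) \<noteq> 0"
      have k: "x \<in> carrier G" "y \<in> carrier G" "hom (x \<otimes> y) (x \<otimes> y) < hom (m \<otimes> n) (m \<otimes> n)"
        using p xy key[of x y] by auto
      then have "hom (m \<otimes> n) (m \<otimes> n) \<le> hom (m \<otimes> n) (x \<otimes> y)"
        using F mn by (intro F_le_right) auto
      also have "\<dots> \<le> hom (x \<otimes> y) (x \<otimes> y)"
        using F mn k by (intro F_le_left) auto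
      finally show False using k by simp
    qed
    then show "(case p of (x, y) \<Rightarrow> ?l f x * ?l g y * F x y (m \<otimes> n)) = 0"
      by (simp add: xy)
  qed auto
  also have "\<dots> \<noteq> 0"
    using assms F_sum[OF mn(1,2)] by (auto simp: leading_def in_keys_iff)
  finally have "m \<otimes> n \<in> Poly_Mapping.keys (f \<otimes>\<^bsub>H\<^esub> g)"
    by (simp add: in_keys_iff)
  moreover have "z \<in> carrier G \<and> below z (m \<otimes> n) \<and>
      (z = m \<otimes> n \<or> hom z z < hom (m \<otimes> n) (m \<otimes> n))"
    if "z \<in> Poly_Mapping.keys (f \<otimes>\<^bsub>H\<^esub> g)" for z
  proof -
    have "?l (f \<otimes>\<^bsub>H\<^esub> g) z \<noteq> 0" using that by (simp add: in_keys_iff)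
    then obtain x where "x \<in> Poly_Mapping.keys f"
      "(\<Sum>y\<in>Poly_Mapping.keys g. ?l f x * ?l g y * (if z \<in> carrier G then F x y z else 0)) \<noteq> 0"
      unfolding lookup_mult[OF fg] by (rule sum.not_neutral_contains_not_neutral)
    then obtain y where "x \<in> Poly_Mapping.keys f" "y \<in> Poly_Mapping.keys g"
      "?l f x * ?l g y * (if z \<in> carrier G then F x y z else 0) \<noteq> 0"
      by (auto elim: sum.not_neutral_contains_not_neutral)
    then have xy: "x \<in> Poly_Mapping.keys f" "y \<in> Poly_Mapping.keys g"
      "z \<in> carrier G" "F x y z \<noteq> 0"
      by (auto split: if_splits)
    note k = key[OF xy(1,2)]
    have b: "below z (x \<otimes> y)"
      using k xy F_le_left[of x y z] F_le_right[of x y z] by (auto simp: below_def)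
    then have b': "below z (m \<otimes> n)"
      using k(3) unfolding below_def by (meson order_trans)
    have "hom z z \<le> hom (x \<otimes> y) (x \<otimes> y)"
      using b k xy by (intro below_self) auto
    \<comment> \<open>Equality of the endomorphism counts leaves only x = m and y = n, and then
      \<open>F_split\<close> identifies z.\<close>
    then have "z = m \<otimes> n \<or> hom z z < hom (m \<otimes> n) (m \<otimes> n)"
      using k(4) F_split[OF k(1,2) xy(3,4)] by force
    with b' xy show ?thesis by simp
  qed
  ultimately show ?thesis
    using mn by (simp add: leading_def)
qed

lemma leading_single: "x \<in> carrier G \<Longrightarrow> leading (Poly_Mapping.single x 1) x"
  by (auto simp: leading_def below_def)

lemma leading_one: "leading \<one>\<^bsub>H\<^esub> \<one>"
  using leading_single[of \<one>] by (simp add: hall_ring_def)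

lemma leading_pow: "leading f m \<Longrightarrow> leading (f [^]\<^bsub>H\<^esub> (n::nat)) (m [^] n)"
proof (induction n)
  case 0
  then show ?case using leading_one by (simp add: nat_pow_def)
next
  case (Suc n)
  then show ?case using leading_mult by (simp add: nat_pow_def)
qed

section \<open>Ordered monomials in the generators\<close>

definition gens :: "('i \<Rightarrow>\<^sub>0 complex) set" where
  "gens = (\<lambda>x. Poly_Mapping.single x 1) ` D"

text \<open>Exponents of monomials live on basis vectors of the algebra, those of
  \<open>power_prod\<close> on \<open>D\<close>. The value 0 outside \<open>D\<close> puts the
  result into \<open>exponents D\<close>.\<close>

definition reindex :: "(('i \<Rightarrow>\<^sub>0 complex) \<Rightarrow> nat) \<Rightarrow> 'i \<Rightarrow> nat" where
  "reindex a = (\<lambda>d. if d \<in> D then a (Poly_Mapping.single d 1) else 0)"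

lemma single_inj: "inj (\<lambda>x. Poly_Mapping.single x (1::complex))"
  by (intro injI) (metis one_neq_zero lookup_single_eq lookup_single_not_eq)

lemma reindex_support:
  assumes "a \<in> exponents gens"
  shows "{s. a s \<noteq> 0} = (\<lambda>x. Poly_Mapping.single x 1) ` {d. reindex a d \<noteq> 0}"
  using assms by (auto simp: exponents_def gens_def reindex_def)

lemma reindex_exponents:
  assumes "a \<in> exponents gens"
  shows "reindex a \<in> exponents D"
proof -
  have "finite {s. a s \<noteq> 0}" using assms by (simp add: exponents_def)
  then have "finite {d. reindex a d \<noteq> 0}"
    unfolding reindex_support[OF assms]
    by (rule finite_imageD) (use single_inj in \<open>auto simp: inj_on_def\<close>)
  then show ?thesis by (auto simp: exponents_def reindex_def split: if_splits)
qed

lemma reindex_inj: "inj_on reindex (exponents gens)"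
proof (rule inj_onI, rule ext)
  fix a b s assume *: "a \<in> exponents gens" "b \<in> exponents gens" "reindex a = reindex b"
  show "a s = b s"
  proof (cases "s \<in> gens")
    case True
    then obtain d where "d \<in> D" "s = Poly_Mapping.single d 1" by (auto simp: gens_def)
    then show ?thesis using fun_cong[OF *(3), of d] by (simp add: reindex_def)
  next
    case False
    then show ?thesis using *(1,2) by (force simp: exponents_def)
  qed
qed

text \<open>Needed for spanning: it turns the decomposition of a class into an actual monomial with
  that leading class.\<close>

lemma reindex_surj:
  assumes "b \<in> exponents D"
  shows "\<exists>a\<in>exponents gens. reindex a = b"
proof -
  define a where "a s = (if s \<in> gens then b (the_inv (\<lambda>x. Poly_Mapping.single x (1::complex)) s) else 0)" for s
  have a: "a (Poly_Mapping.single d 1) = b d" if "d \<in> D" for d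
    using that by (auto simp: a_def gens_def the_inv_f_f[OF single_inj])
  have "{s. a s \<noteq> 0} \<subseteq> (\<lambda>x. Poly_Mapping.single x 1) ` {d. b d \<noteq> 0}"
  proof
    fix s assume s: "s \<in> {s. a s \<noteq> 0}"
    then have "s \<in> gens" by (auto simp: a_def split: if_splits)
    then obtain d where "d \<in> D" "s = Poly_Mapping.single d 1" by (auto simp: gens_def)
    then show "s \<in> (\<lambda>x. Poly_Mapping.single x 1) ` {d. b d \<noteq> 0}" using a s by auto
  qed
  moreover have "finite {d. b d \<noteq> 0}" using assms by (simp add: exponents_def)
  ultimately have "a \<in> exponents gens"
    unfolding exponents_def using finite_subset a_def by (auto split: if_splits)
  moreover have "reindex a = b"
    using a assms by (auto simp: reindex_def exponents_def fun_eq_iff)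
  ultimately show ?thesis by blast
qed

lemma leading_monomial:
  assumes "linear_order_on gens r" "a \<in> exponents gens"
  shows "leading (ordered_monomial H r a) (power_prod (reindex a))"
proof -
  let ?s = "\<lambda>x. Poly_Mapping.single x (1::complex)"
  have supp: "finite {s. a s \<noteq> 0}" "{s. a s \<noteq> 0} \<subseteq> gens"
    using assms(2) by (auto simp: exponents_def)
  \<comment> \<open>Stated for all duplicate-free lists of generators so that the induction applies
    to the tail. The leading class is a \<open>finprod\<close> over a set, which forgets the order
    of the list.\<close>
  have "\<exists>ds. set ds \<subseteq> D \<and> distinct ds \<and> xs = map ?s ds \<and>
      leading (foldr (\<lambda>x m. (x [^]\<^bsub>H\<^esub> a x) \<otimes>\<^bsub>H\<^esub> m) xs \<one>\<^bsub>H\<^esub>)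
        (finprod G (\<lambda>d. d [^] reindex a d) (set ds))"
    if "set xs \<subseteq> gens" "distinct xs" for xs
    using that
  proof (induction xs)
    case Nil
    then show ?case using leading_one by auto
  next
    case (Cons x xs)
    then obtain ds where ds: "set ds \<subseteq> D" "distinct ds" "xs = map ?s ds"
      "leading (foldr (\<lambda>x m. (x [^]\<^bsub>H\<^esub> a x) \<otimes>\<^bsub>H\<^esub> m) xs \<one>\<^bsub>H\<^esub>)
        (finprod G (\<lambda>d. d [^] reindex a d) (set ds))" by auto
    obtain d where d: "d \<in> D" "x = ?s d" using Cons.prems by (auto simp: gens_def)
    have "d \<notin> set ds" using Cons.prems ds d by auto
    moreover have "leading (x [^]\<^bsub>H\<^esub> a x) (d [^] reindex a d)"
      using leading_pow[OF leading_single] d D_carrier by (auto simp: reindex_def)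
    ultimately show ?case
      using ds d D_carrier leading_mult[OF _ ds(4)]
      by (intro exI[of _ "d # ds"]) (auto simp: Pi_iff subset_iff)
  qed
  from this[of "ordered_list r {s. a s \<noteq> 0}"] ordered_list[OF assms(1) supp] supp(2)
  obtain ds where ds: "set ds \<subseteq> D" "ordered_list r {s. a s \<noteq> 0} = map ?s ds"
    "leading (ordered_monomial H r a) (finprod G (\<lambda>d. d [^] reindex a d) (set ds))"
    unfolding ordered_monomial_def by auto
  have "?s ` set ds = ?s ` {d. reindex a d \<noteq> 0}"
    using ds(2) ordered_list(1)[OF assms(1) supp] reindex_support[OF assms(2)]
    by (metis list.set_map)
  then have "set ds = {d. reindex a d \<noteq> 0}"
    by (rule iffD1[OF inj_image_eq_iff[OF single_inj]])
  then show ?thesis using ds(3) by (simp add: power_prod_def)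
qed

text \<open>Of two different leading classes each would have strictly fewer endomorphisms than the
  other.\<close>

lemma leading_unique: "leading f m \<Longrightarrow> leading f n \<Longrightarrow> m = n"
  unfolding leading_def by (metis less_asym)

section \<open>Linear independence and spanning\<close>

lemma carrier_subspace: "pm.subspace (carrier H)"
proof -
  have "carrier H = {f. \<forall>x. x \<notin> carrier G \<longrightarrow> Poly_Mapping.lookup f x = 0}"
    by (auto simp: hall_ring_def in_keys_iff)
  then show ?thesis by (auto simp: pm.subspace_def lookup_add)
qed

lemma sum_of_singles:
  "(\<Sum>z\<in>Poly_Mapping.keys f. pm_scale (Poly_Mapping.lookup f z) (Poly_Mapping.single z 1)) = f"
  by (rule poly_mapping_eqI)
    (simp add: lookup_sum lookup_single when_def sum.delta' in_keys_iff if_distrib cong: if_cong)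

theorem PBW: "universal_PBW_basis H gens"
  unfolding universal_PBW_basis_def
proof (intro conjI allI impI)
  show "gens \<subseteq> carrier H"
    using D_carrier by (auto simp: gens_def hall_ring_def)
  fix r assume r: "linear_order_on gens r"
  let ?m = "ordered_monomial H r" and ?E = "exponents gens"
  let ?p = "\<lambda>a. power_prod (reindex a)"
  have lead: "leading (?m a) (?p a)" if "a \<in> ?E" for a
    using leading_monomial[OF r that] .
  have p_inj: "inj_on ?p ?E"
    using comp_inj_on[OF reindex_inj inj_on_subset[OF power_prod_inj]] reindex_exponents
    by (auto simp: comp_def)
  show inj: "inj_on ?m ?E"
    using lead p_inj leading_unique by (metis (no_types, lifting) inj_on_def)
  show "pm.independent (?m ` ?E)"
  proof
    assume "pm.dependent (?m ` ?E)"
    then obtain T u where T: "finite T" "T \<subseteq> ?m ` ?E" "(\<Sum>v\<in>T. pm_scale (u v) v) = 0" "\<exists>v\<in>T. u v \<noteq> 0"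
      unfolding pm.dependent_explicit by blast
    define T' where "T' = {v \<in> T. u v \<noteq> 0}"
    have T': "finite T'" "T' \<noteq> {}" "T' \<subseteq> ?m ` ?E" using T by (auto simp: T'_def)
    have "\<exists>l. \<forall>v\<in>?m ` ?E. leading v (l v)" using lead by (intro bchoice) auto
    then obtain l where l: "\<forall>v\<in>?m ` ?E. leading v (l v)" ..
    \<comment> \<open>Among the monomials with nonzero coefficient, one whose leading class has the
      most endomorphisms is chosen: that class cannot be a lower term of another such
      monomial.\<close>
    obtain v where v: "v \<in> T'" "\<forall>w\<in>T'. hom (l w) (l w) \<le> hom (l v) (l v)"
    proof -
      have "Max ((\<lambda>w. hom (l w) (l w)) ` T') \<in> (\<lambda>w. hom (l w) (l w)) ` T'"
        using T' by (intro Max_in) auto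
      then obtain v where "v \<in> T'" "hom (l v) (l v) = Max ((\<lambda>w. hom (l w) (l w)) ` T')" by auto
      then show thesis using T'(1) by (intro that[of v]) auto
    qed
    have zero: "Poly_Mapping.lookup w (l v) = 0" if w: "w \<in> T'" "w \<noteq> v" for w
    proof (rule ccontr)
      assume "Poly_Mapping.lookup w (l v) \<noteq> 0"
      then have "l v \<in> Poly_Mapping.keys w" by (simp add: in_keys_iff)
      moreover have "leading w (l w)" "hom (l w) (l w) \<le> hom (l v) (l v)"
        using l w(1) v(2) T'(3) by blast+
      ultimately have "l v = l w" unfolding leading_def by (meson linorder_not_less)
      \<comment> \<open>Equal leading classes mean equal exponents, hence the same monomial.\<close>
      have "v \<in> ?m ` ?E" "w \<in> ?m ` ?E" using v(1) w(1) T'(3) by blast+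
      then obtain a b where ab: "a \<in> ?E" "v = ?m a" "b \<in> ?E" "w = ?m b"
        by (elim imageE)
      have "leading v (l v)" "leading w (l v)"
        using l \<open>v \<in> ?m ` ?E\<close> \<open>w \<in> ?m ` ?E\<close> \<open>l v = l w\<close> by auto
      then have "?p a = ?p b"
        using leading_unique[OF lead[OF ab(1)], of "l v"] leading_unique[OF lead[OF ab(3)], of "l v"] ab
        by simp
      then have "a = b"
        using inj_onD[OF p_inj _ ab(1,3)] by simp
      then show False using ab w(2) by simp
    qed
    have "0 = Poly_Mapping.lookup (\<Sum>w\<in>T. pm_scale (u w) w) (l v)" using T(3) by simp
    also have "\<dots> = (\<Sum>w\<in>T. u w * Poly_Mapping.lookup w (l v))" by (simp add: lookup_sum)
    also have "\<dots> = (\<Sum>w\<in>{v}. u w * Poly_Mapping.lookup w (l v))"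
      using T(1) v(1) zero by (intro sum.mono_neutral_right) (auto simp: T'_def)
    also have "\<dots> \<noteq> 0"
      using v(1) l T'(3) by (auto simp: T'_def leading_def in_keys_iff)
    finally show False by simp
  qed
  \<comment> \<open>The monomial led by z differs from a multiple of z only by classes with fewer
    endomorphisms, which lie in the span by induction.\<close>
  have single: "Poly_Mapping.single z 1 \<in> pm.span (?m ` ?E)" if "z \<in> carrier G" for z
    using that
  proof (induction "hom z z" arbitrary: z rule: less_induct)
    case less
    obtain a where a: "a \<in> ?E" "?p a = z"
      using decomposition[OF less.prems] reindex_surj by metis
    let ?f = "?m a" and ?S = "pm.span (?m ` ?E)"
    let ?t = "\<lambda>w. pm_scale (Poly_Mapping.lookup ?f w) (Poly_Mapping.single w 1)"
    have ld: "leading ?f z" using lead[OF a(1)] a(2) by simp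
    then have z: "z \<in> Poly_Mapping.keys ?f" by (simp add: leading_def)
    have "?f = ?t z + (\<Sum>w\<in>Poly_Mapping.keys ?f - {z}. ?t w)"
      using sum.remove[OF finite_keys z, of ?t] sum_of_singles[of ?f] by simp
    then have "?t z = ?f - (\<Sum>w\<in>Poly_Mapping.keys ?f - {z}. ?t w)"
      by (intro eq_diff_eq[THEN iffD2]) (rule sym)
    moreover have "?f \<in> ?S" using a by (intro pm.span_base) auto
    moreover have "(\<Sum>w\<in>Poly_Mapping.keys ?f - {z}. ?t w) \<in> ?S"
      using less.hyps ld by (intro pm.span_sum pm.span_scale) (auto simp: leading_def)
    ultimately have "?t z \<in> ?S" by (simp add: pm.span_diff)
    \<comment> \<open>The leading coefficient need not be 1, but it is a nonzero complex
      number.\<close>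
    then have "pm_scale (1 / Poly_Mapping.lookup ?f z) (?t z) \<in> ?S" by (rule pm.span_scale)
    moreover have "Poly_Mapping.lookup ?f z \<noteq> 0" using z by (simp add: in_keys_iff)
    ultimately show ?case by simp
  qed
  show "pm.span (?m ` ?E) = carrier H"
  proof
    show "pm.span (?m ` ?E) \<subseteq> carrier H"
      using lead leading_carrier by (intro pm.span_minimal carrier_subspace) auto
    show "carrier H \<subseteq> pm.span (?m ` ?E)"
    proof
      fix f assume "f \<in> carrier H"
      then have "(\<Sum>z\<in>Poly_Mapping.keys f. pm_scale (Poly_Mapping.lookup f z) (Poly_Mapping.single z 1))
          \<in> pm.span (?m ` ?E)"
        using single by (intro pm.span_sum pm.span_scale) (auto simp: hall_ring_def)
      then show "f \<in> pm.span (?m ` ?E)" using sum_of_singles[of f] by simp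
    qed
  qed
qed

end

section \<open>Finite cyclic complexes\<close>

abbreviation car :: "('a, 'm) cyclic_complex \<Rightarrow> 'm set" where
  "car X \<equiv> carrier (fst X)"

text \<open>What the module theory uses of the path algebra. The facts about the multiples of the
  unit serve to identify finite dimensional modules with finite ones in
  \<open>fd_module_iff\<close>.\<close>

locale finite_alg =
  fixes K :: "('k, 'x) ring_scheme" and A :: "('k, 'a) module"
  assumes ring_A: "ring A"
    and finite_K: "finite (carrier K)"
    and one_K: "\<one>\<^bsub>K\<^esub> \<in> carrier K"
    and zero_K: "\<zero>\<^bsub>K\<^esub> \<in> carrier K"
    and scalar_zero: "\<zero>\<^bsub>K\<^esub> \<odot>\<^bsub>A\<^esub> \<one>\<^bsub>A\<^esub> = \<zero>\<^bsub>A\<^esub>"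
    and scalar_closed: "c \<in> carrier K \<Longrightarrow> c \<odot>\<^bsub>A\<^esub> \<one>\<^bsub>A\<^esub> \<in> carrier A"
    and scalar_one: "\<one>\<^bsub>K\<^esub> \<odot>\<^bsub>A\<^esub> \<one>\<^bsub>A\<^esub> = \<one>\<^bsub>A\<^esub>"
begin

sublocale A: ring A by (rule ring_A)

text \<open>The element type stays arbitrary because direct sums live on pairs, whereas
  \<open>C1P\<close> is tied to the naturals.\<close>

definition is_cc :: "('a, 'm) cyclic_complex \<Rightarrow> bool" where
  "is_cc X \<longleftrightarrow> left_module A (fst X) \<and> snd X \<in> mod_hom A (fst X) (fst X) \<and>
     (\<forall>x \<in> car X. snd X (snd X x) = \<zero>\<^bsub>fst X\<^esub>)"

definition fin_cc :: "('a, 'm) cyclic_complex \<Rightarrow> bool" where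
  "fin_cc X \<longleftrightarrow> is_cc X \<and> finite (car X)"

abbreviation hom where "hom \<equiv> cc_hom A"

lemma fin_ccD [simp]: "fin_cc X \<Longrightarrow> is_cc X" "fin_cc X \<Longrightarrow> finite (car X)"
  by (auto simp: fin_cc_def)

lemma is_cc_left_module: "is_cc X \<Longrightarrow> left_module A (fst X)"
  by (simp add: is_cc_def)

lemma is_cc_abelian_group: "is_cc X \<Longrightarrow> abelian_group (fst X)"
  by (simp add: is_cc_def left_module_def)

section \<open>Calculation rules inside a complex\<close>

lemma cc_ops [simp]:
  assumes "is_cc X"
  shows "\<zero>\<^bsub>fst X\<^esub> \<in> car X"
    and "x \<in> car X \<Longrightarrow> y \<in> car X \<Longrightarrow> x \<oplus>\<^bsub>fst X\<^esub> y \<in> car X"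
    and "x \<in> car X \<Longrightarrow> y \<in> car X \<Longrightarrow> x \<ominus>\<^bsub>fst X\<^esub> y \<in> car X"
    and "x \<in> car X \<Longrightarrow> \<ominus>\<^bsub>fst X\<^esub> x \<in> car X"
    and "a \<in> carrier A \<Longrightarrow> x \<in> car X \<Longrightarrow> a \<odot>\<^bsub>fst X\<^esub> x \<in> car X"
    and "x \<in> car X \<Longrightarrow> snd X x \<in> car X"
    and "x \<in> car X \<Longrightarrow> \<zero>\<^bsub>fst X\<^esub> \<oplus>\<^bsub>fst X\<^esub> x = x"
    and "x \<in> car X \<Longrightarrow> x \<oplus>\<^bsub>fst X\<^esub> \<zero>\<^bsub>fst X\<^esub> = x"
    and "x \<in> car X \<Longrightarrow> \<ominus>\<^bsub>fst X\<^esub> x \<oplus>\<^bsub>fst X\<^esub> x = \<zero>\<^bsub>fst X\<^esub>"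
    and "x \<in> car X \<Longrightarrow> x \<ominus>\<^bsub>fst X\<^esub> x = \<zero>\<^bsub>fst X\<^esub>"
    and "x \<in> car X \<Longrightarrow> snd X (snd X x) = \<zero>\<^bsub>fst X\<^esub>"
    and "x \<in> car X \<Longrightarrow> \<one>\<^bsub>A\<^esub> \<odot>\<^bsub>fst X\<^esub> x = x"
    and "a \<in> carrier A \<Longrightarrow> b \<in> carrier A \<Longrightarrow> x \<in> car X \<Longrightarrow>
      (a \<otimes>\<^bsub>A\<^esub> b) \<odot>\<^bsub>fst X\<^esub> x = a \<odot>\<^bsub>fst X\<^esub> (b \<odot>\<^bsub>fst X\<^esub> x)"
    and "a \<in> carrier A \<Longrightarrow> b \<in> carrier A \<Longrightarrow> x \<in> car X \<Longrightarrow>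
      (a \<oplus>\<^bsub>A\<^esub> b) \<odot>\<^bsub>fst X\<^esub> x = a \<odot>\<^bsub>fst X\<^esub> x \<oplus>\<^bsub>fst X\<^esub> b \<odot>\<^bsub>fst X\<^esub> x"
    and "a \<in> carrier A \<Longrightarrow> x \<in> car X \<Longrightarrow> y \<in> car X \<Longrightarrow>
      a \<odot>\<^bsub>fst X\<^esub> (x \<oplus>\<^bsub>fst X\<^esub> y) = a \<odot>\<^bsub>fst X\<^esub> x \<oplus>\<^bsub>fst X\<^esub> a \<odot>\<^bsub>fst X\<^esub> y"
    and "x \<in> car X \<Longrightarrow> y \<in> car X \<Longrightarrow>
      snd X (x \<oplus>\<^bsub>fst X\<^esub> y) = snd X x \<oplus>\<^bsub>fst X\<^esub> snd X y"
    and "a \<in> carrier A \<Longrightarrow> x \<in> car X \<Longrightarrow> snd X (a \<odot>\<^bsub>fst X\<^esub> x) = a \<odot>\<^bsub>fst X\<^esub> snd X x"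
proof -
  interpret X: left_module A "fst X" using assms by (rule is_cc_left_module)
  show "\<zero>\<^bsub>fst X\<^esub> \<in> car X" by simp
  show "x \<in> car X \<Longrightarrow> y \<in> car X \<Longrightarrow> x \<oplus>\<^bsub>fst X\<^esub> y \<in> car X" by simp
  show "x \<in> car X \<Longrightarrow> y \<in> car X \<Longrightarrow> x \<ominus>\<^bsub>fst X\<^esub> y \<in> car X" by simp
  show "x \<in> car X \<Longrightarrow> \<ominus>\<^bsub>fst X\<^esub> x \<in> car X" by simp
  show "a \<in> carrier A \<Longrightarrow> x \<in> car X \<Longrightarrow> a \<odot>\<^bsub>fst X\<^esub> x \<in> car X" by (rule X.smult_closed)
  show "x \<in> car X \<Longrightarrow> \<zero>\<^bsub>fst X\<^esub> \<oplus>\<^bsub>fst X\<^esub> x = x" by simp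
  show "x \<in> car X \<Longrightarrow> x \<oplus>\<^bsub>fst X\<^esub> \<zero>\<^bsub>fst X\<^esub> = x" by simp
  show "x \<in> car X \<Longrightarrow> \<ominus>\<^bsub>fst X\<^esub> x \<oplus>\<^bsub>fst X\<^esub> x = \<zero>\<^bsub>fst X\<^esub>" by (rule X.M.l_neg)
  show "x \<in> car X \<Longrightarrow> x \<ominus>\<^bsub>fst X\<^esub> x = \<zero>\<^bsub>fst X\<^esub>" by (simp add: X.M.minus_eq X.M.r_neg)
  show "x \<in> car X \<Longrightarrow> \<one>\<^bsub>A\<^esub> \<odot>\<^bsub>fst X\<^esub> x = x" by (rule X.smult_one)
  show "a \<in> carrier A \<Longrightarrow> b \<in> carrier A \<Longrightarrow> x \<in> car X \<Longrightarrow>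
      (a \<otimes>\<^bsub>A\<^esub> b) \<odot>\<^bsub>fst X\<^esub> x = a \<odot>\<^bsub>fst X\<^esub> (b \<odot>\<^bsub>fst X\<^esub> x)" by (rule X.smult_assoc1)
  show "a \<in> carrier A \<Longrightarrow> b \<in> carrier A \<Longrightarrow> x \<in> car X \<Longrightarrow>
      (a \<oplus>\<^bsub>A\<^esub> b) \<odot>\<^bsub>fst X\<^esub> x = a \<odot>\<^bsub>fst X\<^esub> x \<oplus>\<^bsub>fst X\<^esub> b \<odot>\<^bsub>fst X\<^esub> x" by (rule X.smult_l_distr)
  show "a \<in> carrier A \<Longrightarrow> x \<in> car X \<Longrightarrow> y \<in> car X \<Longrightarrow>
      a \<odot>\<^bsub>fst X\<^esub> (x \<oplus>\<^bsub>fst X\<^esub> y) = a \<odot>\<^bsub>fst X\<^esub> x \<oplus>\<^bsub>fst X\<^esub> a \<odot>\<^bsub>fst X\<^esub> y" by (rule X.smult_r_distr)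
qed (use assms in \<open>auto simp: is_cc_def mod_hom_def\<close>)

lemma cc_add_ac:
  assumes "is_cc X" "x \<in> car X" "y \<in> car X"
  shows "x \<oplus>\<^bsub>fst X\<^esub> y = y \<oplus>\<^bsub>fst X\<^esub> x"
    and "z \<in> car X \<Longrightarrow> (x \<oplus>\<^bsub>fst X\<^esub> y) \<oplus>\<^bsub>fst X\<^esub> z = x \<oplus>\<^bsub>fst X\<^esub> (y \<oplus>\<^bsub>fst X\<^esub> z)"
    and "z \<in> car X \<Longrightarrow> x \<oplus>\<^bsub>fst X\<^esub> (y \<oplus>\<^bsub>fst X\<^esub> z) = y \<oplus>\<^bsub>fst X\<^esub> (x \<oplus>\<^bsub>fst X\<^esub> z)"
proof -
  interpret X: abelian_group "fst X" using assms(1) by (rule is_cc_abelian_group)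
  show "x \<oplus>\<^bsub>fst X\<^esub> y = y \<oplus>\<^bsub>fst X\<^esub> x"
    and "z \<in> car X \<Longrightarrow> (x \<oplus>\<^bsub>fst X\<^esub> y) \<oplus>\<^bsub>fst X\<^esub> z = x \<oplus>\<^bsub>fst X\<^esub> (y \<oplus>\<^bsub>fst X\<^esub> z)"
    and "z \<in> car X \<Longrightarrow> x \<oplus>\<^bsub>fst X\<^esub> (y \<oplus>\<^bsub>fst X\<^esub> z) = y \<oplus>\<^bsub>fst X\<^esub> (x \<oplus>\<^bsub>fst X\<^esub> z)"
    using assms by (auto simp: X.a_assoc X.a_comm X.a_lcomm)
qed

lemma cc_diff_add [simp]:
  assumes "is_cc X" "x \<in> car X" "y \<in> car X"
  shows "(x \<ominus>\<^bsub>fst X\<^esub> y) \<oplus>\<^bsub>fst X\<^esub> y = x" "y \<oplus>\<^bsub>fst X\<^esub> (x \<ominus>\<^bsub>fst X\<^esub> y) = x"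
    "(x \<oplus>\<^bsub>fst X\<^esub> y) \<ominus>\<^bsub>fst X\<^esub> y = x"
proof -
  interpret X: abelian_group "fst X" using assms(1) by (rule is_cc_abelian_group)
  show "(x \<ominus>\<^bsub>fst X\<^esub> y) \<oplus>\<^bsub>fst X\<^esub> y = x" "y \<oplus>\<^bsub>fst X\<^esub> (x \<ominus>\<^bsub>fst X\<^esub> y) = x"
    "(x \<oplus>\<^bsub>fst X\<^esub> y) \<ominus>\<^bsub>fst X\<^esub> y = x"
    using assms by (simp_all add: X.minus_eq X.a_ac X.r_neg X.l_neg)
qed

lemma cc_diff_unique:
  assumes "is_cc X" "x \<in> car X" "y \<in> car X" "z \<in> car X" "z \<oplus>\<^bsub>fst X\<^esub> y = x"
  shows "z = x \<ominus>\<^bsub>fst X\<^esub> y"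
  using cc_diff_add(3)[OF assms(1,4,3)] assms(5) by simp

lemma cc_add_cancel:
  assumes "is_cc X" "x \<in> car X" "y \<in> car X" "z \<in> car X"
  shows "z \<oplus>\<^bsub>fst X\<^esub> x = z \<oplus>\<^bsub>fst X\<^esub> y \<longleftrightarrow> x = y"
  using assms by (metis cc_add_ac(1) cc_diff_add(3))

lemma smult_zero [simp]:
  assumes "is_cc X" "a \<in> carrier A"
  shows "a \<odot>\<^bsub>fst X\<^esub> \<zero>\<^bsub>fst X\<^esub> = \<zero>\<^bsub>fst X\<^esub>"
proof -
  have "a \<odot>\<^bsub>fst X\<^esub> \<zero>\<^bsub>fst X\<^esub> \<oplus>\<^bsub>fst X\<^esub> a \<odot>\<^bsub>fst X\<^esub> \<zero>\<^bsub>fst X\<^esub> =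
      a \<odot>\<^bsub>fst X\<^esub> \<zero>\<^bsub>fst X\<^esub> \<oplus>\<^bsub>fst X\<^esub> \<zero>\<^bsub>fst X\<^esub>"
    using cc_ops(15)[OF assms(1), of a "\<zero>\<^bsub>fst X\<^esub>" "\<zero>\<^bsub>fst X\<^esub>"] assms by simp
  then show ?thesis
    by (rule iffD1[OF cc_add_cancel, rotated -1]) (use assms in auto)
qed

lemma cc_diff_zero:
  assumes "is_cc X" "x \<in> car X" "y \<in> car X"
  shows "x \<ominus>\<^bsub>fst X\<^esub> y = \<zero>\<^bsub>fst X\<^esub> \<longleftrightarrow> x = y"
  using assms by (metis cc_diff_add(1) cc_ops(7,10))

lemma homI:
  assumes "f \<in> car X \<rightarrow>\<^sub>E car Y"
    and "\<And>x y. x \<in> car X \<Longrightarrow> y \<in> car X \<Longrightarrow> f (x \<oplus>\<^bsub>fst X\<^esub> y) = f x \<oplus>\<^bsub>fst Y\<^esub> f y"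
    and "\<And>a x. a \<in> carrier A \<Longrightarrow> x \<in> car X \<Longrightarrow> f (a \<odot>\<^bsub>fst X\<^esub> x) = a \<odot>\<^bsub>fst Y\<^esub> f x"
    and "\<And>x. x \<in> car X \<Longrightarrow> snd Y (f x) = f (snd X x)"
  shows "f \<in> hom X Y"
  using assms by (simp add: cc_hom_def mod_hom_def)

lemma hom_restrictI:
  assumes "is_cc X"
    and "\<And>x. x \<in> car X \<Longrightarrow> f x \<in> car Y"
    and "\<And>x y. x \<in> car X \<Longrightarrow> y \<in> car X \<Longrightarrow> f (x \<oplus>\<^bsub>fst X\<^esub> y) = f x \<oplus>\<^bsub>fst Y\<^esub> f y"
    and "\<And>a x. a \<in> carrier A \<Longrightarrow> x \<in> car X \<Longrightarrow> f (a \<odot>\<^bsub>fst X\<^esub> x) = a \<odot>\<^bsub>fst Y\<^esub> f x"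
    and "\<And>x. x \<in> car X \<Longrightarrow> snd Y (f x) = f (snd X x)"
  shows "restrict f (car X) \<in> hom X Y"
  using assms by (intro homI) auto

lemma homD:
  assumes "f \<in> hom X Y"
  shows "x \<in> car X \<Longrightarrow> f x \<in> car Y"
    and "x \<in> car X \<Longrightarrow> y \<in> car X \<Longrightarrow> f (x \<oplus>\<^bsub>fst X\<^esub> y) = f x \<oplus>\<^bsub>fst Y\<^esub> f y"
    and "a \<in> carrier A \<Longrightarrow> x \<in> car X \<Longrightarrow> f (a \<odot>\<^bsub>fst X\<^esub> x) = a \<odot>\<^bsub>fst Y\<^esub> f x"
    and "x \<in> car X \<Longrightarrow> f (snd X x) = snd Y (f x)"
  using assms by (auto simp: cc_hom_def mod_hom_def)

lemma hom_ext: "f \<in> hom X Y \<Longrightarrow> f \<in> car X \<rightarrow>\<^sub>E car Y"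
  by (simp add: cc_hom_def mod_hom_def)

lemma hom_eqI: "f \<in> hom X Y \<Longrightarrow> g \<in> hom X Y \<Longrightarrow> (\<And>x. x \<in> car X \<Longrightarrow> f x = g x) \<Longrightarrow> f = g"
  by (rule PiE_ext[OF hom_ext hom_ext])

lemma hom_zero [simp]:
  assumes "f \<in> hom X Y" "is_cc X" "is_cc Y"
  shows "f \<zero>\<^bsub>fst X\<^esub> = \<zero>\<^bsub>fst Y\<^esub>"
proof -
  have "f \<zero>\<^bsub>fst X\<^esub> \<oplus>\<^bsub>fst Y\<^esub> f \<zero>\<^bsub>fst X\<^esub> = f \<zero>\<^bsub>fst X\<^esub> \<oplus>\<^bsub>fst Y\<^esub> \<zero>\<^bsub>fst Y\<^esub>"
    using homD(1,2)[OF assms(1)] assms by (metis cc_ops(1,7,8))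
  then show ?thesis
    by (rule iffD1[OF cc_add_cancel, rotated -1]) (use assms homD(1)[OF assms(1)] in auto)
qed

lemma hom_diff:
  assumes "f \<in> hom X Y" "is_cc X" "is_cc Y" "x \<in> car X" "y \<in> car X"
  shows "f (x \<ominus>\<^bsub>fst X\<^esub> y) = f x \<ominus>\<^bsub>fst Y\<^esub> f y"
proof (rule cc_diff_unique)
  show "f (x \<ominus>\<^bsub>fst X\<^esub> y) \<oplus>\<^bsub>fst Y\<^esub> f y = f x"
    using assms by (simp flip: homD(2)[OF assms(1)])
qed (use assms homD(1)[OF assms(1)] in auto)

lemma d_hom: "is_cc X \<Longrightarrow> snd X \<in> hom X X"
  unfolding is_cc_def cc_hom_def by blast

lemma cc_diff_ops:
  assumes X: "is_cc X" and x: "x \<in> car X" "y \<in> car X"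
  shows "snd X (x \<ominus>\<^bsub>fst X\<^esub> y) = snd X x \<ominus>\<^bsub>fst X\<^esub> snd X y"
    and "a \<in> carrier A \<Longrightarrow> a \<odot>\<^bsub>fst X\<^esub> (x \<ominus>\<^bsub>fst X\<^esub> y) = a \<odot>\<^bsub>fst X\<^esub> x \<ominus>\<^bsub>fst X\<^esub> a \<odot>\<^bsub>fst X\<^esub> y"
    and "x' \<in> car X \<Longrightarrow> y' \<in> car X \<Longrightarrow> (x \<oplus>\<^bsub>fst X\<^esub> x') \<ominus>\<^bsub>fst X\<^esub> (y \<oplus>\<^bsub>fst X\<^esub> y') =
      (x \<ominus>\<^bsub>fst X\<^esub> y) \<oplus>\<^bsub>fst X\<^esub> (x' \<ominus>\<^bsub>fst X\<^esub> y')"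
proof -
  show "snd X (x \<ominus>\<^bsub>fst X\<^esub> y) = snd X x \<ominus>\<^bsub>fst X\<^esub> snd X y"
    by (rule hom_diff[OF d_hom[OF X] X X x])
  show "a \<odot>\<^bsub>fst X\<^esub> (x \<ominus>\<^bsub>fst X\<^esub> y) = a \<odot>\<^bsub>fst X\<^esub> x \<ominus>\<^bsub>fst X\<^esub> a \<odot>\<^bsub>fst X\<^esub> y"
    if "a \<in> carrier A"
    using assms that by (intro cc_diff_unique) (simp_all flip: cc_ops(15))
  show "(x \<oplus>\<^bsub>fst X\<^esub> x') \<ominus>\<^bsub>fst X\<^esub> (y \<oplus>\<^bsub>fst X\<^esub> y') =
      (x \<ominus>\<^bsub>fst X\<^esub> y) \<oplus>\<^bsub>fst X\<^esub> (x' \<ominus>\<^bsub>fst X\<^esub> y')" if x': "x' \<in> car X" "y' \<in> car X"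
  proof -
    interpret X: abelian_group "fst X" using X by (rule is_cc_abelian_group)
    show ?thesis using x x' by (simp add: X.minus_eq X.minus_add X.a_ac)
  qed
qed

lemma finite_hom [simp]: "fin_cc X \<Longrightarrow> fin_cc Y \<Longrightarrow> finite (hom X Y)"
  by (rule finite_subset[of _ "car X \<rightarrow>\<^sub>E car Y"]) (use hom_ext in blast, auto intro!: finite_PiE)

subsection \<open>Operations on homomorphisms\<close>

lemma hom_compose: "f \<in> hom X Y \<Longrightarrow> g \<in> hom Y Z \<Longrightarrow> is_cc X \<Longrightarrow> compose (car X) g f \<in> hom X Z"
  unfolding compose_def by (intro hom_restrictI) (simp_all add: homD)

lemma hom_id: "is_cc X \<Longrightarrow> (\<lambda>x\<in>car X. x) \<in> hom X X"
  by (intro hom_restrictI) auto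

lemma hom_zeroI: "is_cc X \<Longrightarrow> is_cc Y \<Longrightarrow> (\<lambda>x\<in>car X. \<zero>\<^bsub>fst Y\<^esub>) \<in> hom X Y"
  by (intro hom_restrictI) (auto simp: hom_zero[OF d_hom])

definition hadd :: "('a, 'm) cyclic_complex \<Rightarrow> ('a, 'n) cyclic_complex \<Rightarrow> ('m \<Rightarrow> 'n) \<Rightarrow> ('m \<Rightarrow> 'n) \<Rightarrow> 'm \<Rightarrow> 'n" where
  "hadd X Y f g = (\<lambda>x\<in>car X. f x \<oplus>\<^bsub>fst Y\<^esub> g x)"

definition hdiff :: "('a, 'm) cyclic_complex \<Rightarrow> ('a, 'n) cyclic_complex \<Rightarrow> ('m \<Rightarrow> 'n) \<Rightarrow> ('m \<Rightarrow> 'n) \<Rightarrow> 'm \<Rightarrow> 'n" where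
  "hdiff X Y f g = (\<lambda>x\<in>car X. f x \<ominus>\<^bsub>fst Y\<^esub> g x)"

lemma hom_hadd:
  assumes "f \<in> hom X Y" "g \<in> hom X Y" "is_cc X" "is_cc Y"
  shows "hadd X Y f g \<in> hom X Y"
  unfolding hadd_def using assms
  by (intro hom_restrictI) (simp_all add: homD[OF assms(1)] homD[OF assms(2)] cc_add_ac)

lemma hom_hdiff:
  assumes "f \<in> hom X Y" "g \<in> hom X Y" "is_cc X" "is_cc Y"
  shows "hdiff X Y f g \<in> hom X Y"
  unfolding hdiff_def using assms
  by (intro hom_restrictI) (simp_all add: homD[OF assms(1)] homD[OF assms(2)] cc_diff_ops)

text \<open>Universal property of a kernel. Preimages under an injective map are unique, and this
  uniqueness forces the lift to respect sums, scalars and differentials.\<close>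

lemma hom_lift:
  assumes \<phi>: "\<phi> \<in> hom Y Z" "inj_on \<phi> (car Y)" and f: "f \<in> hom T Z" "f ` car T \<subseteq> \<phi> ` car Y"
    and cc: "is_cc T" "is_cc Y"
  shows "\<exists>g\<in>hom T Y. \<forall>t\<in>car T. \<phi> (g t) = f t"
proof -
  define g where "g t = inv_into (car Y) \<phi> (f t)" for t
  have g: "g t \<in> car Y" "\<phi> (g t) = f t" if "t \<in> car T" for t
  proof -
    have "f t \<in> \<phi> ` car Y" using f(2) that by blast
    then show "g t \<in> car Y" "\<phi> (g t) = f t"
      by (simp_all add: g_def inv_into_into f_inv_into_f)
  qed
  have "restrict g (car T) \<in> hom T Y"
    using cc g by (intro hom_restrictI inj_onD[OF \<phi>(2)])
      (simp_all add: homD[OF \<phi>(1)] homD[OF f(1)])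
  then show ?thesis using g by (intro bexI[of _ "restrict g (car T)"]) auto
qed

text \<open>Universal property of a cokernel. The value of f depends only on that of
  \<open>\<psi>\<close>, since the difference of two preimages lies in the kernel; any choice of
  preimages therefore gives a morphism.\<close>

lemma hom_factor:
  assumes \<psi>: "\<psi> \<in> hom Z X" "\<psi> ` car Z = car X" and f: "f \<in> hom Z T"
    and ker: "\<And>z. z \<in> car Z \<Longrightarrow> \<psi> z = \<zero>\<^bsub>fst X\<^esub> \<Longrightarrow> f z = \<zero>\<^bsub>fst T\<^esub>"
    and cc: "is_cc Z" "is_cc X" "is_cc T"
  shows "\<exists>g\<in>hom X T. \<forall>z\<in>car Z. g (\<psi> z) = f z"
proof
  let ?i = "inv_into (car Z) \<psi>"
  let ?g = "\<lambda>x\<in>car X. f (?i x)"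
  have i: "?i x \<in> car Z" "\<psi> (?i x) = x" if "x \<in> car X" for x
    using \<psi>(2) that by (auto intro: inv_into_into f_inv_into_f)
  have eq: "f z = f z'" if "z \<in> car Z" "z' \<in> car Z" "\<psi> z = \<psi> z'" for z z'
    using that ker[of "z \<ominus>\<^bsub>fst Z\<^esub> z'"] cc homD(1)[OF f] homD(1)[OF \<psi>(1)]
    by (simp add: hom_diff[OF \<psi>(1)] hom_diff[OF f] cc_diff_zero)
  show "\<forall>z\<in>car Z. ?g (\<psi> z) = f z"
    using i homD(1)[OF \<psi>(1)] by (auto intro: eq)
  have "f (?i (x \<oplus>\<^bsub>fst X\<^esub> y)) = f (?i x \<oplus>\<^bsub>fst Z\<^esub> ?i y)" if "x \<in> car X" "y \<in> car X" for x y
    using that i cc by (intro eq) (simp_all add: homD[OF \<psi>(1)])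
  moreover have "f (?i (a \<odot>\<^bsub>fst X\<^esub> x)) = f (a \<odot>\<^bsub>fst Z\<^esub> ?i x)" if "a \<in> carrier A" "x \<in> car X" for a x
    using that i cc by (intro eq) (simp_all add: homD[OF \<psi>(1)])
  moreover have "f (?i (snd X x)) = f (snd Z (?i x))" if "x \<in> car X" for x
    using that i cc by (intro eq) (simp_all add: homD[OF \<psi>(1)])
  ultimately show "?g \<in> hom X T"
    using cc i by (intro hom_restrictI) (simp_all add: homD[OF f])
qed

text \<open>Lifting the identity of Y through f yields an inverse that is a morphism by
  construction.\<close>

lemma isos_inverse:
  assumes "f \<in> cc_isos A X Y" "is_cc X" "is_cc Y"
  shows "\<exists>g\<in>cc_isos A Y X. (\<forall>y\<in>car Y. f (g y) = y) \<and> (\<forall>x\<in>car X. g (f x) = x)"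
proof -
  have f: "f \<in> hom X Y" "inj_on f (car X)" "f ` car X = car Y"
    using assms(1) by (auto simp: cc_isos_def bij_betw_def)
  obtain g where g: "g \<in> hom Y X" "\<forall>y\<in>car Y. f (g y) = y"
    using hom_lift[OF f(1,2) hom_id[of Y]] assms f(3) by auto
  have "g (f x) = x" if "x \<in> car X" for x
    using that g homD(1)[OF f(1)] homD(1)[OF g(1)] by (auto intro: inj_onD[OF f(2)])
  moreover from this have "bij_betw g (car Y) (car X)"
    using g homD(1)[OF f(1)] homD(1)[OF g(1)] by (intro bij_betw_byWitness[of _ f]) auto
  ultimately show ?thesis using g by (auto simp: cc_isos_def)
qed

lemma cc_iso_refl: "is_cc X \<Longrightarrow> cc_iso A X X"
  using hom_id[of X] by (auto simp: cc_iso_def cc_isos_def bij_betw_def inj_on_def)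

lemma cc_iso_sym: "cc_iso A X Y \<Longrightarrow> is_cc X \<Longrightarrow> is_cc Y \<Longrightarrow> cc_iso A Y X"
  unfolding cc_iso_def using isos_inverse by blast

lemma isos_compose:
  "f \<in> cc_isos A X Y \<Longrightarrow> g \<in> cc_isos A Y Z \<Longrightarrow> is_cc X \<Longrightarrow> compose (car X) g f \<in> cc_isos A X Z"
  by (auto simp: cc_isos_def hom_compose bij_betw_compose)

lemma cc_iso_trans: "cc_iso A X Y \<Longrightarrow> cc_iso A Y Z \<Longrightarrow> is_cc X \<Longrightarrow> cc_iso A X Z"
  unfolding cc_iso_def using isos_compose by blast

lemma d_zero [simp]: "is_cc X \<Longrightarrow> snd X \<zero>\<^bsub>fst X\<^esub> = \<zero>\<^bsub>fst X\<^esub>"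
  by (rule hom_zero[OF d_hom])

subsection \<open>Short exact sequences\<close>

definition short_exact where
  "short_exact \<phi> \<psi> Y Z X \<longleftrightarrow> \<phi> \<in> hom Y Z \<and> \<psi> \<in> hom Z X \<and> inj_on \<phi> (car Y) \<and>
     \<phi> ` car Y = {z \<in> car Z. \<psi> z = \<zero>\<^bsub>fst X\<^esub>} \<and> \<psi> ` car Z = car X"

lemma hadd_apply [simp]: "x \<in> car X \<Longrightarrow> hadd X Y f g x = f x \<oplus>\<^bsub>fst Y\<^esub> g x"
  by (simp add: hadd_def)

lemma hdiff_apply [simp]: "x \<in> car X \<Longrightarrow> hdiff X Y f g x = f x \<ominus>\<^bsub>fst Y\<^esub> g x"
  by (simp add: hdiff_def)

lemma card_fibres:
  assumes "finite S" "\<And>a. a \<in> S \<Longrightarrow> card {x \<in> S. f x = f a} = k"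
  shows "card S = k * card (f ` S)"
proof -
  have "card S = (\<Sum>y\<in>f ` S. \<Sum>x\<in>{x \<in> S. f x = y}. 1)"
    using sum.image_gen[OF assms(1), of "\<lambda>_. 1::nat" f] by simp
  also have "\<dots> = (\<Sum>y\<in>f ` S. k)"
    using assms(2) by (intro sum.cong) auto
  finally show ?thesis by simp
qed

lemma compose_cong_iff:
  "compose S g f = compose S g' f' \<longleftrightarrow> (\<forall>x\<in>S. g (f x) = g' (f' x))"
  by (auto simp: compose_def fun_eq_iff)

text \<open>Two morphisms to Z with the same composite to X differ by a morphism into the kernel of
  \<open>\<psi>\<close>, that is, by a unique morphism to Y. So every nonempty fibre of composition
  with \<open>\<psi>\<close> is a coset of Hom(T, Y).\<close>

lemma card_hom_exact_right:
  assumes ex: "short_exact \<phi> \<psi> Y Z X"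
    and cc: "fin_cc T" "fin_cc X" "fin_cc Y" "fin_cc Z"
  shows "card (hom T Z) = card (hom T Y) * card (compose (car T) \<psi> ` hom T Z)"
proof (rule card_fibres)
  have \<phi>: "\<phi> \<in> hom Y Z" "inj_on \<phi> (car Y)" "\<phi> ` car Y = {z \<in> car Z. \<psi> z = \<zero>\<^bsub>fst X\<^esub>}"
    and \<psi>: "\<psi> \<in> hom Z X"
    using ex by (auto simp: short_exact_def)
  have \<psi>\<phi>: "\<psi> (\<phi> y) = \<zero>\<^bsub>fst X\<^esub>" if "y \<in> car Y" for y using \<phi>(3) that by auto
  note [simp] = homD[OF \<phi>(1)] homD[OF \<psi>] fin_ccD(1)[OF cc(1)] fin_ccD(1)[OF cc(2)]
    fin_ccD(1)[OF cc(3)] fin_ccD(1)[OF cc(4)]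
  show "finite (hom T Z)" using cc by simp
  fix f assume f: "f \<in> hom T Z"
  note [simp] = homD(1)[OF f]
  let ?F = "\<lambda>g. hadd T Z f (compose (car T) \<phi> g)"
  have "bij_betw ?F (hom T Y) {h \<in> hom T Z. compose (car T) \<psi> h = compose (car T) \<psi> f}"
    unfolding bij_betw_def
  proof (intro conjI inj_onI equalityI subsetI)
    fix g g' assume g: "g \<in> hom T Y" "g' \<in> hom T Y" and eq: "?F g = ?F g'"
    note [simp] = homD(1)[OF g(1)] homD(1)[OF g(2)]
    show "g = g'"
    proof (rule hom_eqI[OF g])
      fix t assume [simp]: "t \<in> car T"
      have "\<phi> (g t) = \<phi> (g' t)"
        using fun_cong[OF eq, of t] by (simp add: compose_eq cc_add_cancel)
      then show "g t = g' t" using \<phi>(2) by (simp add: inj_on_eq_iff)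
    qed
  next
    fix h assume "h \<in> ?F ` hom T Y"
    then obtain g where g: "g \<in> hom T Y" "h = ?F g" by blast
    note [simp] = homD(1)[OF g(1)]
    have "h \<in> hom T Z" unfolding g(2) using g f by (intro hom_hadd hom_compose[OF _ \<phi>(1)]) auto
    then show "h \<in> {h \<in> hom T Z. compose (car T) \<psi> h = compose (car T) \<psi> f}"
      by (simp add: compose_cong_iff g(2) compose_eq \<psi>\<phi>)
  next
    fix h assume "h \<in> {h \<in> hom T Z. compose (car T) \<psi> h = compose (car T) \<psi> f}"
    then have h: "h \<in> hom T Z" and eq: "\<And>t. t \<in> car T \<Longrightarrow> \<psi> (h t) = \<psi> (f t)"
      by (auto simp: compose_cong_iff)
    note [simp] = homD(1)[OF h]
    have d: "hdiff T Z h f \<in> hom T Z" using h f by (intro hom_hdiff) auto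
    have "hdiff T Z h f ` car T \<subseteq> \<phi> ` car Y"
      unfolding \<phi>(3) by (auto simp: hom_diff[OF \<psi>] eq)
    from hom_lift[OF \<phi>(1,2) d this] obtain g where g: "g \<in> hom T Y" "\<forall>t\<in>car T. \<phi> (g t) = hdiff T Z h f t"
      by auto
    note [simp] = homD(1)[OF g(1)]
    have "?F g \<in> hom T Z" using g f by (intro hom_hadd hom_compose[OF _ \<phi>(1)]) auto
    then have "h = ?F g" using h by (rule hom_eqI[symmetric]) (simp add: compose_eq g(2))
    then show "h \<in> ?F ` hom T Y" using g(1) by blast
  qed
  then show "card {h \<in> hom T Z. compose (car T) \<psi> h = compose (car T) \<psi> f} = card (hom T Y)"
    by (simp add: bij_betw_same_card)
qed

text \<open>The dual count: two morphisms from Z that agree on Y differ by one that factors uniquely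
  through X.\<close>

lemma card_hom_exact_left:
  assumes ex: "short_exact \<phi> \<psi> Y Z X"
    and cc: "fin_cc T" "fin_cc X" "fin_cc Y" "fin_cc Z"
  shows "card (hom Z T) = card (hom X T) * card ((\<lambda>f. compose (car Y) f \<phi>) ` hom Z T)"
proof (rule card_fibres)
  have \<phi>: "\<phi> \<in> hom Y Z" "\<phi> ` car Y = {z \<in> car Z. \<psi> z = \<zero>\<^bsub>fst X\<^esub>}"
    and \<psi>: "\<psi> \<in> hom Z X" "\<psi> ` car Z = car X"
    using ex by (auto simp: short_exact_def)
  have \<psi>\<phi>: "\<psi> (\<phi> y) = \<zero>\<^bsub>fst X\<^esub>" if "y \<in> car Y" for y using \<phi>(2) that by auto
  note [simp] = homD[OF \<phi>(1)] homD[OF \<psi>(1)] fin_ccD(1)[OF cc(1)] fin_ccD(1)[OF cc(2)]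
    fin_ccD(1)[OF cc(3)] fin_ccD(1)[OF cc(4)]
  show "finite (hom Z T)" using cc by simp
  fix f assume f: "f \<in> hom Z T"
  note [simp] = homD(1)[OF f]
  let ?F = "\<lambda>g. hadd Z T f (compose (car Z) g \<psi>)"
  have "bij_betw ?F (hom X T) {h \<in> hom Z T. compose (car Y) h \<phi> = compose (car Y) f \<phi>}"
    unfolding bij_betw_def
  proof (intro conjI inj_onI equalityI subsetI)
    fix g g' assume g: "g \<in> hom X T" "g' \<in> hom X T" and eq: "?F g = ?F g'"
    note [simp] = homD(1)[OF g(1)] homD(1)[OF g(2)]
    show "g = g'"
    proof (rule hom_eqI[OF g])
      fix x assume "x \<in> car X"
      then obtain z where [simp]: "z \<in> car Z" and x: "x = \<psi> z" using \<psi>(2) by blast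
      show "g x = g' x"
        using fun_cong[OF eq, of z] by (simp add: compose_eq cc_add_cancel x)
    qed
  next
    fix h assume "h \<in> ?F ` hom X T"
    then obtain g where g: "g \<in> hom X T" "h = ?F g" by blast
    note [simp] = homD(1)[OF g(1)] hom_zero[OF g(1)]
    have "h \<in> hom Z T" unfolding g(2) using g f by (intro hom_hadd hom_compose[OF \<psi>(1)]) auto
    then show "h \<in> {h \<in> hom Z T. compose (car Y) h \<phi> = compose (car Y) f \<phi>}"
      by (simp add: compose_cong_iff g(2) compose_eq \<psi>\<phi>)
  next
    fix h assume "h \<in> {h \<in> hom Z T. compose (car Y) h \<phi> = compose (car Y) f \<phi>}"
    then have h: "h \<in> hom Z T" and eq: "\<And>y. y \<in> car Y \<Longrightarrow> h (\<phi> y) = f (\<phi> y)"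
      by (auto simp: compose_cong_iff)
    note [simp] = homD(1)[OF h]
    have d: "hdiff Z T h f \<in> hom Z T" using h f by (intro hom_hdiff) auto
    have "hdiff Z T h f z = \<zero>\<^bsub>fst T\<^esub>" if "z \<in> car Z" "\<psi> z = \<zero>\<^bsub>fst X\<^esub>" for z
    proof -
      have "z \<in> \<phi> ` car Y" using that \<phi>(2) by simp
      then show ?thesis by (auto simp: eq)
    qed
    from hom_factor[OF \<psi> d this] obtain g where g: "g \<in> hom X T" "\<forall>z\<in>car Z. g (\<psi> z) = hdiff Z T h f z"
      by auto
    note [simp] = homD(1)[OF g(1)]
    have "?F g \<in> hom Z T" using g f by (intro hom_hadd hom_compose[OF \<psi>(1)]) auto
    then have "h = ?F g" using h by (rule hom_eqI[symmetric]) (simp add: compose_eq g(2))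
    then show "h \<in> ?F ` hom X T" using g(1) by blast
  qed
  then show "card {h \<in> hom Z T. compose (car Y) h \<phi> = compose (car Y) f \<phi>} = card (hom X T)"
    by (simp add: bij_betw_same_card)
qed

lemma card_hom_pos: "fin_cc X \<Longrightarrow> fin_cc Y \<Longrightarrow> 0 < card (hom X Y)"
  using hom_zeroI[of X Y] by (auto simp: card_gt_0_iff)

text \<open>The bound replaces the set of liftable morphisms by all of Hom(T, X); equality therefore
  means that every morphism from T to X lifts to Z.\<close>

lemma card_hom_exact_right_le:
  assumes ex: "short_exact \<phi> \<psi> Y Z X" and cc: "fin_cc T" "fin_cc X" "fin_cc Y" "fin_cc Z"
  shows "card (hom T Z) \<le> card (hom T Y) * card (hom T X)"
    and "card (hom T Z) = card (hom T Y) * card (hom T X) \<Longrightarrow> compose (car T) \<psi> ` hom T Z = hom T X"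
proof -
  have sub: "compose (car T) \<psi> ` hom T Z \<subseteq> hom T X"
    using ex cc by (auto simp: short_exact_def intro: hom_compose)
  have fin: "finite (hom T X)" using cc by simp
  show "card (hom T Z) \<le> card (hom T Y) * card (hom T X)"
    using card_hom_exact_right[OF assms] card_mono[OF fin sub] by simp
  assume "card (hom T Z) = card (hom T Y) * card (hom T X)"
  then have "card (compose (car T) \<psi> ` hom T Z) = card (hom T X)"
    using card_hom_exact_right[OF assms] card_hom_pos[OF cc(1,3)] by simp
  then show "compose (car T) \<psi> ` hom T Z = hom T X"
    using sub fin by (simp add: card_subset_eq)
qed

lemma card_hom_exact_left_le:
  assumes ex: "short_exact \<phi> \<psi> Y Z X" and cc: "fin_cc T" "fin_cc X" "fin_cc Y" "fin_cc Z"
  shows "card (hom Z T) \<le> card (hom X T) * card (hom Y T)"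
proof -
  have sub: "(\<lambda>f. compose (car Y) f \<phi>) ` hom Z T \<subseteq> hom Y T"
    using ex cc by (auto simp: short_exact_def intro: hom_compose)
  have fin: "finite (hom Y T)" using cc by simp
  show ?thesis
    using card_hom_exact_left[OF assms] card_mono[OF fin sub] by simp
qed

subsection \<open>Direct sums\<close>

lemma cc_sum_simps [simp]:
  "car (cc_sum X Y) = car X \<times> car Y"
  "\<zero>\<^bsub>fst (cc_sum X Y)\<^esub> = (\<zero>\<^bsub>fst X\<^esub>, \<zero>\<^bsub>fst Y\<^esub>)"
  "p \<oplus>\<^bsub>fst (cc_sum X Y)\<^esub> q = (fst p \<oplus>\<^bsub>fst X\<^esub> fst q, snd p \<oplus>\<^bsub>fst Y\<^esub> snd q)"
  "a \<odot>\<^bsub>fst (cc_sum X Y)\<^esub> p = (a \<odot>\<^bsub>fst X\<^esub> fst p, a \<odot>\<^bsub>fst Y\<^esub> snd p)"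
  "p \<in> car X \<times> car Y \<Longrightarrow> snd (cc_sum X Y) p = (snd X (fst p), snd Y (snd p))"
  by (auto simp: cc_sum_def mod_sum_def split: prod.splits)

lemma is_ccI:
  assumes "abelian_group (fst X)"
    and "\<And>a x. a \<in> carrier A \<Longrightarrow> x \<in> car X \<Longrightarrow> a \<odot>\<^bsub>fst X\<^esub> x \<in> car X"
    and "\<And>a b x. a \<in> carrier A \<Longrightarrow> b \<in> carrier A \<Longrightarrow> x \<in> car X \<Longrightarrow>
      (a \<oplus>\<^bsub>A\<^esub> b) \<odot>\<^bsub>fst X\<^esub> x = a \<odot>\<^bsub>fst X\<^esub> x \<oplus>\<^bsub>fst X\<^esub> b \<odot>\<^bsub>fst X\<^esub> x"
    and "\<And>a x y. a \<in> carrier A \<Longrightarrow> x \<in> car X \<Longrightarrow> y \<in> car X \<Longrightarrow>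
      a \<odot>\<^bsub>fst X\<^esub> (x \<oplus>\<^bsub>fst X\<^esub> y) = a \<odot>\<^bsub>fst X\<^esub> x \<oplus>\<^bsub>fst X\<^esub> a \<odot>\<^bsub>fst X\<^esub> y"
    and "\<And>a b x. a \<in> carrier A \<Longrightarrow> b \<in> carrier A \<Longrightarrow> x \<in> car X \<Longrightarrow>
      (a \<otimes>\<^bsub>A\<^esub> b) \<odot>\<^bsub>fst X\<^esub> x = a \<odot>\<^bsub>fst X\<^esub> (b \<odot>\<^bsub>fst X\<^esub> x)"
    and "\<And>x. x \<in> car X \<Longrightarrow> \<one>\<^bsub>A\<^esub> \<odot>\<^bsub>fst X\<^esub> x = x"
    and "snd X \<in> car X \<rightarrow>\<^sub>E car X"
    and "\<And>x y. x \<in> car X \<Longrightarrow> y \<in> car X \<Longrightarrow>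
      snd X (x \<oplus>\<^bsub>fst X\<^esub> y) = snd X x \<oplus>\<^bsub>fst X\<^esub> snd X y"
    and "\<And>a x. a \<in> carrier A \<Longrightarrow> x \<in> car X \<Longrightarrow> snd X (a \<odot>\<^bsub>fst X\<^esub> x) = a \<odot>\<^bsub>fst X\<^esub> snd X x"
    and "\<And>x. x \<in> car X \<Longrightarrow> snd X (snd X x) = \<zero>\<^bsub>fst X\<^esub>"
  shows "is_cc X"
  unfolding is_cc_def mod_hom_def left_module_def left_module_axioms_def
  using assms ring_A by simp

lemma is_cc_sum [simp]:
  assumes X: "is_cc X" and Y: "is_cc Y"
  shows "is_cc (cc_sum X Y)"
proof (rule is_ccI)
  show "abelian_group (fst (cc_sum X Y))"
  proof (rule abelian_groupI)
    fix p assume "p \<in> car (cc_sum X Y)"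
    then show "\<exists>q\<in>car (cc_sum X Y). q \<oplus>\<^bsub>fst (cc_sum X Y)\<^esub> p = \<zero>\<^bsub>fst (cc_sum X Y)\<^esub>"
      using assms by (intro bexI[of _ "(\<ominus>\<^bsub>fst X\<^esub> fst p, \<ominus>\<^bsub>fst Y\<^esub> snd p)"]) auto
  qed (use assms in \<open>auto simp: cc_add_ac[OF X] cc_add_ac[OF Y]\<close>)
  show "snd (cc_sum X Y) \<in> car (cc_sum X Y) \<rightarrow>\<^sub>E car (cc_sum X Y)"
    using assms by (auto simp: cc_sum_def mod_sum_def PiE_def)
qed (use assms in auto)

lemma fin_cc_sum [simp]: "fin_cc X \<Longrightarrow> fin_cc Y \<Longrightarrow> fin_cc (cc_sum X Y)"
  unfolding fin_cc_def by simp

definition hpair :: "('a, 'l) cyclic_complex \<Rightarrow> ('l \<Rightarrow> 'm) \<Rightarrow> ('l \<Rightarrow> 'n) \<Rightarrow> 'l \<Rightarrow> 'm \<times> 'n" where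
  "hpair T f g = (\<lambda>t\<in>car T. (f t, g t))"

lemma hom_hpair:
  assumes "f \<in> hom T X" "g \<in> hom T Y" "is_cc T"
  shows "hpair T f g \<in> hom T (cc_sum X Y)"
  unfolding hpair_def using assms
  by (intro hom_restrictI) (simp_all add: homD[OF assms(1)] homD[OF assms(2)])

lemma hom_sum_fst:
  assumes "is_cc X" "is_cc Y"
  shows "(\<lambda>p\<in>car X \<times> car Y. fst p) \<in> hom (cc_sum X Y) X"
  using assms by (subst cc_sum_simps(1)[symmetric], intro hom_restrictI) auto

lemma hom_sum_snd:
  assumes "is_cc X" "is_cc Y"
  shows "(\<lambda>p\<in>car X \<times> car Y. snd p) \<in> hom (cc_sum X Y) Y"
  using assms by (subst cc_sum_simps(1)[symmetric], intro hom_restrictI) auto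

lemma bij_hpair:
  assumes cc: "is_cc T" "is_cc X" "is_cc Y"
  shows "bij_betw (\<lambda>(f, g). hpair T f g) (hom T X \<times> hom T Y) (hom T (cc_sum X Y))"
  unfolding bij_betw_def
proof (intro conjI inj_onI equalityI subsetI)
  fix p q assume p: "p \<in> hom T X \<times> hom T Y" and q: "q \<in> hom T X \<times> hom T Y"
    and eq: "(case p of (f, g) \<Rightarrow> hpair T f g) = (case q of (f, g) \<Rightarrow> hpair T f g)"
  have "fst p t = fst q t \<and> snd p t = snd q t" if "t \<in> car T" for t
    using fun_cong[OF eq, of t] that by (simp add: hpair_def split: prod.splits)
  then have "fst p = fst q" "snd p = snd q"
    using p q hom_eqI[of "fst p" T X "fst q"] hom_eqI[of "snd p" T Y "snd q"]
    by (simp_all add: mem_Times_iff)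
  then show "p = q" by (rule prod_eqI)
next
  fix h assume "h \<in> (\<lambda>(f, g). hpair T f g) ` (hom T X \<times> hom T Y)"
  then show "h \<in> hom T (cc_sum X Y)" using cc by (auto intro: hom_hpair)
next
  fix h assume h: "h \<in> hom T (cc_sum X Y)"
  let ?f = "compose (car T) (\<lambda>p\<in>car X \<times> car Y. fst p) h"
  let ?g = "compose (car T) (\<lambda>p\<in>car X \<times> car Y. snd p) h"
  have f: "?f \<in> hom T X" "?g \<in> hom T Y"
    using h cc by (auto intro!: hom_compose hom_sum_fst hom_sum_snd)
  have "hpair T ?f ?g \<in> hom T (cc_sum X Y)" using f cc by (intro hom_hpair)
  then have "h = hpair T ?f ?g"
    using h by (rule hom_eqI[symmetric]) (use homD(1)[OF h] in \<open>auto simp: hpair_def compose_eq\<close>)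
  then show "h \<in> (\<lambda>(f, g). hpair T f g) ` (hom T X \<times> hom T Y)"
    using f by (intro image_eqI[of _ _ "(?f, ?g)"]) auto
qed

lemma card_hom_sum_right:
  assumes "is_cc T" "is_cc X" "is_cc Y"
  shows "card (hom T (cc_sum X Y)) = card (hom T X) * card (hom T Y)"
  using bij_betw_same_card[OF bij_hpair[OF assms]] by (simp add: card_cartesian_product)

lemma short_exact_sum:
  assumes "is_cc X" "is_cc Y"
  shows "short_exact (\<lambda>y\<in>car Y. (\<zero>\<^bsub>fst X\<^esub>, y)) (\<lambda>p\<in>car X \<times> car Y. fst p) Y (cc_sum X Y) X"
  unfolding short_exact_def
proof (intro conjI)
  show "(\<lambda>y\<in>car Y. (\<zero>\<^bsub>fst X\<^esub>, y)) \<in> hom Y (cc_sum X Y)"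
    using assms by (intro hom_restrictI) auto
  have "car Y \<noteq> {}" using cc_ops(1)[OF assms(2)] by blast
  then show "(\<lambda>p\<in>car X \<times> car Y. fst p) ` car (cc_sum X Y) = car X"
    by auto
qed (use assms hom_sum_fst[of X Y] in \<open>auto simp: inj_on_def\<close>)

text \<open>For the split sequence the restriction to Y is onto: a morphism from Y extends to the
  sum through the second projection.\<close>

lemma card_hom_sum_left:
  assumes cc: "fin_cc T" "fin_cc X" "fin_cc Y"
  shows "card (hom (cc_sum X Y) T) = card (hom X T) * card (hom Y T)"
proof -
  let ?\<phi> = "\<lambda>y\<in>car Y. (\<zero>\<^bsub>fst X\<^esub>, y)"
  note ex = short_exact_sum[OF fin_ccD(1)[OF cc(2)] fin_ccD(1)[OF cc(3)]]
  have \<phi>: "?\<phi> \<in> hom Y (cc_sum X Y)" using ex by (simp add: short_exact_def)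
  have "(\<lambda>f. compose (car Y) f ?\<phi>) ` hom (cc_sum X Y) T = hom Y T"
  proof (intro equalityI subsetI)
    fix g assume g: "g \<in> hom Y T"
    let ?f = "compose (car (cc_sum X Y)) g (\<lambda>p\<in>car X \<times> car Y. snd p)"
    have f: "?f \<in> hom (cc_sum X Y) T"
      using cc g by (intro hom_compose[OF hom_sum_snd]) auto
    have "compose (car Y) ?f ?\<phi> \<in> hom Y T"
      using f \<phi> cc by (intro hom_compose) auto
    then have "g = compose (car Y) ?f ?\<phi>"
      using g by (rule hom_eqI[symmetric]) (use cc in \<open>simp add: compose_eq\<close>)
    then show "g \<in> (\<lambda>f. compose (car Y) f ?\<phi>) ` hom (cc_sum X Y) T" using f by blast
  qed (use \<phi> cc in \<open>auto intro: hom_compose\<close>)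
  then show ?thesis
    using card_hom_exact_left[OF ex cc fin_cc_sum[OF cc(2,3)]] by simp
qed

text \<open>Every z is the sum of \<open>\<sigma> (\<psi> z)\<close> and a remainder killed by
  \<open>\<psi>\<close>, which comes from Y; applying \<open>\<psi>\<close> to such a sum recovers
  the component in X.\<close>

lemma split_exact_iso:
  assumes ex: "short_exact \<phi> \<psi> Y Z X" and \<sigma>: "\<sigma> \<in> hom X Z" "\<And>x. x \<in> car X \<Longrightarrow> \<psi> (\<sigma> x) = x"
    and cc: "is_cc X" "is_cc Y" "is_cc Z"
  shows "(\<lambda>p\<in>car X \<times> car Y. \<sigma> (fst p) \<oplus>\<^bsub>fst Z\<^esub> \<phi> (snd p)) \<in> cc_isos A (cc_sum X Y) Z"
proof -
  have \<phi>: "\<phi> \<in> hom Y Z" "inj_on \<phi> (car Y)" "\<phi> ` car Y = {z \<in> car Z. \<psi> z = \<zero>\<^bsub>fst X\<^esub>}"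
    and \<psi>: "\<psi> \<in> hom Z X"
    using ex by (auto simp: short_exact_def)
  have \<psi>\<phi>: "\<psi> (\<phi> y) = \<zero>\<^bsub>fst X\<^esub>" if "y \<in> car Y" for y using \<phi>(3) that by auto
  note [simp] = homD[OF \<phi>(1)] homD[OF \<psi>] homD[OF \<sigma>(1)] cc \<sigma>(2) \<psi>\<phi>
  let ?s = "\<lambda>p. \<sigma> (fst p) \<oplus>\<^bsub>fst Z\<^esub> \<phi> (snd p)"
  have "restrict ?s (car (cc_sum X Y)) \<in> hom (cc_sum X Y) Z"
    by (intro hom_restrictI) (auto simp: cc_add_ac[OF cc(3)])
  moreover have "bij_betw (restrict ?s (car X \<times> car Y)) (car X \<times> car Y) (car Z)"
    unfolding bij_betw_def
  proof (intro conjI inj_onI equalityI subsetI)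
    fix p q assume pq: "p \<in> car X \<times> car Y" "q \<in> car X \<times> car Y"
      and eq: "restrict ?s (car X \<times> car Y) p = restrict ?s (car X \<times> car Y) q"
    then have eq': "?s p = ?s q" by simp
    have "\<psi> (?s p) = fst p" "\<psi> (?s q) = fst q" using pq by auto
    then have 1: "fst p = fst q" using eq' by simp
    then have "\<phi> (snd p) = \<phi> (snd q)" using eq' pq by (auto simp: cc_add_cancel)
    then have "snd p = snd q" using pq \<phi>(2) by (auto simp: inj_on_eq_iff)
    with 1 show "p = q" by (rule prod_eqI)
  next
    fix z assume z: "z \<in> restrict ?s (car X \<times> car Y) ` (car X \<times> car Y)"
    then show "z \<in> car Z" by auto
  next
    fix z assume z: "z \<in> car Z"
    have "z \<ominus>\<^bsub>fst Z\<^esub> \<sigma> (\<psi> z) \<in> \<phi> ` car Y"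
      unfolding \<phi>(3) using z by (simp add: hom_diff[OF \<psi>])
    then obtain y where y: "y \<in> car Y" "\<phi> y = z \<ominus>\<^bsub>fst Z\<^esub> \<sigma> (\<psi> z)" by auto
    then have "z = ?s (\<psi> z, y)" using z by simp
    then show "z \<in> restrict ?s (car X \<times> car Y) ` (car X \<times> car Y)"
      using y z by (intro image_eqI[of _ _ "(\<psi> z, y)"]) auto
  qed
  ultimately show ?thesis by (simp add: cc_isos_def)
qed

text \<open>The map need not be extensional here; it is restricted once and for all.\<close>

lemma isoI:
  assumes "is_cc X"
    and "\<And>x y. x \<in> car X \<Longrightarrow> y \<in> car X \<Longrightarrow> f (x \<oplus>\<^bsub>fst X\<^esub> y) = f x \<oplus>\<^bsub>fst Y\<^esub> f y"
    and "\<And>a x. a \<in> carrier A \<Longrightarrow> x \<in> car X \<Longrightarrow> f (a \<odot>\<^bsub>fst X\<^esub> x) = a \<odot>\<^bsub>fst Y\<^esub> f x"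
    and "\<And>x. x \<in> car X \<Longrightarrow> snd Y (f x) = f (snd X x)"
    and "bij_betw f (car X) (car Y)"
  shows "cc_iso A X Y"
proof -
  have "restrict f (car X) \<in> cc_isos A X Y"
    unfolding cc_isos_def using assms bij_betwE[OF assms(5)]
    by (simp add: hom_restrictI cong: bij_betw_cong)
  then show ?thesis by (auto simp: cc_iso_def)
qed

lemma cc_sum_cong:
  assumes "cc_iso A X X'" "cc_iso A Y Y'" "is_cc X" "is_cc Y"
  shows "cc_iso A (cc_sum X Y) (cc_sum X' Y')"
proof -
  obtain f g where f: "f \<in> hom X X'" "bij_betw f (car X) (car X')"
    and g: "g \<in> hom Y Y'" "bij_betw g (car Y) (car Y')"
    using assms by (auto simp: cc_iso_def cc_isos_def)
  show ?thesis
  proof (rule isoI[where f = "map_prod f g"])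
    show "bij_betw (map_prod f g) (car (cc_sum X Y)) (car (cc_sum X' Y'))"
      using bij_betw_map_prod[OF f(2) g(2)] by simp
  qed (use assms in \<open>auto simp: homD[OF f(1)] homD[OF g(1)]\<close>)
qed

lemma cc_sum_comm: "is_cc X \<Longrightarrow> is_cc Y \<Longrightarrow> cc_iso A (cc_sum X Y) (cc_sum Y X)"
  by (rule isoI[where f = prod.swap])
    (auto intro!: bij_betw_byWitness[where f' = prod.swap])

lemma cc_sum_assoc:
  assumes "is_cc X" "is_cc Y" "is_cc Z"
  shows "cc_iso A (cc_sum (cc_sum X Y) Z) (cc_sum X (cc_sum Y Z))"
proof (rule isoI[where f = "\<lambda>p. (fst (fst p), (snd (fst p), snd p))"])
  show "bij_betw (\<lambda>p. (fst (fst p), (snd (fst p), snd p)))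
      (car (cc_sum (cc_sum X Y) Z)) (car (cc_sum X (cc_sum Y Z)))"
    by (rule bij_betw_byWitness[where f' = "\<lambda>p. ((fst p, fst (snd p)), snd (snd p))"]) auto
qed (use assms in auto)

lemma cc_sum_zero:
  assumes "is_cc X" "is_cc Z" "cc_is_zero Z"
  shows "cc_iso A (cc_sum Z X) X"
proof (rule isoI[where f = snd])
  show "bij_betw snd (car (cc_sum Z X)) (car X)"
    using assms(3) by (intro bij_betw_byWitness[where f' = "\<lambda>x. (\<zero>\<^bsub>fst Z\<^esub>, x)"])
      (auto simp: cc_is_zero_def)
qed (use assms in auto)

subsection \<open>Idempotents\<close>

text \<open>The image is realised as a subset of the same type, so a summand of an object on the
  naturals is again one on the naturals.\<close>

definition cc_im :: "('m \<Rightarrow> 'm) \<Rightarrow> ('a, 'm) cyclic_complex \<Rightarrow> ('a, 'm) cyclic_complex" where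
  "cc_im e X = ((fst X)\<lparr>carrier := e ` car X\<rparr>, restrict (snd X) (e ` car X))"

lemma cc_im_simps [simp]:
  "car (cc_im e X) = e ` car X"
  "\<zero>\<^bsub>fst (cc_im e X)\<^esub> = \<zero>\<^bsub>fst X\<^esub>"
  "x \<oplus>\<^bsub>fst (cc_im e X)\<^esub> y = x \<oplus>\<^bsub>fst X\<^esub> y"
  "a \<odot>\<^bsub>fst (cc_im e X)\<^esub> x = a \<odot>\<^bsub>fst X\<^esub> x"
  "x \<in> e ` car X \<Longrightarrow> snd (cc_im e X) x = snd X x"
  by (auto simp: cc_im_def)

definition idempotent :: "('a, 'm) cyclic_complex \<Rightarrow> ('m \<Rightarrow> 'm) \<Rightarrow> bool" where
  "idempotent X e \<longleftrightarrow> e \<in> hom X X \<and> (\<forall>x\<in>car X. e (e x) = e x)"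

lemma idempotent_image:
  assumes "idempotent X e"
  shows "x \<in> e ` car X \<longleftrightarrow> x \<in> car X \<and> e x = x"
proof -
  have "e \<in> hom X X" using assms by (simp add: idempotent_def)
  from homD(1)[OF this] show ?thesis
    using assms by (auto simp: idempotent_def intro: image_eqI[of _ e x])
qed

lemma is_cc_im [simp]:
  assumes X: "is_cc X" and e: "idempotent X e"
  shows "is_cc (cc_im e X)"
proof -
  have h: "e \<in> hom X X" using e by (simp add: idempotent_def)
  note [simp] = X idempotent_image[OF e] homD[OF h] hom_diff[OF h X X] hom_zero[OF h X X]
  show ?thesis
  proof (rule is_ccI)
    show "abelian_group (fst (cc_im e X))"
    proof (rule abelian_groupI)
      fix x assume "x \<in> car (cc_im e X)"
      then show "\<exists>y\<in>car (cc_im e X). y \<oplus>\<^bsub>fst (cc_im e X)\<^esub> x = \<zero>\<^bsub>fst (cc_im e X)\<^esub>"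
        by (intro bexI[of _ "\<zero>\<^bsub>fst X\<^esub> \<ominus>\<^bsub>fst X\<^esub> x"]) auto
    qed (auto simp: cc_add_ac[OF X])
    show "snd (cc_im e X) \<in> car (cc_im e X) \<rightarrow>\<^sub>E car (cc_im e X)"
      by (auto simp: cc_im_def)
  qed auto
qed

abbreviation idh :: "('a, 'm) cyclic_complex \<Rightarrow> 'm \<Rightarrow> 'm" where
  "idh X \<equiv> \<lambda>x\<in>car X. x"

lemma diff_zero_right [simp]:
  assumes "is_cc X" "x \<in> car X"
  shows "x \<ominus>\<^bsub>fst X\<^esub> \<zero>\<^bsub>fst X\<^esub> = x"
  using cc_diff_unique[of X x "\<zero>\<^bsub>fst X\<^esub>" x] assms by simp

lemma idempotent_complement:
  assumes X: "is_cc X" and e: "idempotent X e"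
  shows "idempotent X (hdiff X X (idh X) e)"
proof -
  have h: "e \<in> hom X X" "\<And>x. x \<in> car X \<Longrightarrow> e (e x) = e x" using e by (auto simp: idempotent_def)
  show ?thesis
    unfolding idempotent_def using X h(2)
    by (intro conjI hom_hdiff hom_id h(1) ballI) (simp_all add: homD(1)[OF h(1)] hom_diff[OF h(1)])
qed

text \<open>The decomposition of x into e x and x - e x; its inverse adds the two
  components.\<close>

lemma idempotent_split:
  assumes X: "is_cc X" and e: "idempotent X e"
  shows "cc_iso A X (cc_sum (cc_im e X) (cc_im (hdiff X X (idh X) e) X))"
proof -
  let ?e' = "hdiff X X (idh X) e"
  have h: "e \<in> hom X X" "\<And>x. x \<in> car X \<Longrightarrow> e (e x) = e x" using e by (auto simp: idempotent_def)
  have e': "idempotent X ?e'" using assms by (rule idempotent_complement)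
  note [simp] = X homD[OF h(1)] hom_diff[OF h(1) X X] h(2)
  have ev: "e v = \<zero>\<^bsub>fst X\<^esub>" if "v \<in> ?e' ` car X" for v
    using that by auto
  show ?thesis
  proof (rule isoI[where f = "\<lambda>x. (e x, x \<ominus>\<^bsub>fst X\<^esub> e x)"])
    show "bij_betw (\<lambda>x. (e x, x \<ominus>\<^bsub>fst X\<^esub> e x)) (car X) (car (cc_sum (cc_im e X) (cc_im ?e' X)))"
    proof (rule bij_betw_byWitness[where f' = "\<lambda>p. fst p \<oplus>\<^bsub>fst X\<^esub> snd p"])
      show "(\<lambda>x. (e x, x \<ominus>\<^bsub>fst X\<^esub> e x)) ` car X \<subseteq> car (cc_sum (cc_im e X) (cc_im ?e' X))"
        by (auto intro: image_eqI[of _ ?e'])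
      have "(e (u \<oplus>\<^bsub>fst X\<^esub> v), (u \<oplus>\<^bsub>fst X\<^esub> v) \<ominus>\<^bsub>fst X\<^esub> e (u \<oplus>\<^bsub>fst X\<^esub> v)) = (u, v)"
        if uv: "u \<in> e ` car X" "v \<in> ?e' ` car X" for u v
      proof -
        have c: "u \<in> car X" "e u = u" "v \<in> car X"
          using uv idempotent_image[OF e] idempotent_image[OF e'] by blast+
        then have "e (u \<oplus>\<^bsub>fst X\<^esub> v) = u" using ev[OF uv(2)] by simp
        then show ?thesis using c by (simp add: cc_add_ac(1)[OF X, of u v])
      qed
      note inv = this
      show "\<forall>p\<in>car (cc_sum (cc_im e X) (cc_im ?e' X)).
          (e (fst p \<oplus>\<^bsub>fst X\<^esub> snd p),
           (fst p \<oplus>\<^bsub>fst X\<^esub> snd p) \<ominus>\<^bsub>fst X\<^esub> e (fst p \<oplus>\<^bsub>fst X\<^esub> snd p)) = p"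
      proof
        fix p assume "p \<in> car (cc_sum (cc_im e X) (cc_im ?e' X))"
        then have "fst p \<in> e ` car X" "snd p \<in> ?e' ` car X"
          by (simp_all only: cc_sum_simps(1) cc_im_simps(1) mem_Times_iff)
        from inv[OF this] show "(e (fst p \<oplus>\<^bsub>fst X\<^esub> snd p),
           (fst p \<oplus>\<^bsub>fst X\<^esub> snd p) \<ominus>\<^bsub>fst X\<^esub> e (fst p \<oplus>\<^bsub>fst X\<^esub> snd p)) = p"
          by (simp only: prod.collapse)
      qed
      show "(\<lambda>p. fst p \<oplus>\<^bsub>fst X\<^esub> snd p) ` car (cc_sum (cc_im e X) (cc_im ?e' X)) \<subseteq> car X"
        by auto
    qed auto
    have im: "x \<ominus>\<^bsub>fst X\<^esub> e x \<in> ?e' ` car X" if "x \<in> car X" for x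
      using that by (intro image_eqI[of _ ?e' x]) auto
    show "snd (cc_sum (cc_im e X) (cc_im ?e' X)) (e x, x \<ominus>\<^bsub>fst X\<^esub> e x) =
        (e (snd X x), snd X x \<ominus>\<^bsub>fst X\<^esub> e (snd X x))" if "x \<in> car X" for x
      using that im[OF that] by (simp add: cc_diff_ops)
  qed (auto simp: cc_diff_ops)
qed

subsection \<open>Modules and complexes with zero differential\<close>

text \<open>A finite set has only finitely many coefficient functions into a finite field.
  Conversely a finite module is spanned by the set of all its elements.\<close>

lemma fd_module_iff: "fd_module K A M \<longleftrightarrow> left_module A M \<and> finite (carrier M)"
proof (intro iffI conjI)
  assume fd: "fd_module K A M"
  then show "left_module A M" by (simp add: fd_module_def)
  then interpret M: left_module A M .
  obtain B where B: "finite B" "B \<subseteq> carrier M"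
    and span: "\<forall>x \<in> carrier M. \<exists>c \<in> B \<rightarrow> carrier K.
       x = (\<Oplus>\<^bsub>M\<^esub>b \<in> B. (c b \<odot>\<^bsub>A\<^esub> \<one>\<^bsub>A\<^esub>) \<odot>\<^bsub>M\<^esub> b)"
    using fd unfolding fd_module_def by blast
  let ?F = "\<lambda>c. \<Oplus>\<^bsub>M\<^esub>b \<in> B. (c b \<odot>\<^bsub>A\<^esub> \<one>\<^bsub>A\<^esub>) \<odot>\<^bsub>M\<^esub> b"
  have "carrier M \<subseteq> ?F ` (B \<rightarrow>\<^sub>E carrier K)"
  proof
    fix x assume "x \<in> carrier M"
    then obtain c where c: "c \<in> B \<rightarrow> carrier K" "x = ?F c" using span by blast
    have "?F (restrict c B) = ?F c"
      using c(1) B by (intro M.M.finsum_cong') (auto intro!: M.smult_closed scalar_closed)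
    then show "x \<in> ?F ` (B \<rightarrow>\<^sub>E carrier K)"
      using c by (intro image_eqI[of _ _ "restrict c B"]) auto
  qed
  then show "finite (carrier M)"
    by (rule finite_surj[rotated]) (use B finite_K in \<open>auto intro!: finite_PiE\<close>)
next
  assume asm: "left_module A M \<and> finite (carrier M)"
  then interpret M: left_module A M by simp
  have smult_0: "\<zero>\<^bsub>A\<^esub> \<odot>\<^bsub>M\<^esub> x = \<zero>\<^bsub>M\<^esub>" if "x \<in> carrier M" for x
  proof -
    have "\<zero>\<^bsub>A\<^esub> \<odot>\<^bsub>M\<^esub> x \<oplus>\<^bsub>M\<^esub> \<zero>\<^bsub>A\<^esub> \<odot>\<^bsub>M\<^esub> x = \<zero>\<^bsub>A\<^esub> \<odot>\<^bsub>M\<^esub> x"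
      using that M.smult_l_distr[of "\<zero>\<^bsub>A\<^esub>" "\<zero>\<^bsub>A\<^esub>" x] by simp
    then show ?thesis
      using that M.smult_closed[of "\<zero>\<^bsub>A\<^esub>" x] by (simp add: M.M.add.l_cancel_one')
  qed
  have "\<exists>c \<in> carrier M \<rightarrow> carrier K. x = (\<Oplus>\<^bsub>M\<^esub>b \<in> carrier M. (c b \<odot>\<^bsub>A\<^esub> \<one>\<^bsub>A\<^esub>) \<odot>\<^bsub>M\<^esub> b)"
    if x: "x \<in> carrier M" for x
  proof
    \<comment> \<open>With the whole carrier as spanning set, the coefficients of x may be taken as
      a Kronecker delta.\<close>
    let ?c = "\<lambda>b. if b = x then \<one>\<^bsub>K\<^esub> else \<zero>\<^bsub>K\<^esub>"
    show "?c \<in> carrier M \<rightarrow> carrier K" using one_K zero_K by auto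
    have "(\<Oplus>\<^bsub>M\<^esub>b \<in> carrier M. (?c b \<odot>\<^bsub>A\<^esub> \<one>\<^bsub>A\<^esub>) \<odot>\<^bsub>M\<^esub> b) =
        (\<Oplus>\<^bsub>M\<^esub>b \<in> carrier M. if x = b then b else \<zero>\<^bsub>M\<^esub>)"
      by (intro M.M.finsum_cong') (auto simp: scalar_one scalar_zero smult_0 M.smult_one)
    also have "\<dots> = x" using asm x by (intro M.M.finsum_singleton) auto
    finally show "x = (\<Oplus>\<^bsub>M\<^esub>b \<in> carrier M. (?c b \<odot>\<^bsub>A\<^esub> \<one>\<^bsub>A\<^esub>) \<odot>\<^bsub>M\<^esub> b)" by simp
  qed
  then show "fd_module K A M"
    unfolding fd_module_def using asm by blast
qed

text \<open>
  Module homomorphisms are the morphisms between complexes with zero differential, which makes the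
  facts about complexes available for modules.
\<close>

definition triv :: "('a, 'm) module \<Rightarrow> ('a, 'm) cyclic_complex" where
  "triv M = (M, \<lambda>x\<in>carrier M. \<zero>\<^bsub>M\<^esub>)"

lemma fst_triv [simp]: "fst (triv M) = M"
  by (simp add: triv_def)

lemma is_cc_triv [simp]:
  assumes "left_module A M"
  shows "is_cc (triv M)"
proof -
  interpret M: left_module A M by fact
  have "a \<odot>\<^bsub>M\<^esub> \<zero>\<^bsub>M\<^esub> = \<zero>\<^bsub>M\<^esub>" if "a \<in> carrier A" for a
    using that M.smult_r_distr[of a "\<zero>\<^bsub>M\<^esub>" "\<zero>\<^bsub>M\<^esub>"] M.smult_closed[of a "\<zero>\<^bsub>M\<^esub>"]
    by (simp add: M.M.add.l_cancel_one')
  then show ?thesis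
    using assms M.smult_closed by (auto simp: is_cc_def triv_def mod_hom_def)
qed

text \<open>Commuting with zero differentials amounts to sending zero to zero, which additivity
  implies by cancellation in N.\<close>

lemma hom_triv:
  assumes "left_module A M" "left_module A N"
  shows "hom (triv M) (triv N) = mod_hom A M N"
proof
  show "hom (triv M) (triv N) \<subseteq> mod_hom A M N" by (auto simp: cc_hom_def triv_def)
  show "mod_hom A M N \<subseteq> hom (triv M) (triv N)"
  proof
    fix f assume f: "f \<in> mod_hom A M N"
    interpret M: left_module A M by fact
    interpret N: left_module A N by fact
    have "f (\<zero>\<^bsub>M\<^esub> \<oplus>\<^bsub>M\<^esub> \<zero>\<^bsub>M\<^esub>) = f \<zero>\<^bsub>M\<^esub> \<oplus>\<^bsub>N\<^esub> f \<zero>\<^bsub>M\<^esub>" "f \<zero>\<^bsub>M\<^esub> \<in> carrier N"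
      using f M.M.zero_closed unfolding mod_hom_def by blast+
    then have "f \<zero>\<^bsub>M\<^esub> \<oplus>\<^bsub>N\<^esub> f \<zero>\<^bsub>M\<^esub> = f \<zero>\<^bsub>M\<^esub>" "f \<zero>\<^bsub>M\<^esub> \<in> carrier N" by simp_all
    then have "f \<zero>\<^bsub>M\<^esub> = \<zero>\<^bsub>N\<^esub>" by (simp add: N.M.add.l_cancel_one')
    then show "f \<in> hom (triv M) (triv N)"
      using f by (auto simp: cc_hom_def triv_def mod_hom_def)
  qed
qed

lemma cc_sum_triv: "cc_sum (triv M) (triv N) = triv (mod_sum M N)"
  by (auto simp: cc_sum_def triv_def mod_sum_def fun_eq_iff)

section \<open>Projective modules\<close>

lemma projectiveD:
  assumes "projective K A P"
  shows "left_module A P" "finite (carrier P)"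
  using assms by (auto simp: projective_def fd_module_iff)

lemma projective_lift:
  fixes M N :: "('a, nat) module"
  assumes P: "projective K A P" and M: "left_module A M" "finite (carrier M)"
    and N: "left_module A N" "finite (carrier N)"
    and g: "g \<in> mod_hom A M N" "g ` carrier M = carrier N" and f: "f \<in> mod_hom A P N"
  shows "\<exists>h \<in> mod_hom A P M. \<forall>x \<in> carrier P. g (h x) = f x"
  using P M N g f unfolding projective_def fd_module_iff by blast

lemma projectiveI:
  assumes "left_module A P" "finite (carrier P)"
    and "\<And>(M :: ('a, nat) module) (N :: ('a, nat) module) g f.
      left_module A M \<Longrightarrow> finite (carrier M) \<Longrightarrow> left_module A N \<Longrightarrow> finite (carrier N) \<Longrightarrow>
      g \<in> mod_hom A M N \<Longrightarrow> g ` carrier M = carrier N \<Longrightarrow> f \<in> mod_hom A P N \<Longrightarrow>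
      \<exists>h \<in> mod_hom A P M. \<forall>x \<in> carrier P. g (h x) = f x"
  shows "projective K A P"
  unfolding projective_def fd_module_iff using assms by blast

lemma mod_hom_compose:
  assumes "f \<in> mod_hom A M N" "g \<in> mod_hom A N P"
    and "left_module A M" "left_module A N" "left_module A P"
  shows "compose (carrier M) g f \<in> mod_hom A M P"
  using assms hom_compose[of f "triv M" "triv N" g "triv P"] by (simp add: hom_triv)

text \<open>A morphism from the retract is pulled back to P along p, lifted there, and restricted
  along i.\<close>

lemma projective_retract:
  assumes P: "projective K A P" and P': "left_module A P'" "finite (carrier P')"
    and i: "i \<in> mod_hom A P' P" and p: "p \<in> mod_hom A P P'"
    and pi: "\<And>x. x \<in> carrier P' \<Longrightarrow> p (i x) = x"
  shows "projective K A P'"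
proof (rule projectiveI[OF P'])
  fix M N :: "('a, nat) module" and g f
  assume M: "left_module A M" "finite (carrier M)" and N: "left_module A N" "finite (carrier N)"
    and g: "g \<in> mod_hom A M N" "g ` carrier M = carrier N" and f: "f \<in> mod_hom A P' N"
  have "compose (carrier P) f p \<in> mod_hom A P N"
    using p f projectiveD[OF P] P' N by (intro mod_hom_compose)
  from projective_lift[OF P M N g this]
  obtain h where h: "h \<in> mod_hom A P M" "\<forall>x\<in>carrier P. g (h x) = f (p x)"
    by (auto simp: compose_eq)
  have "i x \<in> carrier P" if "x \<in> carrier P'" for x using i that by (auto simp: mod_hom_def)
  then show "\<exists>h \<in> mod_hom A P' M. \<forall>x \<in> carrier P'. g (h x) = f x"
    using h pi mod_hom_compose[OF i h(1) P'(1) projectiveD(1)[OF P] M(1)]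
    by (intro bexI[of _ "compose (carrier P') h i"]) (auto simp: compose_eq)
qed

lemma hom_copair:
  assumes f: "f \<in> hom X T" and g: "g \<in> hom Y T" and cc: "is_cc X" "is_cc Y" "is_cc T"
  shows "(\<lambda>p\<in>car X \<times> car Y. f (fst p) \<oplus>\<^bsub>fst T\<^esub> g (snd p)) \<in> hom (cc_sum X Y) T"
  using cc by (subst cc_sum_simps(1)[symmetric], intro hom_restrictI)
    (auto simp: homD[OF f] homD[OF g] cc_add_ac[OF cc(3)])

lemma hom_sum_in1:
  "is_cc X \<Longrightarrow> is_cc Y \<Longrightarrow> (\<lambda>x\<in>car X. (x, \<zero>\<^bsub>fst Y\<^esub>)) \<in> hom X (cc_sum X Y)"
  by (intro hom_restrictI) auto

lemma hom_sum_in2: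
  "is_cc X \<Longrightarrow> is_cc Y \<Longrightarrow> (\<lambda>y\<in>car Y. (\<zero>\<^bsub>fst X\<^esub>, y)) \<in> hom Y (cc_sum X Y)"
  by (intro hom_restrictI) auto

text \<open>The restrictions to the two summands are lifted separately and the lifts are
  added.\<close>

lemma projective_sum:
  assumes X: "projective K A X" and Y: "projective K A Y"
  shows "projective K A (mod_sum X Y)"
proof -
  note lX = projectiveD[OF X] and lY = projectiveD[OF Y]
  have cX: "is_cc (triv X)" and cY: "is_cc (triv Y)" using lX lY by auto
  have cS: "is_cc (triv (mod_sum X Y))" using cX cY by (simp flip: cc_sum_triv)
  then have lS: "left_module A (mod_sum X Y)"
    using is_cc_left_module[OF cS] by simp
  have car: "carrier (mod_sum X Y) = carrier X \<times> carrier Y" by (simp add: mod_sum_def)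
  show ?thesis
  proof (rule projectiveI)
    show "left_module A (mod_sum X Y)" "finite (carrier (mod_sum X Y))"
      using lS lX lY by (auto simp: car)
    fix M N :: "('a, nat) module" and g f
    assume M: "left_module A M" "finite (carrier M)" and N: "left_module A N" "finite (carrier N)"
      and g: "g \<in> mod_hom A M N" "g ` carrier M = carrier N" and f: "f \<in> mod_hom A (mod_sum X Y) N"
    have cM: "is_cc (triv M)" and cN: "is_cc (triv N)" using M N by auto
    have f': "f \<in> hom (cc_sum (triv X) (triv Y)) (triv N)"
      using f lS N by (simp add: hom_triv cc_sum_triv)
    let ?i = "\<lambda>x\<in>carrier X. (x, \<zero>\<^bsub>Y\<^esub>)" and ?j = "\<lambda>y\<in>carrier Y. (\<zero>\<^bsub>X\<^esub>, y)"
    have "compose (carrier X) f ?i \<in> hom (triv X) (triv N)"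
      "compose (carrier Y) f ?j \<in> hom (triv Y) (triv N)"
      using hom_compose[OF hom_sum_in1[OF cX cY] f' cX] hom_compose[OF hom_sum_in2[OF cX cY] f' cY]
      by simp_all
    then have "compose (carrier X) f ?i \<in> mod_hom A X N" "compose (carrier Y) f ?j \<in> mod_hom A Y N"
      using lX lY N by (simp_all add: hom_triv)
    from projective_lift[OF X M N g this(1)] projective_lift[OF Y M N g this(2)]
    obtain h k where h: "h \<in> mod_hom A X M" "\<forall>x\<in>carrier X. g (h x) = f (x, \<zero>\<^bsub>Y\<^esub>)"
      and k: "k \<in> mod_hom A Y M" "\<forall>y\<in>carrier Y. g (k y) = f (\<zero>\<^bsub>X\<^esub>, y)"
      by (auto simp: compose_eq)
    have h': "h \<in> hom (triv X) (triv M)" and k': "k \<in> hom (triv Y) (triv M)"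
      and g': "g \<in> hom (triv M) (triv N)"
      using h k g lX lY M N by (simp_all add: hom_triv)
    let ?u = "\<lambda>p\<in>carrier X \<times> carrier Y. h (fst p) \<oplus>\<^bsub>M\<^esub> k (snd p)"
    have "?u \<in> hom (cc_sum (triv X) (triv Y)) (triv M)"
      using hom_copair[OF h' k' cX cY cM] by simp
    then have u: "?u \<in> mod_hom A (mod_sum X Y) M"
      using lS M by (simp add: hom_triv cc_sum_triv)
    have "g (?u p) = f p" if "p \<in> carrier X \<times> carrier Y" for p
    proof -
      from that obtain x y where p: "p = (x, y)" "x \<in> carrier X" "y \<in> carrier Y" by auto
      have "g (?u p) = g (h x) \<oplus>\<^bsub>N\<^esub> g (k y)"
        using p homD(1)[OF h'] homD(1)[OF k'] homD(2)[OF g'] by simp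
      also have "\<dots> = f (x, \<zero>\<^bsub>Y\<^esub>) \<oplus>\<^bsub>N\<^esub> f (\<zero>\<^bsub>X\<^esub>, y)" using h k p by simp
      also have "\<dots> = f p"
        using homD(2)[OF f', of "(x, \<zero>\<^bsub>Y\<^esub>)" "(\<zero>\<^bsub>X\<^esub>, y)"] p
          cc_ops(1,7,8)[OF cX] cc_ops(1,7,8)[OF cY] by simp
      finally show ?thesis .
    qed
    then show "\<exists>h \<in> mod_hom A (mod_sum X Y) M. \<forall>x \<in> carrier (mod_sum X Y). g (h x) = f x"
      unfolding car using u by blast
  qed
qed

subsection \<open>Objects carried by the natural numbers\<close>

abbreviation C where "C \<equiv> C1P K A"

lemma C_iff: "X \<in> C \<longleftrightarrow> is_cc X \<and> projective K A (fst X)"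
  unfolding C1P_def is_cc_def using projectiveD(1)[of "fst X"] by (auto simp: case_prod_beta)

lemma C_is_cc [simp]: "X \<in> C \<Longrightarrow> is_cc X"
  by (simp add: C_iff)

lemma C_fin_cc [simp]: "X \<in> C \<Longrightarrow> fin_cc X"
  using projectiveD(2) unfolding fin_cc_def C_iff by blast

lemma cc_hom_mod_hom: "f \<in> hom X Y \<Longrightarrow> f \<in> mod_hom A (fst X) (fst Y)"
  by (simp add: cc_hom_def)

lemma projective_iso:
  assumes "cc_iso A X Y" "is_cc X" "fin_cc Y" "projective K A (fst X)"
  shows "projective K A (fst Y)"
proof -
  obtain f where f: "f \<in> cc_isos A X Y" using assms(1) by (auto simp: cc_iso_def)
  obtain g where g: "g \<in> cc_isos A Y X" "\<forall>y\<in>car Y. f (g y) = y"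
    using isos_inverse[OF f] assms by auto
  show ?thesis
  proof (rule projective_retract[OF assms(4)])
    show "g \<in> mod_hom A (fst Y) (fst X)" "f \<in> mod_hom A (fst X) (fst Y)"
      using f g by (auto simp: cc_isos_def cc_hom_mod_hom)
  qed (use assms g in \<open>auto intro: is_cc_left_module\<close>)
qed

text \<open>Copies a structure along an injection. With \<open>prod_encode\<close> it brings a
  direct sum, which is carried by pairs, back to the naturals.\<close>

definition transport :: "('m \<Rightarrow> 'n) \<Rightarrow> ('a, 'm) cyclic_complex \<Rightarrow> ('a, 'n) cyclic_complex" where
  "transport e X = (let i = inv_into (car X) e in
     (\<lparr>carrier = e ` car X, mult = undefined, one = undefined, zero = e \<zero>\<^bsub>fst X\<^esub>,
       add = \<lambda>x y. e (i x \<oplus>\<^bsub>fst X\<^esub> i y), smult = \<lambda>a x. e (a \<odot>\<^bsub>fst X\<^esub> i x)\<rparr>,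
      \<lambda>x\<in>e ` car X. e (snd X (i x))))"

lemma transport:
  assumes X: "is_cc X" and e: "inj_on e (car X)"
  shows "is_cc (transport e X)" "cc_iso A X (transport e X)"
proof -
  define i where "i = inv_into (car X) e"
  have ie: "i (e x) = x" if "x \<in> car X" for x using e that by (simp add: i_def)
  have ops: "car (transport e X) = e ` car X" "\<zero>\<^bsub>fst (transport e X)\<^esub> = e \<zero>\<^bsub>fst X\<^esub>"
    "\<And>x y. x \<oplus>\<^bsub>fst (transport e X)\<^esub> y = e (i x \<oplus>\<^bsub>fst X\<^esub> i y)"
    "\<And>a x. a \<odot>\<^bsub>fst (transport e X)\<^esub> x = e (a \<odot>\<^bsub>fst X\<^esub> i x)"
    "snd (transport e X) = (\<lambda>x\<in>e ` car X. e (snd X (i x)))"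
    by (simp_all add: transport_def i_def Let_def)
  note [simp] = X ie ops
  show cc: "is_cc (transport e X)"
  proof (rule is_ccI)
    show "abelian_group (fst (transport e X))"
    proof (rule abelian_groupI)
      fix x assume "x \<in> car (transport e X)"
      then show "\<exists>y\<in>car (transport e X). y \<oplus>\<^bsub>fst (transport e X)\<^esub> x = \<zero>\<^bsub>fst (transport e X)\<^esub>"
        by (intro bexI[of _ "e (\<ominus>\<^bsub>fst X\<^esub> i x)"]) auto
    qed (auto simp: cc_add_ac[OF X])
  qed (auto simp: inj_on_eq_iff[OF e])
  show "cc_iso A X (transport e X)"
    by (rule isoI[where f = e]) (use e in \<open>auto simp: bij_betw_def inj_on_eq_iff[OF e]\<close>)
qed

lemma fin_cc_iso:
  assumes "cc_iso A X Y" "fin_cc X" "is_cc Y"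
  shows "fin_cc Y"
proof -
  obtain f where "bij_betw f (car X) (car Y)"
    using assms(1) by (auto simp: cc_iso_def cc_isos_def)
  then show ?thesis
    using assms(3) fin_ccD(2)[OF assms(2)] bij_betw_finite unfolding fin_cc_def by blast
qed

definition nsum :: "('a, nat) cyclic_complex \<Rightarrow> ('a, nat) cyclic_complex \<Rightarrow> ('a, nat) cyclic_complex" where
  "nsum X Y = transport prod_encode (cc_sum X Y)"

lemma nsum:
  assumes "X \<in> C" "Y \<in> C"
  shows "nsum X Y \<in> C" "cc_iso A (cc_sum X Y) (nsum X Y)"
proof -
  have "inj_on prod_encode (car (cc_sum X Y))" by (rule inj_prod_encode)
  with assms have *: "is_cc (nsum X Y)" "cc_iso A (cc_sum X Y) (nsum X Y)"
    unfolding nsum_def by (auto intro!: transport)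
  then show "cc_iso A (cc_sum X Y) (nsum X Y)" by simp
  have "fin_cc (nsum X Y)" using * assms by (intro fin_cc_iso[OF *(2)]) auto
  moreover have "projective K A (fst (cc_sum X Y))"
    using assms unfolding C_iff by (simp add: cc_sum_def projective_sum)
  ultimately show "nsum X Y \<in> C"
    using * assms projective_iso[OF *(2)] unfolding C_iff by simp
qed

text \<open>The inclusion and e itself exhibit the image as a retract, hence as projective. Images
  of idempotents thus qualify as the summands over which indecomposability quantifies.\<close>

lemma C_cc_im:
  assumes X: "X \<in> C" and e: "idempotent X e"
  shows "cc_im e X \<in> C"
proof -
  have h: "e \<in> hom X X" using e by (simp add: idempotent_def)
  have cc: "is_cc (cc_im e X)" using assms by simp
  have i: "restrict (\<lambda>x. x) (car (cc_im e X)) \<in> hom (cc_im e X) X"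
    using X cc idempotent_image[OF e] by (intro hom_restrictI) auto
  have p: "restrict e (car X) \<in> hom X (cc_im e X)"
    using X cc homD[OF h] by (intro hom_restrictI) auto
  have "projective K A (fst (cc_im e X))"
  proof (rule projective_retract[OF _ _ _ cc_hom_mod_hom[OF i] cc_hom_mod_hom[OF p]])
    show "projective K A (fst X)" using X unfolding C_iff by blast
    show "left_module A (fst (cc_im e X))" using cc by (rule is_cc_left_module)
  qed (use X idempotent_image[OF e] in auto)
  with cc show ?thesis unfolding C_iff by blast
qed

subsection \<open>Endomorphisms of indecomposable objects\<close>

abbreviation indec where "indec \<equiv> cc_indecomposable K A"

lemma indecD:
  assumes "indec X"
  shows "X \<in> C" "\<not> cc_is_zero X"
  using assms by (auto simp: cc_indecomposable_def)

text \<open>The idempotents e and 1 - e cut out complementary summands in \<open>C\<close>, one of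
  which must vanish.\<close>

lemma indec_idempotent:
  assumes X: "indec X" and e: "idempotent X e"
  shows "(\<forall>x\<in>car X. e x = \<zero>\<^bsub>fst X\<^esub>) \<or> (\<forall>x\<in>car X. e x = x)"
proof -
  let ?e' = "hdiff X X (idh X) e"
  note C = indecD(1)[OF X]
  have h: "e \<in> hom X X" using e by (simp add: idempotent_def)
  have e': "idempotent X ?e'" using idempotent_complement[OF C_is_cc[OF C] e] .
  have "cc_im e X \<in> C" "cc_im ?e' X \<in> C" "cc_iso A X (cc_sum (cc_im e X) (cc_im ?e' X))"
    using C e e' by (auto intro: C_cc_im idempotent_split)
  then have "cc_is_zero (cc_im e X) \<or> cc_is_zero (cc_im ?e' X)"
    using X unfolding cc_indecomposable_def by blast
  then show ?thesis
  proof
    assume "cc_is_zero (cc_im e X)"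
    then have "e ` car X = {\<zero>\<^bsub>fst X\<^esub>}" by (simp add: cc_is_zero_def)
    then show ?thesis by blast
  next
    assume "cc_is_zero (cc_im ?e' X)"
    then have z: "?e' ` car X = {\<zero>\<^bsub>fst X\<^esub>}" unfolding cc_is_zero_def cc_im_simps .
    have "e x = x" if x: "x \<in> car X" for x
    proof -
      have "?e' x = \<zero>\<^bsub>fst X\<^esub>" using z x by blast
      then have "x \<ominus>\<^bsub>fst X\<^esub> e x = \<zero>\<^bsub>fst X\<^esub>" using x by simp
      then show ?thesis
        using cc_diff_zero[OF C_is_cc[OF C] x homD(1)[OF h x]] by simp
    qed
    then show ?thesis by blast
  qed
qed

text \<open>By the pigeonhole principle two iterates agree on the finite set, so the iterates are
  periodic from some exponent i on. A multiple of the period beyond i gives an idempotent.\<close>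

lemma idempotent_power:
  assumes "finite S" "f \<in> S \<rightarrow> S"
  shows "\<exists>n>0. \<forall>x\<in>S. (f ^^ n) ((f ^^ n) x) = (f ^^ n) x"
proof -
  have cl: "(f ^^ n) x \<in> S" if "x \<in> S" for n x using assms(2) that by (induction n) auto
  have "\<not> inj (\<lambda>n. restrict (f ^^ n) S)"
  proof
    assume "inj (\<lambda>n. restrict (f ^^ n) S)"
    moreover have "range (\<lambda>n. restrict (f ^^ n) S) \<subseteq> S \<rightarrow>\<^sub>E S" using cl by auto
    moreover have "finite (S \<rightarrow>\<^sub>E S)" using assms by (auto intro: finite_PiE)
    ultimately have "finite (UNIV :: nat set)" by (metis finite_imageD finite_subset)
    then show False by simp
  qed
  then obtain i j where ij: "i < j" "restrict (f ^^ i) S = restrict (f ^^ j) S"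
    unfolding inj_def by (metis linorder_neqE_nat)
  define p where "p = j - i"
  have p: "p > 0" "j = p + i" using ij by (auto simp: p_def)
  have step: "(f ^^ (p + m)) x = (f ^^ m) x" if "i \<le> m" "x \<in> S" for m x
  proof -
    have "(f ^^ i) x = (f ^^ j) x" using fun_cong[OF ij(2), of x] that by simp
    then have "(f ^^ (m - i)) ((f ^^ i) x) = (f ^^ (m - i)) ((f ^^ j) x)" by simp
    then have "(f ^^ (m - i + i)) x = (f ^^ (m - i + j)) x" unfolding funpow_add by simp
    then show ?thesis using that p by (simp add: add.commute)
  qed
  have steps: "(f ^^ (k * p + m)) x = (f ^^ m) x" if "i \<le> m" "x \<in> S" for k m x
  proof (induction k)
    case (Suc k)
    have "(f ^^ (p + (k * p + m))) x = (f ^^ (k * p + m)) x" using that by (intro step) auto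
    then show ?case using Suc by (simp add: add.assoc)
  qed simp
  \<comment> \<open>A multiple of the period that is at least i, and positive even if i = 0.\<close>
  let ?n = "Suc i * p"
  have "i \<le> ?n" using p(1) by (cases p) auto
  then have "(f ^^ ?n) ((f ^^ ?n) x) = (f ^^ ?n) x" if "x \<in> S" for x
    using steps[of ?n x "Suc i"] that by (metis comp_apply funpow_add)
  moreover have "0 < ?n" using p by simp
  ultimately show ?thesis by blast
qed

lemma funpow_hom:
  assumes X: "is_cc X" and f: "f \<in> hom X X"
  shows "restrict (f ^^ n) (car X) \<in> hom X X"
proof (induction n)
  case 0
  then show ?case using hom_id[OF X] by (simp add: id_def restrict_def)
next
  case (Suc n)
  have "restrict (f ^^ Suc n) (car X) = compose (car X) f (restrict (f ^^ n) (car X))"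
    by (auto simp: compose_def)
  then show ?case using hom_compose[OF Suc f X] by (simp only:)
qed

text \<open>Some positive power of f is idempotent, hence zero or the identity: f is nilpotent in
  the first case and left invertible in the second.\<close>

lemma fitting:
  assumes X: "indec X" and f: "f \<in> hom X X"
  shows "inj_on f (car X) \<or> (\<exists>n. \<forall>x\<in>car X. (f ^^ n) x = \<zero>\<^bsub>fst X\<^esub>)"
proof -
  note C = indecD(1)[OF X]
  have cl: "f \<in> car X \<rightarrow> car X" using homD(1)[OF f] by auto
  then obtain n where n: "n > 0" "\<forall>x\<in>car X. (f ^^ n) ((f ^^ n) x) = (f ^^ n) x"
    using idempotent_power[OF fin_ccD(2)[OF C_fin_cc[OF C]]] by blast
  have "(f ^^ n) x \<in> car X" if "x \<in> car X" for n x using cl that by (induction n) auto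
  then have "idempotent X (restrict (f ^^ n) (car X))"
    unfolding idempotent_def using n(2) funpow_hom[OF C_is_cc[OF C] f] by auto
  from indec_idempotent[OF X this] show ?thesis
  proof
    assume "\<forall>x\<in>car X. restrict (f ^^ n) (car X) x = \<zero>\<^bsub>fst X\<^esub>"
    then show ?thesis by auto
  next
    assume id: "\<forall>x\<in>car X. restrict (f ^^ n) (car X) x = x"
    obtain m where m: "n = Suc m" using n(1) gr0_conv_Suc by auto
    have "(f ^^ m) (f x) = x" if "x \<in> car X" for x
      using id that by (simp add: m flip: funpow_swap1)
    then have "inj_on f (car X)" by (rule inj_on_inverseI)
    then show ?thesis by simp
  qed
qed

lemma inj_endo_bij:
  assumes "fin_cc X" "f \<in> hom X X"
  shows "bij_betw f (car X) (car X) \<longleftrightarrow> inj_on f (car X)"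
proof -
  have "f ` car X \<subseteq> car X" using homD(1)[OF assms(2)] by auto
  then show ?thesis
    using endo_inj_surj[of "car X" f] assms(1) by (auto simp: bij_betw_def)
qed

lemma inj_homI:
  assumes f: "f \<in> hom X Y" and cc: "is_cc X" "is_cc Y"
    and "\<And>x. x \<in> car X \<Longrightarrow> f x = \<zero>\<^bsub>fst Y\<^esub> \<Longrightarrow> x = \<zero>\<^bsub>fst X\<^esub>"
  shows "inj_on f (car X)"
proof (rule inj_onI)
  fix x y assume xy: "x \<in> car X" "y \<in> car X" "f x = f y"
  have "f (x \<ominus>\<^bsub>fst X\<^esub> y) = \<zero>\<^bsub>fst Y\<^esub>"
    using xy cc homD(1)[OF f] by (simp add: hom_diff[OF f])
  then have "x \<ominus>\<^bsub>fst X\<^esub> y = \<zero>\<^bsub>fst X\<^esub>" using assms(4) xy cc by simp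
  then show "x = y" using xy cc by (simp add: cc_diff_zero)
qed

text \<open>The endomorphism ring is local. With v inverse to the sum, v f + v g = 1. Fitting's
  alternative for v f then decides which of f and g is injective, and finiteness makes it
  bijective.\<close>

lemma indec_local:
  assumes X: "indec X" and f: "f \<in> hom X X" and g: "g \<in> hom X X"
    and bij: "bij_betw (\<lambda>x. f x \<oplus>\<^bsub>fst X\<^esub> g x) (car X) (car X)"
  shows "bij_betw f (car X) (car X) \<or> bij_betw g (car X) (car X)"
proof -
  note C = C_is_cc[OF indecD(1)[OF X]] and F = C_fin_cc[OF indecD(1)[OF X]]
  have "hadd X X f g \<in> cc_isos A X X"
    unfolding cc_isos_def using hom_hadd[OF f g C C] bij by (simp add: hadd_def cong: bij_betw_cong)
  from isos_inverse[OF this C C] obtain v where v: "v \<in> hom X X"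
    "\<forall>x\<in>car X. v (f x \<oplus>\<^bsub>fst X\<^esub> g x) = x" by (auto simp: cc_isos_def)
  note [simp] = C homD[OF f] homD[OF g] homD[OF v(1)]
  let ?f = "compose (car X) v f"
  have f': "?f \<in> hom X X" using f v(1) C by (rule hom_compose)
  from fitting[OF X this] show ?thesis
  proof
    assume "inj_on ?f (car X)"
    then have "inj_on f (car X)" by (auto simp: inj_on_def compose_eq)
    then show ?thesis using inj_endo_bij[OF F f] by simp
  next
    assume "\<exists>n. \<forall>x\<in>car X. (?f ^^ n) x = \<zero>\<^bsub>fst X\<^esub>"
    then obtain n where n: "\<forall>x\<in>car X. (?f ^^ n) x = \<zero>\<^bsub>fst X\<^esub>" ..
    \<comment> \<open>On the kernel of g the map v f is the identity, so its nilpotency leaves only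
      zero there.\<close>
    have "inj_on g (car X)"
    proof (rule inj_homI[OF g C C])
      fix x assume x: "x \<in> car X" "g x = \<zero>\<^bsub>fst X\<^esub>"
      have "v (f x \<oplus>\<^bsub>fst X\<^esub> g x) = x" using v(2) x by blast
      then have "?f x = x" using x by (simp add: compose_eq hom_zero[OF v(1)])
      then have "(?f ^^ m) x = x" for m by (induction m) auto
      then show "x = \<zero>\<^bsub>fst X\<^esub>" using n x by auto
    qed
    then show ?thesis using inj_endo_bij[OF F g] by simp
  qed
qed

subsection \<open>Multiplicities of indecomposable summands\<close>

text \<open>Asking for g f to be bijective instead of the identity changes nothing, as g can be
  corrected by the inverse of g f. For indecomposable X this is the radical Hom space from X to
  M.\<close>

definition rad :: "('a, 'm) cyclic_complex \<Rightarrow> ('a, 'n) cyclic_complex \<Rightarrow> ('m \<Rightarrow> 'n) set" where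
  "rad X M = {f \<in> hom X M. \<forall>g \<in> hom M X. \<not> bij_betw (\<lambda>x. g (f x)) (car X) (car X)}"

text \<open>A morphism from the sum composed with the pair has the form a f + b g. If it is
  bijective, locality makes one of the two terms bijective.\<close>

lemma rad_hpair:
  assumes X: "indec X" and cc: "is_cc M" "is_cc N" and f: "f \<in> hom X M" and g: "g \<in> hom X N"
  shows "hpair X f g \<in> rad X (cc_sum M N) \<longleftrightarrow> f \<in> rad X M \<and> g \<in> rad X N"
proof -
  note cX = C_is_cc[OF indecD(1)[OF X]]
  let ?h = "hpair X f g"
  have h: "?h \<in> hom X (cc_sum M N)" using f g cX by (rule hom_hpair)
  note [simp] = homD(1)[OF f] homD(1)[OF g]
  show ?thesis
  proof (intro iffI conjI)
    assume r: "?h \<in> rad X (cc_sum M N)"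
    have "\<not> bij_betw (\<lambda>x. u (f x)) (car X) (car X)" if u: "u \<in> hom M X" for u
    proof -
      let ?u = "compose (car (cc_sum M N)) u (\<lambda>p\<in>car M \<times> car N. fst p)"
      have "?u \<in> hom (cc_sum M N) X" using u cc by (intro hom_compose[OF hom_sum_fst]) auto
      then have "\<not> bij_betw (\<lambda>x. ?u (?h x)) (car X) (car X)" using r by (auto simp: rad_def)
      moreover have "?u (?h x) = u (f x)" if "x \<in> car X" for x
        using that by (simp add: hpair_def compose_eq)
      ultimately show ?thesis by (simp cong: bij_betw_cong)
    qed
    then show "f \<in> rad X M" using f by (simp add: rad_def)
    have "\<not> bij_betw (\<lambda>x. u (g x)) (car X) (car X)" if u: "u \<in> hom N X" for u
    proof -
      let ?u = "compose (car (cc_sum M N)) u (\<lambda>p\<in>car M \<times> car N. snd p)"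
      have "?u \<in> hom (cc_sum M N) X" using u cc by (intro hom_compose[OF hom_sum_snd]) auto
      then have "\<not> bij_betw (\<lambda>x. ?u (?h x)) (car X) (car X)" using r by (auto simp: rad_def)
      moreover have "?u (?h x) = u (g x)" if "x \<in> car X" for x
        using that by (simp add: hpair_def compose_eq)
      ultimately show ?thesis by (simp cong: bij_betw_cong)
    qed
    then show "g \<in> rad X N" using g by (simp add: rad_def)
  next
    assume r: "f \<in> rad X M \<and> g \<in> rad X N"
    have "\<not> bij_betw (\<lambda>x. u (?h x)) (car X) (car X)" if u: "u \<in> hom (cc_sum M N) X" for u
    proof
      assume bij: "bij_betw (\<lambda>x. u (?h x)) (car X) (car X)"
      let ?a = "compose (car M) u (\<lambda>x\<in>car M. (x, \<zero>\<^bsub>fst N\<^esub>))"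
      let ?b = "compose (car N) u (\<lambda>x\<in>car N. (\<zero>\<^bsub>fst M\<^esub>, x))"
      have a: "?a \<in> hom M X" and b: "?b \<in> hom N X"
        using hom_compose[OF hom_sum_in1 u] hom_compose[OF hom_sum_in2 u] cc by blast+
      have "u (?h x) = ?a (f x) \<oplus>\<^bsub>fst X\<^esub> ?b (g x)" if "x \<in> car X" for x
        using that cc homD(2)[OF u, of "(f x, \<zero>\<^bsub>fst N\<^esub>)" "(\<zero>\<^bsub>fst M\<^esub>, g x)"]
        by (simp add: hpair_def compose_eq)
      then have "bij_betw (\<lambda>x. ?a (f x) \<oplus>\<^bsub>fst X\<^esub> ?b (g x)) (car X) (car X)"
        using bij by (simp cong: bij_betw_cong)
      then have "bij_betw (\<lambda>x. compose (car X) ?a f x \<oplus>\<^bsub>fst X\<^esub> compose (car X) ?b g x) (car X) (car X)"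
        by (simp add: compose_eq cong: bij_betw_cong)
      then have "bij_betw (compose (car X) ?a f) (car X) (car X) \<or>
          bij_betw (compose (car X) ?b g) (car X) (car X)"
        using indec_local[OF X hom_compose[OF f a cX] hom_compose[OF g b cX]] by blast
      then have "bij_betw (\<lambda>x. ?a (f x)) (car X) (car X) \<or> bij_betw (\<lambda>x. ?b (g x)) (car X) (car X)"
        by (simp add: compose_eq cong: bij_betw_cong)
      then show False using r a b unfolding rad_def by blast
    qed
    then show "?h \<in> rad X (cc_sum M N)" using h by (simp add: rad_def)
  qed
qed

lemma card_rad_sum:
  assumes X: "indec X" and cc: "is_cc M" "is_cc N"
  shows "card (rad X (cc_sum M N)) = card (rad X M) * card (rad X N)"
proof -
  note bij = bij_hpair[OF C_is_cc[OF indecD(1)[OF X]] cc]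
  have "(\<lambda>(f, g). hpair X f g) ` (rad X M \<times> rad X N) = rad X (cc_sum M N)"
  proof (intro equalityI subsetI)
    fix h assume "h \<in> (\<lambda>(f, g). hpair X f g) ` (rad X M \<times> rad X N)"
    then obtain f g where "f \<in> rad X M" "g \<in> rad X N" "h = hpair X f g" by auto
    then show "h \<in> rad X (cc_sum M N)"
      using rad_hpair[OF X cc, of f g] by (auto simp: rad_def)
  next
    fix h assume h: "h \<in> rad X (cc_sum M N)"
    then have "h \<in> hom X (cc_sum M N)" by (simp add: rad_def)
    then have "h \<in> (\<lambda>(f, g). hpair X f g) ` (hom X M \<times> hom X N)"
      using bij_betw_imp_surj_on[OF bij] by simp
    then obtain f g where fg: "f \<in> hom X M" "g \<in> hom X N" "h = hpair X f g"
      by auto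
    then show "h \<in> (\<lambda>(f, g). hpair X f g) ` (rad X M \<times> rad X N)"
      using rad_hpair[OF X cc fg(1,2)] h by (intro image_eqI[of _ _ "(f, g)"]) auto
  qed
  moreover have "rad X M \<times> rad X N \<subseteq> hom X M \<times> hom X N" by (auto simp: rad_def)
  ultimately have "bij_betw (\<lambda>(f, g). hpair X f g) (rad X M \<times> rad X N) (rad X (cc_sum M N))"
    unfolding bij_betw_def using bij_betw_imp_inj_on[OF bij] inj_on_subset by blast
  from bij_betw_same_card[OF this] show ?thesis by (simp add: card_cartesian_product)
qed

lemma finite_rad [simp]: "fin_cc X \<Longrightarrow> fin_cc M \<Longrightarrow> finite (rad X M)"
  by (simp add: rad_def)

text \<open>Composition with an isomorphism is injective and preserves \<open>rad\<close>, because a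
  would-be retraction can be composed with the isomorphism as well. The reverse inequality comes
  from symmetry.\<close>

lemma card_iso_right_le:
  assumes iso: "cc_iso A M M'" and cc: "fin_cc X" "fin_cc M" "fin_cc M'"
  shows "card (hom X M) \<le> card (hom X M')" "card (rad X M) \<le> card (rad X M')"
proof -
  obtain u where u: "u \<in> hom M M'" "inj_on u (car M)"
    using iso by (auto simp: cc_iso_def cc_isos_def bij_betw_def)
  have inj: "inj_on (compose (car X) u) (hom X M)"
  proof (rule inj_onI)
    fix f g assume fg: "f \<in> hom X M" "g \<in> hom X M" and eq: "compose (car X) u f = compose (car X) u g"
    show "f = g"
    proof (rule hom_eqI[OF fg])
      fix x assume x: "x \<in> car X"
      then have "u (f x) = u (g x)" using eq by (auto simp: compose_cong_iff)
      then show "f x = g x" using u(2) homD(1)[OF fg(1) x] homD(1)[OF fg(2) x] by (simp add: inj_on_eq_iff)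
    qed
  qed
  have cl: "compose (car X) u f \<in> hom X M'" if "f \<in> hom X M" for f
    using that u(1) cc by (intro hom_compose) auto
  show "card (hom X M) \<le> card (hom X M')"
    using inj cl cc by (intro card_inj_on_le[of "compose (car X) u"]) auto
  have "compose (car X) u f \<in> rad X M'" if f: "f \<in> rad X M" for f
  proof -
    have fh: "f \<in> hom X M" using f by (simp add: rad_def)
    have "\<not> bij_betw (\<lambda>x. g (compose (car X) u f x)) (car X) (car X)" if g: "g \<in> hom M' X" for g
    proof -
      have "compose (car M) g u \<in> hom M X" using u(1) g cc by (intro hom_compose) auto
      then have "\<not> bij_betw (\<lambda>x. compose (car M) g u (f x)) (car X) (car X)"
        using f unfolding rad_def by blast
      then show ?thesis using homD(1)[OF fh] by (simp add: compose_eq cong: bij_betw_cong)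
    qed
    then show ?thesis using cl[OF fh] by (simp add: rad_def)
  qed
  moreover have "rad X M \<subseteq> hom X M" by (auto simp: rad_def)
  ultimately show "card (rad X M) \<le> card (rad X M')"
    using inj cc by (intro card_inj_on_le[of "compose (car X) u"]) (auto intro: inj_on_subset)
qed

lemma card_iso_right:
  assumes iso: "cc_iso A M M'" and cc: "fin_cc X" "fin_cc M" "fin_cc M'"
  shows "card (hom X M) = card (hom X M')" "card (rad X M) = card (rad X M')"
proof -
  have "cc_iso A M' M" using iso cc by (simp add: cc_iso_sym)
  with iso show "card (hom X M) = card (hom X M')" "card (rad X M) = card (rad X M')"
    using card_iso_right_le[of M M' X] card_iso_right_le[of M' M X] cc by (auto intro: antisym)
qed

lemma card_iso_left_le:
  assumes iso: "cc_iso A M M'" and cc: "fin_cc X" "fin_cc M" "fin_cc M'"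
  shows "card (hom M' X) \<le> card (hom M X)"
proof -
  obtain u where u: "u \<in> hom M M'" "u ` car M = car M'"
    using iso by (auto simp: cc_iso_def cc_isos_def bij_betw_def)
  have inj: "inj_on (\<lambda>f. compose (car M) f u) (hom M' X)"
  proof (rule inj_onI)
    fix f g assume fg: "f \<in> hom M' X" "g \<in> hom M' X" and eq: "compose (car M) f u = compose (car M) g u"
    show "f = g"
    proof (rule hom_eqI[OF fg])
      fix x assume x: "x \<in> car M'"
      then obtain m where "m \<in> car M" "x = u m" using u(2) by auto
      then show "f x = g x" using eq by (auto simp: compose_cong_iff)
    qed
  qed
  have cl: "compose (car M) f u \<in> hom M X" if "f \<in> hom M' X" for f
    using that u(1) cc by (intro hom_compose) auto
  show ?thesis
    using inj cl cc by (intro card_inj_on_le[of "\<lambda>f. compose (car M) f u"]) auto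
qed

lemma card_iso_left:
  assumes iso: "cc_iso A M M'" and cc: "fin_cc X" "fin_cc M" "fin_cc M'"
  shows "card (hom M X) = card (hom M' X)"
proof -
  have "cc_iso A M' M" using iso cc by (simp add: cc_iso_sym)
  with iso show ?thesis
    using card_iso_left_le[of M M' X] card_iso_left_le[of M' M X] cc by (auto intro: antisym)
qed

text \<open>The identity of X is its own retraction and so lies outside the radical.\<close>

lemma rad_self:
  assumes X: "indec X"
  shows "card (rad X X) < card (hom X X)"
proof -
  note cX = C_is_cc[OF indecD(1)[OF X]] C_fin_cc[OF indecD(1)[OF X]]
  have "bij_betw (\<lambda>x. idh X (idh X x)) (car X) (car X)" by (simp add: bij_betw_def inj_on_def)
  then have "idh X \<notin> rad X X" using hom_id[OF cX(1)] unfolding rad_def by blast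
  moreover have "rad X X \<subseteq> hom X X" unfolding rad_def by blast
  ultimately have "rad X X \<subset> hom X X" using hom_id[OF cX(1)] by blast
  then show ?thesis using cX by (intro psubset_card_mono) auto
qed

text \<open>The zero map is radical because X is not zero. This keeps the denominators of
  \<open>multiplicity\<close> positive.\<close>

lemma card_rad_pos:
  assumes X: "indec X" and M: "fin_cc M"
  shows "0 < card (rad X M)"
proof -
  note cX = C_is_cc[OF indecD(1)[OF X]] C_fin_cc[OF indecD(1)[OF X]]
  let ?z = "\<lambda>x\<in>car X. \<zero>\<^bsub>fst M\<^esub>"
  have "\<not> bij_betw (\<lambda>x. g (?z x)) (car X) (car X)" if g: "g \<in> hom M X" for g
  proof
    assume "bij_betw (\<lambda>x. g (?z x)) (car X) (car X)"
    then have "(\<lambda>x. g (?z x)) ` car X = car X" by (simp add: bij_betw_def)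
    moreover have "(\<lambda>x. g (?z x)) ` car X \<subseteq> {\<zero>\<^bsub>fst X\<^esub>}" using g M cX by auto
    ultimately have "car X = {\<zero>\<^bsub>fst X\<^esub>}" using cc_ops(1)[OF cX(1)] by blast
    then show False using indecD(2)[OF X] by (simp add: cc_is_zero_def)
  qed
  then have "?z \<in> rad X M" using hom_zeroI[OF cX(1) fin_ccD(1)[OF M]] unfolding rad_def by blast
  then show ?thesis using finite_rad[OF cX(2) M] by (auto simp: card_gt_0_iff)
qed

text \<open>If g f were bijective with inverse v, then f v g would be an idempotent of Y. Were it
  zero, X would vanish; were it the identity, f would be an isomorphism.\<close>

lemma rad_other:
  assumes X: "indec X" and Y: "indec Y" and ne: "\<not> cc_iso A X Y"
  shows "rad X Y = hom X Y"
proof -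
  note cX = C_is_cc[OF indecD(1)[OF X]] and cY = C_is_cc[OF indecD(1)[OF Y]]
  have False if f: "f \<in> hom X Y" and g: "g \<in> hom Y X"
    and bij: "bij_betw (\<lambda>x. g (f x)) (car X) (car X)" for f g
  proof -
    note [simp] = homD(1)[OF f] homD(1)[OF g]
    have "compose (car X) g f \<in> cc_isos A X X"
      using hom_compose[OF f g cX] bij by (simp add: cc_isos_def compose_eq cong: bij_betw_cong)
    from isos_inverse[OF this cX cX] obtain v where v: "v \<in> hom X X"
      "\<forall>x\<in>car X. v (g (f x)) = x" by (auto simp: cc_isos_def compose_eq)
    note [simp] = homD(1)[OF v(1)]
    let ?e = "compose (car Y) f (compose (car Y) v g)"
    have "idempotent Y ?e"
      unfolding idempotent_def using v(2)
      by (intro conjI hom_compose[OF hom_compose[OF g v(1) cY] f cY]) (simp add: compose_eq)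
    from indec_idempotent[OF Y this] show False
    proof
      assume z: "\<forall>y\<in>car Y. ?e y = \<zero>\<^bsub>fst Y\<^esub>"
      have "x = \<zero>\<^bsub>fst X\<^esub>" if x: "x \<in> car X" for x
      proof -
        have "?e (f x) = \<zero>\<^bsub>fst Y\<^esub>" using z x homD(1)[OF f x] by blast
        then have "f x = \<zero>\<^bsub>fst Y\<^esub>" using x v(2) by (simp add: compose_eq)
        then have "v (g (f x)) = \<zero>\<^bsub>fst X\<^esub>"
          using hom_zero[OF g cY cX] hom_zero[OF v(1) cX cX] by simp
        then show ?thesis using v(2) x by simp
      qed
      then have "car X = {\<zero>\<^bsub>fst X\<^esub>}" using cc_ops(1)[OF cX] by blast
      then show False using indecD(2)[OF X] by (simp add: cc_is_zero_def)
    next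
      assume id: "\<forall>y\<in>car Y. ?e y = y"
      have "f ` car X = car Y"
      proof (intro equalityI subsetI)
        fix y assume y: "y \<in> car Y"
        then have "?e y = y" using id by blast
        then have "f (v (g y)) = y" using y by (simp add: compose_eq)
        then show "y \<in> f ` car X" using y by (intro image_eqI[of _ f "v (g y)"]) auto
      qed auto
      moreover have "inj_on f (car X)"
        by (rule inj_on_inverseI[of _ "\<lambda>y. v (g y)"]) (use v(2) in blast)
      ultimately have "f \<in> cc_isos A X Y" using f by (simp add: cc_isos_def bij_betw_def)
      then show False using ne by (auto simp: cc_iso_def)
    qed
  qed
  then show ?thesis by (auto simp: rad_def)
qed

subsection \<open>Isoclasses\<close>

abbreviation iclasses where "iclasses \<equiv> isoclasses K A"
abbreviation cls where "cls \<equiv> isoclass K A"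

text \<open>The same choice as in \<open>hall_coeff\<close>, so that the coefficients are the Hall
  numbers of these representatives.\<close>

definition rep :: "'a isoclass \<Rightarrow> ('a, nat) cyclic_complex" where
  "rep x = (SOME X. X \<in> x)"

lemma cls_self: "X \<in> C \<Longrightarrow> X \<in> cls X"
  by (simp add: isoclass_def cc_iso_refl)

lemma cls_eq_iff:
  assumes "X \<in> C" "Y \<in> C"
  shows "cls X = cls Y \<longleftrightarrow> cc_iso A X Y"
proof
  assume "cls X = cls Y"
  then have "Y \<in> cls X" using cls_self[OF assms(2)] by simp
  then show "cc_iso A X Y" by (simp add: isoclass_def)
next
  assume iso: "cc_iso A X Y"
  then have "cc_iso A Y X" using assms by (simp add: cc_iso_sym)
  with iso show "cls X = cls Y"
    unfolding isoclass_def using assms cc_iso_trans C_is_cc by blast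
qed

lemma rep_in: "x \<in> iclasses \<Longrightarrow> rep x \<in> x"
  unfolding rep_def isoclasses_def using cls_self by (metis imageE someI)

lemma rep_C [simp]: "x \<in> iclasses \<Longrightarrow> rep x \<in> C"
  using rep_in[of x] unfolding isoclasses_def isoclass_def by blast

lemma cls_classes [simp]: "X \<in> C \<Longrightarrow> cls X \<in> iclasses"
  by (simp add: isoclasses_def)

lemma cls_rep [simp]:
  assumes "x \<in> iclasses"
  shows "cls (rep x) = x"
proof -
  obtain X where X: "X \<in> C" "x = cls X" using assms by (auto simp: isoclasses_def)
  then have "cc_iso A X (rep x)" using rep_in[OF assms] by (simp add: isoclass_def)
  then show ?thesis using X cls_eq_iff[OF X(1) rep_C[OF assms]] by simp
qed

lemma rep_cls: "X \<in> C \<Longrightarrow> cc_iso A (rep (cls X)) X"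
  using cls_eq_iff[of "rep (cls X)" X] by simp

lemma class_eqI: "x \<in> iclasses \<Longrightarrow> y \<in> iclasses \<Longrightarrow> cc_iso A (rep x) (rep y) \<Longrightarrow> x = y"
  using cls_eq_iff[of "rep x" "rep y"] by simp

section \<open>The commutative monoid of isoclasses\<close>

definition class_monoid :: "'a isoclass monoid" where
  "class_monoid = \<lparr>carrier = iclasses, mult = \<lambda>x y. cls (nsum (rep x) (rep y)), one = cls zero_complex\<rparr>"

lemma class_monoid_simps [simp]:
  "carrier class_monoid = iclasses"
  "x \<otimes>\<^bsub>class_monoid\<^esub> y = cls (nsum (rep x) (rep y))"
  "\<one>\<^bsub>class_monoid\<^esub> = cls zero_complex"
  by (simp_all add: class_monoid_def)

lemma rep_mult:
  assumes "x \<in> iclasses" "y \<in> iclasses"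
  shows "cc_iso A (rep (cls (nsum (rep x) (rep y)))) (cc_sum (rep x) (rep y))"
  using assms nsum[of "rep x" "rep y"] rep_cls[of "nsum (rep x) (rep y)"]
  by (meson C_is_cc cc_iso_sym cc_iso_trans cls_classes is_cc_sum rep_C)

text \<open>Reduces identities in the monoid to isomorphisms between direct sums of
  representatives.\<close>

lemma mult_eqI:
  assumes "x \<in> iclasses" "y \<in> iclasses" "z \<in> iclasses" "cc_iso A (cc_sum (rep x) (rep y)) (rep z)"
  shows "z = cls (nsum (rep x) (rep y))"
  using assms rep_mult[OF assms(1,2)] nsum(1)[of "rep x" "rep y"]
  by (intro class_eqI[symmetric]) (auto intro: cc_iso_trans)

lemma zero_complex: "zero_complex \<in> C" "cc_is_zero zero_complex"
proof -
  let ?Z = "fst zero_complex :: ('a, nat) module"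
  show "cc_is_zero zero_complex" by (simp add: zero_complex_def cc_is_zero_def)
  have ops: "carrier ?Z = {0}" "\<zero>\<^bsub>?Z\<^esub> = 0" by (simp_all add: zero_complex_def)
  have "abelian_group ?Z" by (rule abelian_groupI) (auto simp: zero_complex_def)
  then have cc: "is_cc zero_complex" by (rule is_ccI) (auto simp: zero_complex_def)
  then have l: "left_module A ?Z" by (rule is_cc_left_module)
  have "projective K A ?Z"
  proof (rule projectiveI[OF l])
    fix M N :: "('a, nat) module" and g f
    assume M: "left_module A M" and N: "left_module A N"
      and g: "g \<in> mod_hom A M N" and f: "f \<in> mod_hom A ?Z N"
    have g': "g \<in> hom (triv M) (triv N)" and f': "f \<in> hom (triv ?Z) (triv N)"
      using l M N f g by (simp_all add: hom_triv)
    have "(\<lambda>x\<in>carrier ?Z. \<zero>\<^bsub>M\<^esub>) \<in> mod_hom A ?Z M"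
      using hom_zeroI[of "triv ?Z" "triv M"] l M by (simp add: hom_triv)
    moreover have "g ((\<lambda>x\<in>carrier ?Z. \<zero>\<^bsub>M\<^esub>) x) = f x" if "x \<in> carrier ?Z" for x
      using that hom_zero[OF g'] hom_zero[OF f'] l M N by (simp add: ops)
    ultimately show "\<exists>h\<in>mod_hom A ?Z M. \<forall>x\<in>carrier ?Z. g (h x) = f x" by blast
  qed (simp add: ops)
  with cc show "zero_complex \<in> C" by (simp only: C_iff)
qed

lemma comm_monoid_classes: "comm_monoid class_monoid"
proof (rule comm_monoidI)
  show "\<one>\<^bsub>class_monoid\<^esub> \<in> carrier class_monoid" by (simp add: zero_complex)
next
  fix x y assume "x \<in> carrier class_monoid" "y \<in> carrier class_monoid"
  then show "x \<otimes>\<^bsub>class_monoid\<^esub> y \<in> carrier class_monoid" by (simp add: nsum)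
next
  fix x y z assume "x \<in> carrier class_monoid" "y \<in> carrier class_monoid" "z \<in> carrier class_monoid"
  then have c: "x \<in> iclasses" "y \<in> iclasses" "z \<in> iclasses" by auto
  let ?xy = "cls (nsum (rep x) (rep y))" and ?yz = "cls (nsum (rep y) (rep z))"
  have cl: "?xy \<in> iclasses" "?yz \<in> iclasses" using c by (auto simp: nsum)
  note [simp] = c cl
  \<comment> \<open>The chosen representative of an inner product is replaced by the actual direct
    sum, reassociated, and replaced back.\<close>
  have "cc_iso A (cc_sum (rep x) (rep ?yz)) (rep (cls (nsum (rep ?xy) (rep z))))"
  proof -
    have "cc_iso A (cc_sum (rep x) (rep ?yz)) (cc_sum (rep x) (cc_sum (rep y) (rep z)))"
      by (intro cc_sum_cong cc_iso_refl rep_mult) auto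
    moreover have "cc_iso A (cc_sum (rep x) (cc_sum (rep y) (rep z)))
        (cc_sum (cc_sum (rep x) (rep y)) (rep z))"
      by (intro cc_iso_sym[OF cc_sum_assoc]) auto
    moreover have "cc_iso A (cc_sum (cc_sum (rep x) (rep y)) (rep z)) (cc_sum (rep ?xy) (rep z))"
      by (intro cc_sum_cong cc_iso_refl cc_iso_sym[OF rep_mult]) auto
    moreover have "cc_iso A (cc_sum (rep ?xy) (rep z)) (rep (cls (nsum (rep ?xy) (rep z))))"
      by (intro cc_iso_sym[OF rep_mult]) (auto simp: nsum)
    ultimately show ?thesis
      using cc_iso_trans by (metis C_is_cc c cl is_cc_sum rep_C)
  qed
  from mult_eqI[OF _ _ _ this]
  show "x \<otimes>\<^bsub>class_monoid\<^esub> y \<otimes>\<^bsub>class_monoid\<^esub> z = x \<otimes>\<^bsub>class_monoid\<^esub> (y \<otimes>\<^bsub>class_monoid\<^esub> z)"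
    by (simp add: nsum)
next
  fix x assume "x \<in> carrier class_monoid"
  then have x: "x \<in> iclasses" by simp
  let ?z = "cls zero_complex"
  have z: "?z \<in> iclasses" by (simp add: zero_complex)
  have "cc_iso A (cc_sum (rep ?z) (rep x)) (cc_sum zero_complex (rep x))"
    using x z by (intro cc_sum_cong rep_cls zero_complex cc_iso_refl) auto
  moreover have "cc_iso A (cc_sum zero_complex (rep x)) (rep x)"
    using x zero_complex by (intro cc_sum_zero) auto
  ultimately have "cc_iso A (cc_sum (rep ?z) (rep x)) (rep x)"
    by (rule cc_iso_trans) (use x z in auto)
  from mult_eqI[OF z x x this] show "\<one>\<^bsub>class_monoid\<^esub> \<otimes>\<^bsub>class_monoid\<^esub> x = x" by simp
next
  fix x y assume "x \<in> carrier class_monoid" "y \<in> carrier class_monoid"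
  then have c: "x \<in> iclasses" "y \<in> iclasses" by auto
  then have yx: "cls (nsum (rep y) (rep x)) \<in> iclasses" by (simp add: nsum)
  have "cc_iso A (cc_sum (rep x) (rep y)) (cc_sum (rep y) (rep x))"
    using c by (intro cc_sum_comm) auto
  moreover have "cc_iso A (cc_sum (rep y) (rep x)) (rep (cls (nsum (rep y) (rep x))))"
    using c yx by (intro cc_iso_sym[OF rep_mult]) auto
  ultimately have "cc_iso A (cc_sum (rep x) (rep y)) (rep (cls (nsum (rep y) (rep x))))"
    by (rule cc_iso_trans) (use c in auto)
  from mult_eqI[OF c yx this] show "x \<otimes>\<^bsub>class_monoid\<^esub> y = y \<otimes>\<^bsub>class_monoid\<^esub> x" by simp
qed

subsection \<open>Extensions of complexes of projectives\<close>

lemma ses_eq: "ses A X Y Z = {(\<phi>, \<psi>). short_exact \<phi> \<psi> Y Z X}"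
  by (simp add: ses_def short_exact_def)

text \<open>Triangularity only needs the support of the Hall numbers. Automorphism groups are finite
  and nonempty, so the quotient vanishes exactly when there is no exact sequence.\<close>

lemma hall_coeff_nonzero:
  assumes "x \<in> iclasses" "y \<in> iclasses" "z \<in> iclasses"
  shows "hall_coeff A x y z \<noteq> 0 \<longleftrightarrow> (\<exists>\<phi> \<psi>. short_exact \<phi> \<psi> (rep y) (rep z) (rep x))"
proof -
  let ?X = "rep x" and ?Y = "rep y" and ?Z = "rep z"
  have F: "fin_cc ?X" "fin_cc ?Y" "fin_cc ?Z" using assms by auto
  have "ses A ?X ?Y ?Z \<subseteq> hom ?Y ?Z \<times> hom ?Z ?X" by (auto simp: ses_eq short_exact_def)
  then have fin: "finite (ses A ?X ?Y ?Z)" using F by (auto intro: finite_subset)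
  have aut: "card (cc_Aut A W) \<noteq> 0" if W: "fin_cc W" for W :: "('a, nat) cyclic_complex"
  proof -
    have "finite (cc_Aut A W)"
      by (rule finite_subset[of _ "hom W W"]) (use W in \<open>auto simp: cc_Aut_def cc_isos_def\<close>)
    moreover have "cc_Aut A W \<noteq> {}"
      using cc_iso_refl[of W] W by (simp add: cc_Aut_def cc_iso_def)
    ultimately show ?thesis by (simp add: card_eq_0_iff)
  qed
  have "hall_coeff A x y z = hall_number A ?X ?Y ?Z" by (simp add: hall_coeff_def rep_def)
  then have "hall_coeff A x y z \<noteq> 0 \<longleftrightarrow> ses A ?X ?Y ?Z \<noteq> {}"
    using aut[OF F(1)] aut[OF F(2)] fin by (simp add: hall_number_def card_eq_0_iff)
  also have "\<dots> \<longleftrightarrow> (\<exists>\<phi> \<psi>. short_exact \<phi> \<psi> ?Y ?Z ?X)" by (auto simp: ses_eq)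
  finally show ?thesis .
qed

text \<open>Moves a middle term to the chosen representative of its class.\<close>

lemma short_exact_iso:
  assumes ex: "short_exact \<phi> \<psi> Y Z X" and iso: "cc_iso A Z Z'"
    and cc: "is_cc X" "is_cc Y" "is_cc Z" "is_cc Z'"
  shows "\<exists>\<phi>' \<psi>'. short_exact \<phi>' \<psi>' Y Z' X"
proof -
  have \<phi>: "\<phi> \<in> hom Y Z" "inj_on \<phi> (car Y)" "\<phi> ` car Y = {z \<in> car Z. \<psi> z = \<zero>\<^bsub>fst X\<^esub>}"
    and \<psi>: "\<psi> \<in> hom Z X" "\<psi> ` car Z = car X"
    using ex by (auto simp: short_exact_def)
  obtain u where u: "u \<in> cc_isos A Z Z'" using iso by (auto simp: cc_iso_def)
  obtain v where v: "v \<in> cc_isos A Z' Z" "\<forall>z\<in>car Z'. u (v z) = z" "\<forall>z\<in>car Z. v (u z) = z"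
    using isos_inverse[OF u cc(3,4)] by blast
  have uh: "u \<in> hom Z Z'" and vh: "v \<in> hom Z' Z" using u v by (auto simp: cc_isos_def)
  note [simp] = homD(1)[OF uh] homD(1)[OF vh] homD(1)[OF \<phi>(1)] homD(1)[OF \<psi>(1)]
  let ?\<phi> = "compose (car Y) u \<phi>" and ?\<psi> = "compose (car Z') \<psi> v"
  have "short_exact ?\<phi> ?\<psi> Y Z' X"
    unfolding short_exact_def
  proof (intro conjI)
    show "?\<phi> \<in> hom Y Z'" "?\<psi> \<in> hom Z' X"
      using \<phi>(1) \<psi>(1) uh vh cc by (auto intro: hom_compose)
    show "inj_on ?\<phi> (car Y)"
    proof (rule inj_onI)
      fix x y assume xy: "x \<in> car Y" "y \<in> car Y" "?\<phi> x = ?\<phi> y"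
      then have "v (u (\<phi> x)) = v (u (\<phi> y))" by (simp add: compose_eq)
      then have "\<phi> x = \<phi> y" using v(3) xy by simp
      then show "x = y" using \<phi>(2) xy by (simp add: inj_on_eq_iff)
    qed
    show "?\<phi> ` car Y = {z \<in> car Z'. ?\<psi> z = \<zero>\<^bsub>fst X\<^esub>}"
    proof (intro equalityI subsetI)
      fix z assume "z \<in> ?\<phi> ` car Y"
      then obtain y where y: "y \<in> car Y" "z = u (\<phi> y)" by (auto simp: compose_eq)
      have "\<phi> y \<in> {z \<in> car Z. \<psi> z = \<zero>\<^bsub>fst X\<^esub>}" using y \<phi>(3) by blast
      then show "z \<in> {z \<in> car Z'. ?\<psi> z = \<zero>\<^bsub>fst X\<^esub>}"
        using y v(3) by (simp add: compose_eq)
    next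
      fix z assume "z \<in> {z \<in> car Z'. ?\<psi> z = \<zero>\<^bsub>fst X\<^esub>}"
      then have z: "z \<in> car Z'" "\<psi> (v z) = \<zero>\<^bsub>fst X\<^esub>" by (auto simp: compose_eq)
      then have "v z \<in> \<phi> ` car Y" unfolding \<phi>(3) by simp
      then obtain y where y: "y \<in> car Y" "v z = \<phi> y" by blast
      then have "z = u (\<phi> y)" using v(2) z by metis
      then show "z \<in> ?\<phi> ` car Y" using y by (intro image_eqI[of _ _ y]) (auto simp: compose_eq)
    qed
    show "?\<psi> ` car Z' = car X"
    proof (intro equalityI subsetI)
      fix x assume "x \<in> car X"
      then obtain z where z: "z \<in> car Z" "x = \<psi> z" using \<psi>(2) by blast
      then have "x = ?\<psi> (u z)" using v(3) by (simp add: compose_eq)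
      then show "x \<in> ?\<psi> ` car Z'" using z by (intro image_eqI[of _ _ "u z"]) auto
    qed (auto simp: compose_eq)
  qed
  then show ?thesis by blast
qed

lemma exact_card_le:
  assumes ex: "short_exact \<phi> \<psi> Y Z X" and cc: "fin_cc T" "fin_cc X" "fin_cc Y" "fin_cc Z"
  shows "card (hom T Z) \<le> card (hom T X) * card (hom T Y)"
    and "card (hom Z T) \<le> card (hom X T) * card (hom Y T)"
  using card_hom_exact_right_le(1)[OF assms] card_hom_exact_left_le[OF assms]
  by (simp_all add: mult.commute)

text \<open>|End Z| is at most |Hom(X, Z)| |Hom(Y, Z)|, which is at most the product of the four Hom
  counts between X and Y. Equality, after cancelling the positive factors of Y, gives |Hom(X, Z)| =
  |Hom(X, Y)| |Hom(X, X)|; so the identity of X lifts.\<close>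

lemma exact_end_eq_split:
  assumes ex: "short_exact \<phi> \<psi> Y Z X" and cc: "fin_cc X" "fin_cc Y" "fin_cc Z"
    and eq: "card (hom Z Z) = card (hom (cc_sum X Y) (cc_sum X Y))"
  shows "cc_iso A (cc_sum X Y) Z"
proof -
  have "card (hom (cc_sum X Y) (cc_sum X Y)) =
      (card (hom X Y) * card (hom X X)) * (card (hom Y X) * card (hom Y Y))"
    using cc by (simp add: card_hom_sum_left card_hom_sum_right)
  moreover have "card (hom Z Z) \<le> card (hom X Z) * card (hom Y Z)"
    using ex cc by (intro exact_card_le)
  moreover have YZ: "card (hom Y Z) \<le> card (hom Y X) * card (hom Y Y)"
    using ex cc by (intro exact_card_le)
  moreover have XZ: "card (hom X Z) \<le> card (hom X Y) * card (hom X X)"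
    using exact_card_le(1)[OF ex cc(1) cc] by (simp add: mult.commute)
  moreover have "0 < card (hom Y X) * card (hom Y Y)" using cc by (simp add: card_hom_pos)
  ultimately have "(card (hom X Y) * card (hom X X)) * (card (hom Y X) * card (hom Y Y)) \<le>
      card (hom X Z) * (card (hom Y X) * card (hom Y Y))" and "0 < card (hom Y X) * card (hom Y Y)"
    using eq mult_le_mono2[OF YZ, of "card (hom X Z)"] by linarith+
  then have "card (hom X Z) = card (hom X Y) * card (hom X X)"
    using XZ unfolding mult_le_cancel2 by linarith
  then have "compose (car X) \<psi> ` hom X Z = hom X X"
    using card_hom_exact_right_le(2)[OF ex cc(1) cc] by simp
  then have "idh X \<in> compose (car X) \<psi> ` hom X Z" using hom_id[of X] cc by simp
  then obtain \<sigma> where \<sigma>: "\<sigma> \<in> hom X Z" "idh X = compose (car X) \<psi> \<sigma>" by blast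
  have "\<psi> (\<sigma> x) = x" if "x \<in> car X" for x
    using fun_cong[OF \<sigma>(2), of x] that by (simp add: compose_eq)
  from split_exact_iso[OF ex \<sigma>(1) this] show ?thesis using cc by (auto simp: cc_iso_def)
qed

text \<open>The section supplied by projectivity is linear but need not commute with the
  differentials; hence the conclusion is about the complexes with zero differential.\<close>

lemma exact_module_split:
  assumes ex: "short_exact \<phi> \<psi> Y Z X" and C: "X \<in> C" "Y \<in> C" "Z \<in> C"
  shows "\<exists>u. u \<in> cc_isos A (cc_sum (triv (fst X)) (triv (fst Y))) (triv (fst Z))"
proof -
  have l: "left_module A (fst X)" "left_module A (fst Y)" "left_module A (fst Z)"
    using C by (auto intro: is_cc_left_module)
  have \<phi>: "\<phi> \<in> hom Y Z" and \<psi>: "\<psi> \<in> hom Z X" "\<psi> ` car Z = car X"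
    using ex by (auto simp: short_exact_def)
  have ex': "short_exact \<phi> \<psi> (triv (fst Y)) (triv (fst Z)) (triv (fst X))"
    using ex l unfolding short_exact_def by (auto simp: hom_triv intro: cc_hom_mod_hom)
  have id: "idh X \<in> mod_hom A (fst X) (fst X)"
    using hom_id[of X] C by (auto intro: cc_hom_mod_hom)
  have P: "projective K A (fst X)" using C(1) unfolding C_iff by blast
  have fin: "finite (car Z)" "finite (car X)" using C by auto
  obtain \<sigma> where \<sigma>: "\<sigma> \<in> mod_hom A (fst X) (fst Z)" "\<forall>x\<in>car X. \<psi> (\<sigma> x) = idh X x"
    using projective_lift[OF P l(3) fin(1) l(1) fin(2) cc_hom_mod_hom[OF \<psi>(1)] \<psi>(2) id] by blast
  have "\<sigma> \<in> hom (triv (fst X)) (triv (fst Z))" using \<sigma>(1) l by (simp add: hom_triv)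
  from split_exact_iso[OF ex' this] show ?thesis
    using \<sigma>(2) l by (intro exI) auto
qed

text \<open>
  As X is projective, the module underlying an extension of X by Y is a direct sum, so the extension
  is determined up to isomorphism by a differential on the finite set underlying that sum.
\<close>

lemma finite_extensions:
  assumes xy: "x \<in> iclasses" "y \<in> iclasses"
  shows "finite {z \<in> iclasses. hall_coeff A x y z \<noteq> 0}" (is "finite ?E")
proof -
  let ?P = "cc_sum (triv (fst (rep x))) (triv (fst (rep y)))"
  have l: "left_module A (fst (rep x))" "left_module A (fst (rep y))"
    using xy by (auto intro: is_cc_left_module)
  then have P: "is_cc ?P" by simp
  have "\<exists>u. u \<in> cc_isos A ?P (triv (fst (rep z)))" if "z \<in> ?E" for z
  proof -
    from that obtain \<phi> \<psi> where ex: "short_exact \<phi> \<psi> (rep y) (rep z) (rep x)"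
      using hall_coeff_nonzero[OF xy, of z] by blast
    show ?thesis using that xy by (intro exact_module_split[OF ex]) auto
  qed
  then have "\<forall>z\<in>?E. \<exists>u. u \<in> cc_isos A ?P (triv (fst (rep z)))" by blast
  from bchoice[OF this] obtain u where u: "\<And>z. z \<in> ?E \<Longrightarrow> u z \<in> cc_isos A ?P (triv (fst (rep z)))"
    by blast
  have "\<exists>v. v \<in> cc_isos A (triv (fst (rep z))) ?P \<and> (\<forall>w\<in>car (rep z). u z (v w) = w) \<and>
      (\<forall>p\<in>car ?P. v (u z p) = p)" if z: "z \<in> ?E" for z
  proof -
    have "is_cc (triv (fst (rep z)))"
      by (rule is_cc_triv[OF is_cc_left_module[OF C_is_cc[OF rep_C]]]) (use z in simp)
    from isos_inverse[OF u[OF z] P this] show ?thesis unfolding fst_triv by blast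
  qed
  then have "\<forall>z\<in>?E. \<exists>v. v \<in> cc_isos A (triv (fst (rep z))) ?P \<and>
      (\<forall>w\<in>car (rep z). u z (v w) = w) \<and> (\<forall>p\<in>car ?P. v (u z p) = p)" by blast
  from bchoice[OF this] obtain v where v': "\<forall>z\<in>?E. v z \<in> cc_isos A (triv (fst (rep z))) ?P \<and>
      (\<forall>w\<in>car (rep z). u z (v z w) = w) \<and> (\<forall>p\<in>car ?P. v z (u z p) = p)" by blast
  have v: "v z \<in> cc_isos A (triv (fst (rep z))) ?P"
      "w \<in> car (rep z) \<Longrightarrow> u z (v z w) = w" "p \<in> car ?P \<Longrightarrow> v z (u z p) = p"
    if "z \<in> ?E" for z w p
    using bspec[OF v' that] by blast+
  define \<delta> where "\<delta> z = (\<lambda>p\<in>car ?P. v z (snd (rep z) (u z p)))" for z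
  have uh: "u z \<in> hom ?P (triv (fst (rep z)))" and vh: "v z \<in> hom (triv (fst (rep z))) ?P"
    if "z \<in> ?E" for z using u[OF that] v(1)[OF that] by (auto simp: cc_isos_def)
  have uc: "u z p \<in> car (rep z)" if "z \<in> ?E" "p \<in> car ?P" for z p
    using homD(1)[OF uh[OF that(1)] that(2)] by simp
  have vc: "v z w \<in> car ?P" if "z \<in> ?E" "w \<in> car (rep z)" for z w
    using homD(1)[OF vh[OF that(1)], of w] that(2) by simp
  have dc: "snd (rep z) w \<in> car (rep z)" if "z \<in> ?E" "w \<in> car (rep z)" for z w
    using that by simp
  have "inj_on \<delta> ?E"
  proof (rule inj_onI)
    fix z z' assume z: "z \<in> ?E" and z': "z' \<in> ?E" and eq: "\<delta> z = \<delta> z'"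
    \<comment> \<open>When the transported differentials coincide, passing from z to the common
      module and on to z' is an isomorphism of complexes, not only of modules.\<close>
    have "cc_iso A (rep z) (rep z')"
    proof (rule isoI[where f = "\<lambda>w. u z' (v z w)"])
      show "is_cc (rep z)" using z by simp
      show "bij_betw (\<lambda>w. u z' (v z w)) (car (rep z)) (car (rep z'))"
      proof (rule bij_betw_byWitness[where f' = "\<lambda>w. u z (v z' w)"])
        show "\<forall>w\<in>car (rep z). u z (v z' (u z' (v z w))) = w"
          using v(2,3)[OF z] v(3)[OF z'] vc[OF z] by simp
        show "\<forall>w\<in>car (rep z'). u z' (v z (u z (v z' w))) = w"
          using v(2)[OF z'] v(3)[OF z] vc[OF z'] by simp
      qed (use uc[OF z] uc[OF z'] vc[OF z] vc[OF z'] in blast)+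
    next
      fix w assume w: "w \<in> car (rep z)"
      have "\<delta> z (v z w) = \<delta> z' (v z w)" using eq by simp
      then have "v z (snd (rep z) w) = v z' (snd (rep z') (u z' (v z w)))"
        using vc[OF z w] v(2)[OF z w] by (simp add: \<delta>_def)
      then have "u z' (v z (snd (rep z) w)) = u z' (v z' (snd (rep z') (u z' (v z w))))" by simp
      also have "\<dots> = snd (rep z') (u z' (v z w))"
        by (rule v(2)[OF z' dc[OF z' uc[OF z' vc[OF z w]]]])
      finally show "snd (rep z') (u z' (v z w)) = u z' (v z (snd (rep z) w))" by simp
    next
      fix w w' assume w: "w \<in> car (rep z)" "w' \<in> car (rep z)"
      show "u z' (v z (w \<oplus>\<^bsub>fst (rep z)\<^esub> w')) = u z' (v z w) \<oplus>\<^bsub>fst (rep z')\<^esub> u z' (v z w')"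
        using homD(2)[OF vh[OF z], of w w'] homD(2)[OF uh[OF z'], of "v z w" "v z w'"] w vc[OF z] by simp
    next
      fix a w assume w: "a \<in> carrier A" "w \<in> car (rep z)"
      show "u z' (v z (a \<odot>\<^bsub>fst (rep z)\<^esub> w)) = a \<odot>\<^bsub>fst (rep z')\<^esub> u z' (v z w)"
        using homD(3)[OF vh[OF z], of a w] homD(3)[OF uh[OF z'], of a "v z w"] w vc[OF z] by simp
    qed
    then show "z = z'" using z z' by (intro class_eqI) auto
  qed
  moreover have "\<delta> ` ?E \<subseteq> car ?P \<rightarrow>\<^sub>E car ?P"
  proof
    fix f assume "f \<in> \<delta> ` ?E"
    then obtain z where z: "z \<in> ?E" "f = \<delta> z" by blast
    have "v z (snd (rep z) (u z p)) \<in> car ?P" if "p \<in> car ?P" for p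
      by (rule vc[OF z(1) dc[OF z(1) uc[OF z(1) that]]])
    then show "f \<in> car ?P \<rightarrow>\<^sub>E car ?P"
      unfolding z(2) \<delta>_def by (simp only: restrict_PiE_iff) blast
  qed
  moreover have "finite (car ?P \<rightarrow>\<^sub>E car ?P)"
    using xy by (intro finite_PiE) auto
  ultimately show ?thesis
    by (intro finite_imageD[of \<delta> ?E] finite_subset[of "\<delta> ` ?E" "car ?P \<rightarrow>\<^sub>E car ?P"])
qed

subsection \<open>The Hall algebra of the category\<close>

lemma zero_iso: "cc_is_zero X \<Longrightarrow> is_cc X \<Longrightarrow> cc_iso A X zero_complex"
  using zero_complex by (intro isoI[where f = "\<lambda>_. 0"])
    (auto simp: cc_is_zero_def zero_complex_def bij_betw_def)

lemma indec_iso: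
  assumes X: "indec X" and Y: "Y \<in> C" and iso: "cc_iso A X Y"
  shows "indec Y"
proof -
  note cX = C_is_cc[OF indecD(1)[OF X]] and cY = C_is_cc[OF Y]
  have "\<not> cc_is_zero Y"
  proof
    assume "cc_is_zero Y"
    moreover obtain f where f: "f \<in> hom X Y" "inj_on f (car X)"
      using iso by (auto simp: cc_iso_def cc_isos_def bij_betw_def)
    ultimately have "x = \<zero>\<^bsub>fst X\<^esub>" if "x \<in> car X" for x
      using that homD(1)[OF f(1)] cX by (auto simp: cc_is_zero_def intro: inj_onD[OF f(2)])
    then have "car X = {\<zero>\<^bsub>fst X\<^esub>}" using cc_ops(1)[OF cX] by blast
    then show False using indecD(2)[OF X] by (simp add: cc_is_zero_def)
  qed
  moreover have "cc_iso A X (cc_sum V W)" if "cc_iso A Y (cc_sum V W)" for V W :: "('a, nat) cyclic_complex"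
    using cc_iso_trans[OF iso that cX] .
  ultimately show ?thesis using X Y unfolding cc_indecomposable_def by blast
qed

definition indec_classes where "indec_classes = cls ` {X. indec X}"

lemma indec_rep: "d \<in> indec_classes \<Longrightarrow> indec (rep d)"
proof -
  assume "d \<in> indec_classes"
  then obtain X where X: "indec X" "d = cls X" by (auto simp: indec_classes_def)
  then have "cc_iso A X (rep d)"
    using rep_cls[OF indecD(1)[OF X(1)]] indecD(1)[OF X(1)] by (simp add: cc_iso_sym)
  then show "indec (rep d)" using X indecD(1)[OF X(1)] by (intro indec_iso[OF X(1)]) auto
qed

lemma indec_classes_subset: "indec_classes \<subseteq> iclasses"
  using indecD(1) by (auto simp: indec_classes_def)

text \<open>If X is the direct sum of Y and Z, then |X| = |Y| |Z|; with both factors above 1, each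
  summand is smaller than X.\<close>

lemma card_gt_1:
  assumes "fin_cc X" "\<not> cc_is_zero X"
  shows "1 < card (car X)"
proof -
  have "\<zero>\<^bsub>fst X\<^esub> \<in> car X" using assms by simp
  then show ?thesis
    using assms card_1_singletonE[of "car X"] card_gt_0_iff[of "car X"]
    by (metis One_nat_def cc_is_zero_def empty_iff fin_ccD(2) nat_neq_iff less_one singletonD)
qed

section \<open>Numerical invariants of isoclasses\<close>

definition hom_card where "hom_card x y = card (hom (rep x) (rep y))"
text \<open>For indecomposable d the quotient of Hom by its radical part is a vector space over the
  residue field of the endomorphism ring, of dimension the multiplicity of d in x. The value is the
  size of that space.\<close>

definition multiplicity where
  "multiplicity d x = real (card (hom (rep d) (rep x))) / real (card (rad (rep d) (rep x)))"

lemma hom_card_mult: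
  assumes "x \<in> iclasses" "y \<in> iclasses" "t \<in> iclasses"
  shows "hom_card (cls (nsum (rep x) (rep y))) t = hom_card x t * hom_card y t"
    and "hom_card t (cls (nsum (rep x) (rep y))) = hom_card t x * hom_card t y"
proof -
  have z: "cls (nsum (rep x) (rep y)) \<in> iclasses" using assms by (simp add: nsum)
  show "hom_card (cls (nsum (rep x) (rep y))) t = hom_card x t * hom_card y t"
    unfolding hom_card_def using assms z
    by (subst card_iso_left[OF rep_mult]) (auto simp: card_hom_sum_left)
  show "hom_card t (cls (nsum (rep x) (rep y))) = hom_card t x * hom_card t y"
    unfolding hom_card_def using assms z
    by (subst card_iso_right(1)[OF rep_mult]) (auto simp: card_hom_sum_right)
qed

lemma multiplicity_mult:
  assumes "d \<in> indec_classes" "x \<in> iclasses" "y \<in> iclasses"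
  shows "multiplicity d (cls (nsum (rep x) (rep y))) = multiplicity d x * multiplicity d y"
proof -
  have d: "d \<in> iclasses" using assms(1) indec_classes_subset by blast
  have z: "cls (nsum (rep x) (rep y)) \<in> iclasses" using assms by (simp add: nsum)
  have "card (rad (rep d) (rep (cls (nsum (rep x) (rep y))))) =
      card (rad (rep d) (cc_sum (rep x) (rep y)))"
    using d assms z by (intro card_iso_right(2)[OF rep_mult]) auto
  also have "\<dots> = card (rad (rep d) (rep x)) * card (rad (rep d) (rep y))"
    using assms indec_rep by (intro card_rad_sum) auto
  finally show ?thesis
    using hom_card_mult(2)[OF assms(2,3) d] by (simp add: multiplicity_def hom_card_def)
qed

lemma multiplicity_pos: "d \<in> indec_classes \<Longrightarrow> x \<in> iclasses \<Longrightarrow> 0 < multiplicity d x"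
  using card_rad_pos[OF indec_rep, of d "rep x"] card_hom_pos[of "rep d" "rep x"] indec_classes_subset
  by (auto simp: multiplicity_def)

sublocale hall: hall_data class_monoid "hall_coeff A" hom_card indec_classes
  "\<lambda>x. card (car (rep x))" multiplicity
proof (rule hall_data.intro[OF comm_monoid_classes], rule hall_data_axioms.intro, unfold class_monoid_simps)
  show "indec_classes \<subseteq> iclasses" by (rule indec_classes_subset)
next
  fix x y assume "x \<in> iclasses" "y \<in> iclasses"
  then show "0 < hom_card x y" by (simp add: hom_card_def card_hom_pos)
next
  fix x y t assume "x \<in> iclasses" "y \<in> iclasses" "t \<in> iclasses"
  then show "hom_card (cls (nsum (rep x) (rep y))) t = hom_card x t * hom_card y t"
    "hom_card t (cls (nsum (rep x) (rep y))) = hom_card t x * hom_card t y"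
    by (rule hom_card_mult)+
next
  fix x y z t assume c: "x \<in> iclasses" "y \<in> iclasses" "z \<in> iclasses" "t \<in> iclasses"
    and F: "hall_coeff A x y z \<noteq> 0"
  from F obtain \<phi> \<psi> where ex: "short_exact \<phi> \<psi> (rep y) (rep z) (rep x)"
    using hall_coeff_nonzero c by blast
  show "hom_card t z \<le> hom_card t (cls (nsum (rep x) (rep y)))"
    using exact_card_le(1)[OF ex, of "rep t"] c by (simp add: hom_card_mult) (simp add: hom_card_def)
  show "hom_card z t \<le> hom_card (cls (nsum (rep x) (rep y))) t"
    using exact_card_le(2)[OF ex, of "rep t"] c by (simp add: hom_card_mult) (simp add: hom_card_def)
next
  fix x y z assume c: "x \<in> iclasses" "y \<in> iclasses" "z \<in> iclasses"
    and F: "hall_coeff A x y z \<noteq> 0"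
    and eq: "hom_card z z = hom_card (cls (nsum (rep x) (rep y))) (cls (nsum (rep x) (rep y)))"
  from F obtain \<phi> \<psi> where ex: "short_exact \<phi> \<psi> (rep y) (rep z) (rep x)"
    using hall_coeff_nonzero c by blast
  have s: "cls (nsum (rep x) (rep y)) \<in> iclasses" using c by (simp add: nsum)
  \<comment> \<open>The endomorphism counts of the class and of the direct sum on pairs expand into
    the same four factors.\<close>
  have "card (hom (rep z) (rep z)) = card (hom (cc_sum (rep x) (rep y)) (cc_sum (rep x) (rep y)))"
    using eq c s by (simp add: hom_card_mult)
      (simp add: hom_card_def card_hom_sum_left card_hom_sum_right)
  then have "cc_iso A (cc_sum (rep x) (rep y)) (rep z)"
    using c by (intro exact_end_eq_split[OF ex]) auto
  then show "z = cls (nsum (rep x) (rep y))" using c by (intro mult_eqI)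
next
  fix x y assume c: "x \<in> iclasses" "y \<in> iclasses"
  then have s: "cls (nsum (rep x) (rep y)) \<in> iclasses" by (simp add: nsum)
  have "cc_iso A (cc_sum (rep x) (rep y)) (rep (cls (nsum (rep x) (rep y))))"
    using c s by (intro cc_iso_sym[OF rep_mult]) auto
  from short_exact_iso[OF short_exact_sum this]
  show "hall_coeff A x y (cls (nsum (rep x) (rep y))) \<noteq> 0"
    using c s by (simp add: hall_coeff_nonzero)
next
  fix x y assume "x \<in> iclasses" "y \<in> iclasses"
  then show "finite {z \<in> iclasses. hall_coeff A x y z \<noteq> 0}" by (rule finite_extensions)
next
  fix x assume x: "x \<in> iclasses" "x \<noteq> cls zero_complex" "x \<notin> indec_classes"
  have "\<not> cc_is_zero (rep x)"
  proof
    assume "cc_is_zero (rep x)"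
    then have "cls (rep x) = cls zero_complex"
      using x zero_iso[of "rep x"] zero_complex by (simp add: cls_eq_iff del: cls_rep)
    then show False using x by simp
  qed
  moreover have "\<not> indec (rep x)"
  proof
    assume "indec (rep x)"
    then have "cls (rep x) \<in> indec_classes" by (simp add: indec_classes_def)
    then show False using x by simp
  qed
  ultimately obtain Y Z where YZ: "Y \<in> C" "Z \<in> C" "cc_iso A (rep x) (cc_sum Y Z)"
    "\<not> cc_is_zero Y" "\<not> cc_is_zero Z"
    using x rep_C[of x] unfolding cc_indecomposable_def by blast
  have iso_card: "card (car V) = card (car W)" if "cc_iso A V W"
    for V :: "('a, 'p) cyclic_complex" and W :: "('a, 'q) cyclic_complex"
    using that by (auto simp: cc_iso_def cc_isos_def intro: bij_betw_same_card)
  have c: "card (car (rep x)) = card (car Y) * card (car Z)"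
    using iso_card[OF YZ(3)] by (simp add: card_cartesian_product)
  have r: "card (car (rep (cls Y))) = card (car Y)" "card (car (rep (cls Z))) = card (car Z)"
    using iso_card[OF rep_cls[OF YZ(1)]] iso_card[OF rep_cls[OF YZ(2)]] by auto
  have "cc_iso A (cc_sum (rep (cls Y)) (rep (cls Z))) (rep x)"
  proof -
    have "cc_iso A (cc_sum (rep (cls Y)) (rep (cls Z))) (cc_sum Y Z)"
      using YZ by (intro cc_sum_cong rep_cls) auto
    moreover have "cc_iso A (cc_sum Y Z) (rep x)"
      by (rule cc_iso_sym[OF YZ(3)]) (use YZ x in auto)
    ultimately show ?thesis by (rule cc_iso_trans) (use YZ in auto)
  qed
  then have "x = cls (nsum (rep (cls Y)) (rep (cls Z)))"
    using x YZ by (intro mult_eqI) auto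
  then show "\<exists>y\<in>iclasses. \<exists>z\<in>iclasses. x = cls (nsum (rep y) (rep z)) \<and>
      card (car (rep y)) < card (car (rep x)) \<and> card (car (rep z)) < card (car (rep x))"
    using YZ c r card_gt_1[of Y] card_gt_1[of Z] by (intro bexI[of _ "cls Y"] bexI[of _ "cls Z"]) auto
next
  fix d assume d: "d \<in> indec_classes"
  have "\<one>\<^bsub>class_monoid\<^esub> = \<one>\<^bsub>class_monoid\<^esub> \<otimes>\<^bsub>class_monoid\<^esub> \<one>\<^bsub>class_monoid\<^esub>"
    using monoid.l_one[OF comm_monoid.axioms(1)[OF comm_monoid_classes], of "\<one>\<^bsub>class_monoid\<^esub>"] zero_complex by simp
  \<comment> \<open>The zero class is idempotent under direct sum, so its multiplicity is a positive
    real equal to its square.\<close>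
  then have "multiplicity d (cls zero_complex) =
      multiplicity d (cls zero_complex) * multiplicity d (cls zero_complex)"
    using multiplicity_mult[OF d, of "cls zero_complex" "cls zero_complex"] zero_complex by simp
  then show "multiplicity d (cls zero_complex) = 1"
    using multiplicity_pos[OF d, of "cls zero_complex"] zero_complex by simp
next
  fix d x y assume "d \<in> indec_classes" "x \<in> iclasses" "y \<in> iclasses"
  then show "multiplicity d (cls (nsum (rep x) (rep y))) = multiplicity d x * multiplicity d y"
    by (rule multiplicity_mult)
next
  fix d e assume d: "d \<in> indec_classes" and e: "e \<in> indec_classes" and ne: "d \<noteq> e"
  have "\<not> cc_iso A (rep d) (rep e)"
    using class_eqI[of d e] indec_classes_subset d e ne by blast
  then have "rad (rep d) (rep e) = hom (rep d) (rep e)"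
    using d e by (intro rad_other indec_rep)
  moreover have "0 < card (hom (rep d) (rep e))"
    using d e indec_classes_subset by (intro card_hom_pos) auto
  ultimately show "multiplicity d e = 1" by (simp add: multiplicity_def)
next
  fix d assume d: "d \<in> indec_classes"
  have "0 < card (rad (rep d) (rep d))"
    using d indec_classes_subset by (intro card_rad_pos indec_rep) auto
  then show "1 < multiplicity d d"
    using rad_self[OF indec_rep[OF d]] by (simp add: multiplicity_def)
qed

theorem hall_algebra_PBW: "universal_PBW_basis (hall_algebra K A) (indecomposables K A)"
proof -
  have "hall_algebra K A = hall_ring class_monoid (hall_coeff A)"
    by (simp add: hall_algebra_def hall_ring_def hall_mult_def)
  moreover have "indecomposables K A = hall.gens"
    unfolding indecomposables_def hall.gens_def by (auto simp: indec_classes_def)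
  ultimately show ?thesis using hall.PBW by simp
qed

end

section \<open>Ring structure of the path algebra\<close>

text \<open>Flattens the double sums that arise from factorising a path twice.\<close>

lemma (in abelian_monoid) finsum_Sigma:
  assumes "finite S" "\<And>x. x \<in> S \<Longrightarrow> finite (B x)"
    and f: "\<And>x y. x \<in> S \<Longrightarrow> y \<in> B x \<Longrightarrow> f x y \<in> carrier G"
  shows "(\<Oplus>x\<in>S. \<Oplus>y\<in>B x. f x y) = (\<Oplus>p\<in>Sigma S B. f (fst p) (snd p))"
  using assms
proof (induction S rule: finite_induct)
  case (insert a S)
  have Sig: "Sigma (insert a S) B = Pair a ` B a \<union> Sigma S B" by auto
  have "(\<Oplus>p\<in>Sigma (insert a S) B. f (fst p) (snd p)) =
      (\<Oplus>p\<in>Pair a ` B a. f (fst p) (snd p)) \<oplus> (\<Oplus>p\<in>Sigma S B. f (fst p) (snd p))"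
    unfolding Sig using insert by (intro finsum_Un_disjoint) auto
  also have "(\<Oplus>p\<in>Pair a ` B a. f (fst p) (snd p)) = (\<Oplus>y\<in>B a. f a y)"
    using insert.prems by (subst finsum_reindex) (auto simp: inj_on_def)
  also have "(\<Oplus>p\<in>Sigma S B. f (fst p) (snd p)) = (\<Oplus>x\<in>S. \<Oplus>y\<in>B x. f x y)"
    using insert by simp
  finally show ?case using insert by (simp add: Pi_def)
qed simp

locale finite_quiver = K: field K + fin_digraph Q
  for K :: "('k, 'x) ring_scheme" (structure) and Q :: "('v, 'e) pre_digraph"
begin

abbreviation PA where "PA \<equiv> path_algebra K Q"

definition splits :: "'v \<Rightarrow> 'e list \<Rightarrow> 'v \<Rightarrow> ('e list \<times> 'v \<times> 'e list) set" where
  "splits u r w = {(p, v, q). awalk u p v \<and> awalk v q w \<and> p @ q = r}"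

lemma qpaths_iff [simp]: "(u, p, v) \<in> qpaths Q \<longleftrightarrow> awalk u p v"
  by (simp add: qpaths_def)

text \<open>A factorisation is determined by the length of its first part, whose end point is the
  midpoint.\<close>

lemma finite_splits [simp]: "finite (splits u r w)"
proof -
  have "splits u r w \<subseteq> (\<lambda>i. (take i r, awlast u (take i r), drop i r)) ` {..length r}"
  proof
    fix s assume "s \<in> splits u r w"
    then obtain p v q where s: "s = (p, v, q)" "awalk u p v" "p @ q = r" by (auto simp: splits_def)
    then have "take (length p) r = p" "drop (length p) r = q" "awlast u p = v" "length p \<le> length r"
      by auto
    then show "s \<in> (\<lambda>i. (take i r, awlast u (take i r), drop i r)) ` {..length r}"
      using s by (intro image_eqI[of _ _ "length p"]) auto
  qed
  then show ?thesis by (rule finite_subset) auto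
qed

lemma splits_nonempty: "(p, v, q) \<in> splits u r w \<Longrightarrow> awalk u r w"
  by (auto simp: splits_def)

lemma PA_simps:
  "\<zero>\<^bsub>PA\<^esub> = (\<lambda>_. \<zero>)"
  "f \<oplus>\<^bsub>PA\<^esub> g = (\<lambda>r. f r \<oplus> g r)"
  "c \<odot>\<^bsub>PA\<^esub> f = (\<lambda>r. c \<otimes> f r)"
  "\<one>\<^bsub>PA\<^esub> (u, r, w) = (if awalk u r w \<and> r = [] then \<one> else \<zero>)"
  "(f \<otimes>\<^bsub>PA\<^esub> g) (u, r, w) = (\<Oplus>s\<in>splits u r w. f (fst (snd s), snd (snd s), w) \<otimes> g (u, fst s, fst (snd s)))"
  by (simp_all add: path_algebra_def splits_def case_prod_beta')

lemma PA_carrier: "f \<in> carrier PA \<longleftrightarrow>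
    (\<forall>r. f r \<in> carrier K) \<and> (\<forall>u p v. \<not> awalk u p v \<longrightarrow> f (u, p, v) = \<zero>) \<and> finite {r. f r \<noteq> \<zero>}"
  by (auto simp: path_algebra_def)

lemma PA_carrierD:
  assumes "f \<in> carrier PA"
  shows "f r \<in> carrier K" "\<not> awalk u p v \<Longrightarrow> f (u, p, v) = \<zero>" "finite {r. f r \<noteq> \<zero>}"
  using assms unfolding PA_carrier by blast+

lemmas PA_closed [simp] = PA_carrierD(1)

text \<open>The support of a product consists of composites of paths taken from two finite
  supports.\<close>

lemma PA_mult_closed:
  assumes f: "f \<in> carrier PA" and g: "g \<in> carrier PA"
  shows "f \<otimes>\<^bsub>PA\<^esub> g \<in> carrier PA"
  unfolding PA_carrier
proof (intro conjI allI impI)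
  fix r :: "('v, 'e) qpath"
  obtain u p w where "r = (u, p, w)" by (cases r)
  then show "(f \<otimes>\<^bsub>PA\<^esub> g) r \<in> carrier K"
    using f g by (auto simp: PA_simps intro!: K.finsum_closed)
next
  fix u r w assume "\<not> awalk u r w"
  then have "splits u r w = {}" using splits_nonempty by fast
  then show "(f \<otimes>\<^bsub>PA\<^esub> g) (u, r, w) = \<zero>" by (simp add: PA_simps)
next
  let ?c = "\<lambda>(x, y). (fst y, fst (snd y) @ fst (snd x), snd (snd x))"
  have "{r. (f \<otimes>\<^bsub>PA\<^esub> g) r \<noteq> \<zero>} \<subseteq> ?c ` ({r. f r \<noteq> \<zero>} \<times> {r. g r \<noteq> \<zero>})"
  proof
    fix x assume x: "x \<in> {r. (f \<otimes>\<^bsub>PA\<^esub> g) r \<noteq> \<zero>}"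
    obtain u r w where urw: "x = (u, r, w)" by (cases x)
    have "\<exists>s\<in>splits u r w. f (fst (snd s), snd (snd s), w) \<otimes> g (u, fst s, fst (snd s)) \<noteq> \<zero>"
    proof (rule ccontr)
      assume "\<not> ?thesis"
      then have "(f \<otimes>\<^bsub>PA\<^esub> g) (u, r, w) = \<zero>"
        unfolding PA_simps by (intro K.add.finprod_one_eqI) auto
      then show False using x urw by simp
    qed
    then obtain p v q where s: "(p, v, q) \<in> splits u r w" "f (v, q, w) \<otimes> g (u, p, v) \<noteq> \<zero>"
      by auto
    then have "f (v, q, w) \<noteq> \<zero>" "g (u, p, v) \<noteq> \<zero>" using f g by auto
    then show "x \<in> ?c ` ({r. f r \<noteq> \<zero>} \<times> {r. g r \<noteq> \<zero>})"
      using s urw by (intro image_eqI[of _ _ "((v, q, w), (u, p, v))"]) (auto simp: splits_def)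
  qed
  moreover have "finite ({r. f r \<noteq> \<zero>} \<times> {r. g r \<noteq> \<zero>})"
    using PA_carrierD(3)[OF f] PA_carrierD(3)[OF g] by simp
  ultimately show "finite {r. (f \<otimes>\<^bsub>PA\<^esub> g) r \<noteq> \<zero>}" by (blast intro: finite_subset)
qed

text \<open>Both bracketings are sums over the factorisations of the path into three consecutive
  parts.\<close>

lemma PA_mult_assoc:
  assumes f: "f \<in> carrier PA" and g: "g \<in> carrier PA" and h: "h \<in> carrier PA"
  shows "f \<otimes>\<^bsub>PA\<^esub> g \<otimes>\<^bsub>PA\<^esub> h = f \<otimes>\<^bsub>PA\<^esub> (g \<otimes>\<^bsub>PA\<^esub> h)"
proof (rule ext)
  fix x :: "('v, 'e) qpath"
  obtain u r w where x: "x = (u, r, w)" by (cases x)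
  define T where "T = {(p\<^sub>1, v\<^sub>1, p\<^sub>2, v\<^sub>2, p\<^sub>3).
    awalk u p\<^sub>1 v\<^sub>1 \<and> awalk v\<^sub>1 p\<^sub>2 v\<^sub>2 \<and> awalk v\<^sub>2 p\<^sub>3 w \<and> p\<^sub>1 @ p\<^sub>2 @ p\<^sub>3 = r}"
  let ?F = "\<lambda>(p\<^sub>1, v\<^sub>1, p\<^sub>2, v\<^sub>2, p\<^sub>3). f (v\<^sub>2, p\<^sub>3, w) \<otimes> g (v\<^sub>1, p\<^sub>2, v\<^sub>2) \<otimes> h (u, p\<^sub>1, v\<^sub>1)"
  note [simp] = PA_closed[OF f] PA_closed[OF g] PA_closed[OF h]
  have "(f \<otimes>\<^bsub>PA\<^esub> g \<otimes>\<^bsub>PA\<^esub> h) x = (\<Oplus>s\<in>splits u r w.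
      (\<Oplus>t\<in>splits (fst (snd s)) (snd (snd s)) w. f (fst (snd t), snd (snd t), w) \<otimes>
        g (fst (snd s), fst t, fst (snd t))) \<otimes> h (u, fst s, fst (snd s)))"
    by (simp add: x PA_simps)
  also have "\<dots> = (\<Oplus>s\<in>splits u r w. \<Oplus>t\<in>splits (fst (snd s)) (snd (snd s)) w.
      f (fst (snd t), snd (snd t), w) \<otimes> g (fst (snd s), fst t, fst (snd t)) \<otimes> h (u, fst s, fst (snd s)))"
    by (intro K.finsum_cong') (auto simp: K.finsum_ldistr intro!: K.finsum_closed)
  also have "\<dots> = (\<Oplus>p\<in>(SIGMA s:splits u r w. splits (fst (snd s)) (snd (snd s)) w).
      f (fst (snd (snd p)), snd (snd (snd p)), w) \<otimes> g (fst (snd (fst p)), fst (snd p), fst (snd (snd p)))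
        \<otimes> h (u, fst (fst p), fst (snd (fst p))))"
    by (subst K.finsum_Sigma) auto
  also have "(SIGMA s:splits u r w. splits (fst (snd s)) (snd (snd s)) w) =
      (\<lambda>(p\<^sub>1, v\<^sub>1, p\<^sub>2, v\<^sub>2, p\<^sub>3). ((p\<^sub>1, v\<^sub>1, p\<^sub>2 @ p\<^sub>3), (p\<^sub>2, v\<^sub>2, p\<^sub>3))) ` T"
  proof (intro equalityI subsetI)
    fix y assume "y \<in> (SIGMA s:splits u r w. splits (fst (snd s)) (snd (snd s)) w)"
    then obtain p v q p' v' q' where "y = ((p, v, q), (p', v', q'))"
      "(p, v, q) \<in> splits u r w" "(p', v', q') \<in> splits v q w" by auto
    then show "y \<in> (\<lambda>(p\<^sub>1, v\<^sub>1, p\<^sub>2, v\<^sub>2, p\<^sub>3). ((p\<^sub>1, v\<^sub>1, p\<^sub>2 @ p\<^sub>3), (p\<^sub>2, v\<^sub>2, p\<^sub>3))) ` T"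
      by (intro image_eqI[of _ _ "(p, v, p', v', q')"]) (auto simp: splits_def T_def)
  qed (auto simp: splits_def T_def)
  also have "(\<Oplus>p\<in>\<dots>.
      f (fst (snd (snd p)), snd (snd (snd p)), w) \<otimes> g (fst (snd (fst p)), fst (snd p), fst (snd (snd p)))
        \<otimes> h (u, fst (fst p), fst (snd (fst p)))) = (\<Oplus>p\<in>T. ?F p)"
    by (subst K.finsum_reindex) (auto simp: inj_on_def case_prod_beta')
  finally have 1: "(f \<otimes>\<^bsub>PA\<^esub> g \<otimes>\<^bsub>PA\<^esub> h) x = (\<Oplus>p\<in>T. ?F p)" .
  have "(f \<otimes>\<^bsub>PA\<^esub> (g \<otimes>\<^bsub>PA\<^esub> h)) x = (\<Oplus>s\<in>splits u r w. f (fst (snd s), snd (snd s), w) \<otimes>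
      (\<Oplus>t\<in>splits u (fst s) (fst (snd s)). g (fst (snd t), snd (snd t), fst (snd s)) \<otimes>
        h (u, fst t, fst (snd t))))"
    by (simp add: x PA_simps)
  also have "\<dots> = (\<Oplus>s\<in>splits u r w. \<Oplus>t\<in>splits u (fst s) (fst (snd s)).
      f (fst (snd s), snd (snd s), w) \<otimes> g (fst (snd t), snd (snd t), fst (snd s)) \<otimes> h (u, fst t, fst (snd t)))"
    by (intro K.finsum_cong') (auto simp: K.finsum_rdistr K.m_assoc intro!: K.finsum_closed)
  also have "\<dots> = (\<Oplus>p\<in>(SIGMA s:splits u r w. splits u (fst s) (fst (snd s))).
      f (fst (snd (fst p)), snd (snd (fst p)), w) \<otimes>
      g (fst (snd (snd p)), snd (snd (snd p)), fst (snd (fst p))) \<otimes> h (u, fst (snd p), fst (snd (snd p))))"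
    by (subst K.finsum_Sigma) auto
  \<comment> \<open>In this bracketing the first part of the outer factorisation is divided again;
    in the other one it was the second part.\<close>
  also have "(SIGMA s:splits u r w. splits u (fst s) (fst (snd s))) =
      (\<lambda>(p\<^sub>1, v\<^sub>1, p\<^sub>2, v\<^sub>2, p\<^sub>3). ((p\<^sub>1 @ p\<^sub>2, v\<^sub>2, p\<^sub>3), (p\<^sub>1, v\<^sub>1, p\<^sub>2))) ` T"
  proof (intro equalityI subsetI)
    fix y assume "y \<in> (SIGMA s:splits u r w. splits u (fst s) (fst (snd s)))"
    then obtain p v q p' v' q' where "y = ((p, v, q), (p', v', q'))"
      "(p, v, q) \<in> splits u r w" "(p', v', q') \<in> splits u p v" by auto
    then show "y \<in> (\<lambda>(p\<^sub>1, v\<^sub>1, p\<^sub>2, v\<^sub>2, p\<^sub>3). ((p\<^sub>1 @ p\<^sub>2, v\<^sub>2, p\<^sub>3), (p\<^sub>1, v\<^sub>1, p\<^sub>2))) ` T"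
      by (intro image_eqI[of _ _ "(p', v', q', v, q)"]) (auto simp: splits_def T_def)
  qed (auto simp: splits_def T_def)
  also have "(\<Oplus>p\<in>\<dots>. f (fst (snd (fst p)), snd (snd (fst p)), w) \<otimes>
      g (fst (snd (snd p)), snd (snd (snd p)), fst (snd (fst p))) \<otimes> h (u, fst (snd p), fst (snd (snd p)))) =
      (\<Oplus>p\<in>T. ?F p)"
    by (subst K.finsum_reindex) (auto simp: inj_on_def case_prod_beta')
  finally show "(f \<otimes>\<^bsub>PA\<^esub> g \<otimes>\<^bsub>PA\<^esub> h) x = (f \<otimes>\<^bsub>PA\<^esub> (g \<otimes>\<^bsub>PA\<^esub> h)) x"
    using 1 by simp
qed

lemma PA_one_closed: "\<one>\<^bsub>PA\<^esub> \<in> carrier PA"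
  unfolding PA_carrier
proof (intro conjI allI impI)
  fix r :: "('v, 'e) qpath"
  show "\<one>\<^bsub>PA\<^esub> r \<in> carrier K" by (cases r) (simp add: PA_simps)
next
  have "{r. \<one>\<^bsub>PA\<^esub> r \<noteq> \<zero>} \<subseteq> (\<lambda>u. (u, [], u)) ` verts Q"
    by (auto simp: PA_simps awalk_Nil_iff split: if_splits)
  then show "finite {r. \<one>\<^bsub>PA\<^esub> r \<noteq> \<zero>}" by (rule finite_subset) simp
qed (simp add: PA_simps)

text \<open>The left factor is evaluated at the second part of a factorisation, so only the one
  ending in a trivial path contributes.\<close>

lemma PA_one_left:
  assumes f: "f \<in> carrier PA"
  shows "\<one>\<^bsub>PA\<^esub> \<otimes>\<^bsub>PA\<^esub> f = f"
proof (rule ext)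
  fix x :: "('v, 'e) qpath"
  obtain u r w where x: "x = (u, r, w)" by (cases x)
  show "(\<one>\<^bsub>PA\<^esub> \<otimes>\<^bsub>PA\<^esub> f) x = f x"
  proof (cases "awalk u r w")
    case True
    then have w: "awalk w [] w" by (auto simp: awalk_Nil_iff)
    have "(\<one>\<^bsub>PA\<^esub> \<otimes>\<^bsub>PA\<^esub> f) x = (\<Oplus>s\<in>splits u r w. if (r, w, []) = s then f (u, fst s, fst (snd s)) else \<zero>)"
      unfolding x PA_simps(5) using f
      by (intro K.finsum_cong') (auto simp: PA_simps splits_def awalk_Nil_iff)
    also have "\<dots> = f (u, r, w)"
    proof -
      have "(r, w, []) \<in> splits u r w" using True w by (simp add: splits_def)
      then show ?thesis using f by (subst K.finsum_singleton) auto
    qed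
    finally show ?thesis by (simp add: x)
  next
    case False
    then have "splits u r w = {}" using splits_nonempty by fast
    then show ?thesis using PA_carrierD(2)[OF f False] by (simp add: x PA_simps)
  qed
qed

lemma PA_one_right:
  assumes f: "f \<in> carrier PA"
  shows "f \<otimes>\<^bsub>PA\<^esub> \<one>\<^bsub>PA\<^esub> = f"
proof (rule ext)
  fix x :: "('v, 'e) qpath"
  obtain u r w where x: "x = (u, r, w)" by (cases x)
  show "(f \<otimes>\<^bsub>PA\<^esub> \<one>\<^bsub>PA\<^esub>) x = f x"
  proof (cases "awalk u r w")
    case True
    then have w: "awalk u [] u" by (auto simp: awalk_Nil_iff)
    have "(f \<otimes>\<^bsub>PA\<^esub> \<one>\<^bsub>PA\<^esub>) x = (\<Oplus>s\<in>splits u r w. if ([], u, r) = s then f (fst (snd s), snd (snd s), w) else \<zero>)"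
      unfolding x PA_simps(5) using f
      by (intro K.finsum_cong') (auto simp: PA_simps splits_def awalk_Nil_iff)
    also have "\<dots> = f (u, r, w)"
    proof -
      have "([], u, r) \<in> splits u r w" using True w by (simp add: splits_def)
      then show ?thesis using f by (subst K.finsum_singleton) auto
    qed
    finally show ?thesis by (simp add: x)
  next
    case False
    then have "splits u r w = {}" using splits_nonempty by fast
    then show ?thesis using PA_carrierD(2)[OF f False] by (simp add: x PA_simps)
  qed
qed

lemma PA_abelian_group: "abelian_group PA"
proof (rule abelian_groupI)
  fix f g assume f: "f \<in> carrier PA" and g: "g \<in> carrier PA"
  have "{r. f r \<oplus> g r \<noteq> \<zero>} \<subseteq> {r. f r \<noteq> \<zero>} \<union> {r. g r \<noteq> \<zero>}" by auto
  moreover have "finite ({r. f r \<noteq> \<zero>} \<union> {r. g r \<noteq> \<zero>})"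
    using PA_carrierD(3)[OF f] PA_carrierD(3)[OF g] by simp
  ultimately have "finite {r. f r \<oplus> g r \<noteq> \<zero>}" by (rule finite_subset)
  then show "f \<oplus>\<^bsub>PA\<^esub> g \<in> carrier PA"
    unfolding PA_simps(2) PA_carrier[of "\<lambda>r. f r \<oplus> g r"]
    using PA_carrierD(1,2)[OF f] PA_carrierD(1,2)[OF g] by simp
  show "f \<oplus>\<^bsub>PA\<^esub> g = g \<oplus>\<^bsub>PA\<^esub> f"
    using f g by (auto simp: PA_simps K.a_comm)
next
  fix f g h assume "f \<in> carrier PA" "g \<in> carrier PA" "h \<in> carrier PA"
  then show "f \<oplus>\<^bsub>PA\<^esub> g \<oplus>\<^bsub>PA\<^esub> h = f \<oplus>\<^bsub>PA\<^esub> (g \<oplus>\<^bsub>PA\<^esub> h)"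
    by (auto simp: PA_simps K.a_assoc)
next
  show "\<zero>\<^bsub>PA\<^esub> \<in> carrier PA" unfolding PA_simps PA_carrier by simp
next
  fix f assume f: "f \<in> carrier PA"
  then show "\<zero>\<^bsub>PA\<^esub> \<oplus>\<^bsub>PA\<^esub> f = f" by (simp add: PA_simps)
  have "{r. \<ominus> f r \<noteq> \<zero>} \<subseteq> {r. f r \<noteq> \<zero>}" by auto
  then have "finite {r. \<ominus> f r \<noteq> \<zero>}" using PA_carrierD(3)[OF f] by (rule finite_subset)
  then have "(\<lambda>r. \<ominus> f r) \<in> carrier PA"
    unfolding PA_carrier[of "\<lambda>r. \<ominus> f r"] using PA_carrierD(1,2)[OF f] by simp
  moreover have "(\<lambda>r. \<ominus> f r) \<oplus>\<^bsub>PA\<^esub> f = \<zero>\<^bsub>PA\<^esub>"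
    using f by (simp add: PA_simps K.l_neg)
  ultimately show "\<exists>g\<in>carrier PA. g \<oplus>\<^bsub>PA\<^esub> f = \<zero>\<^bsub>PA\<^esub>" by blast
qed

lemma PA_ring: "ring PA"
proof (rule ringI[OF PA_abelian_group])
  show "monoid PA"
    by (rule monoidI) (auto simp: PA_mult_closed PA_one_closed PA_mult_assoc PA_one_left PA_one_right)
next
  fix f g h assume c: "f \<in> carrier PA" "g \<in> carrier PA" "h \<in> carrier PA"
  show "(f \<oplus>\<^bsub>PA\<^esub> g) \<otimes>\<^bsub>PA\<^esub> h = f \<otimes>\<^bsub>PA\<^esub> h \<oplus>\<^bsub>PA\<^esub> g \<otimes>\<^bsub>PA\<^esub> h"
  proof (rule ext)
    fix x :: "('v, 'e) qpath"
    obtain u r w where x: "x = (u, r, w)" by (cases x)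
    have "((f \<oplus>\<^bsub>PA\<^esub> g) \<otimes>\<^bsub>PA\<^esub> h) x = (\<Oplus>s\<in>splits u r w.
        f (fst (snd s), snd (snd s), w) \<otimes> h (u, fst s, fst (snd s)) \<oplus>
        g (fst (snd s), snd (snd s), w) \<otimes> h (u, fst s, fst (snd s)))"
      unfolding x PA_simps(5) using c
      by (intro K.finsum_cong') (auto simp: PA_simps(2) K.l_distr)
    also have "\<dots> = (f \<otimes>\<^bsub>PA\<^esub> h \<oplus>\<^bsub>PA\<^esub> g \<otimes>\<^bsub>PA\<^esub> h) x"
      unfolding PA_simps(2) x PA_simps(5) using c by (intro K.finsum_addf) auto
    finally show "((f \<oplus>\<^bsub>PA\<^esub> g) \<otimes>\<^bsub>PA\<^esub> h) x = (f \<otimes>\<^bsub>PA\<^esub> h \<oplus>\<^bsub>PA\<^esub> g \<otimes>\<^bsub>PA\<^esub> h) x" .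
  qed
  show "h \<otimes>\<^bsub>PA\<^esub> (f \<oplus>\<^bsub>PA\<^esub> g) = h \<otimes>\<^bsub>PA\<^esub> f \<oplus>\<^bsub>PA\<^esub> h \<otimes>\<^bsub>PA\<^esub> g"
  proof (rule ext)
    fix x :: "('v, 'e) qpath"
    obtain u r w where x: "x = (u, r, w)" by (cases x)
    have "(h \<otimes>\<^bsub>PA\<^esub> (f \<oplus>\<^bsub>PA\<^esub> g)) x = (\<Oplus>s\<in>splits u r w.
        h (fst (snd s), snd (snd s), w) \<otimes> f (u, fst s, fst (snd s)) \<oplus>
        h (fst (snd s), snd (snd s), w) \<otimes> g (u, fst s, fst (snd s)))"
      unfolding x PA_simps(5) using c
      by (intro K.finsum_cong') (auto simp: PA_simps(2) K.r_distr)
    also have "\<dots> = (h \<otimes>\<^bsub>PA\<^esub> f \<oplus>\<^bsub>PA\<^esub> h \<otimes>\<^bsub>PA\<^esub> g) x"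
      unfolding PA_simps(2) x PA_simps(5) using c by (intro K.finsum_addf) auto
    finally show "(h \<otimes>\<^bsub>PA\<^esub> (f \<oplus>\<^bsub>PA\<^esub> g)) x = (h \<otimes>\<^bsub>PA\<^esub> f \<oplus>\<^bsub>PA\<^esub> h \<otimes>\<^bsub>PA\<^esub> g) x" .
  qed
qed

text \<open>The support of a scalar multiple of the unit lies in that of the unit, which is finite
  because there are finitely many vertices.\<close>

lemma finite_alg_PA:
  assumes "finite (carrier K)"
  shows "finite_alg K PA"
proof (rule finite_alg.intro[OF PA_ring assms])
  fix c assume c: "c \<in> carrier K"
  note one = PA_carrierD[OF PA_one_closed]
  have "{r. c \<otimes> \<one>\<^bsub>PA\<^esub> r \<noteq> \<zero>} \<subseteq> {r. \<one>\<^bsub>PA\<^esub> r \<noteq> \<zero>}" using c by auto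
  then have "finite {r. c \<otimes> \<one>\<^bsub>PA\<^esub> r \<noteq> \<zero>}" using one(3) by (rule finite_subset)
  then show "c \<odot>\<^bsub>PA\<^esub> \<one>\<^bsub>PA\<^esub> \<in> carrier PA"
    unfolding PA_simps(3) PA_carrier[of "\<lambda>r. c \<otimes> \<one>\<^bsub>PA\<^esub> r"] using c one(1,2) by simp
qed (use PA_carrierD(1)[OF PA_one_closed] in \<open>auto simp: PA_simps(1,3)\<close>)

end

theorem theorem3p1:
  fixes K :: "('k, 'x) ring_scheme"
    and Q :: "('v, 'e) pre_digraph"
  assumes "field K"
    and "finite (carrier K)"
    and "fin_digraph Q"
    and "\<not> (\<exists>p. pre_digraph.cycle Q p)"
  shows "universal_PBW_basis (hall_algebra K (path_algebra K Q))
           (indecomposables K (path_algebra K Q))"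
proof -
  interpret quiver: finite_quiver K Q
    using assms(1,3) by (rule finite_quiver.intro)
  show ?thesis
    by (rule finite_alg.hall_algebra_PBW[OF quiver.finite_alg_PA[OF assms(2)]])
qed

end
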